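(* For each of the five Mukai threefolds below, consider the three-term linear recurrence $$n^3 u_n = P(n)\,u_{n-1} + Q(n)\,u_{n-2},$$ with $P,Q$ given by: - $V_{10}$: $P(n)=2(2n-1)(11n^2-11n+3)$, $Q(n)=4(n-1)(2n-1)(2n-3)$; - $V_{12}$: $P(n)=(2n-1)(17n^2-17n+5)$, $Q(n)=-(n-1)^3$; - $V_{14}$: $P(n)=(2n-1)(13n^2-13n+4)$, $Q(n)=3(n-1)(3n-2)(3n-4)$; - $V_{16}$: $P(n)=4(2n-1)(3n^2-3n+1)$, $Q(n)=-16(n-1)^3$; - $V_{18}$: $P(n)=3(2n-1)(3n^2-3n+1)$, $Q(n)=27(n-1)^3$. Define two rational sequences for each case. - $(a_n)_{n\ge 0}$ is the solution with $a_0=1$ that satisfies the recurrence for all $n\ge 1$, with the convention $a_{-1}=0$. - $(b_n)_{n\ge 0}$ is the solution with $b_0=0$, $b_1=1$ that satisfies the recurrence for all $n\ge 2$. Then the limit $\lim_{n\to+\infty} b_n/a_n$ exists and equals: - $\frac{1}{10}\zeta(2)$ for $V_{10}$; - $\frac16\zeta(3)$ for $V_{12}$; - $\frac17\zeta(2)$ for $V_{14}$; - $\frac{7}{32}\zeta(3)$ for $V_{16}$; - $\frac13 L(\chi_3,3)$ for $V_{18}$.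
   Context: These recurrences are the regularized quantum recurrences of the Mukai threefolds $V_{10},\dots,V_{18}$. Each is the recurrence on the coefficients $u_n$ of a power series $\sum_n u_n t^n$ annihilated by the corresponding operator below, where $D=t\,\frac{d}{dt}$: - $V_{10}$: $D^3-2t(2D+1)(11D^2+11D+3)-4t^2(D+1)(2D+3)(2D+1)$; - $V_{12}$: $D^3-t(2D+1)(17D^2+17D+5)+t^2(D+1)^3$; - $V_{14}$: $D^3-t(2D+1)(13D^2+13D+4)-3t^2(D+1)(3D+4)(3D+2)$; - $V_{16}$: $D^3-4t(2D+1)(3D^2+3D+1)+16t^2(D+1)^3$; - $V_{18}$: $D^3-3t(2D+1)(3D^2+3D+1)-27t^2(D+1)^3$. Here $\zeta$ is the Riemann zeta function. $L(\chi_3,s)=\sum_{n\ge1}\chi_3(n)n^{-s}$ is the Dirichlet $L$-function of the nontrivial Dirichlet character $\chi_3(n)=\left(\frac{n}{3}\right)$ modulo $3$. *)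

theory Defs
  imports "HOL-Analysis.Analysis" "HOL-Number_Theory.Number_Theory"
begin

fun rec_seq :: "(nat \<Rightarrow> real) \<Rightarrow> (nat \<Rightarrow> real) \<Rightarrow> real \<Rightarrow> real \<Rightarrow> nat \<Rightarrow> real" where
  "rec_seq P Q u0 u1 0 = u0"
| "rec_seq P Q u0 u1 (Suc 0) = u1"
| "rec_seq P Q u0 u1 (Suc (Suc n)) =
     (P (Suc (Suc n)) * rec_seq P Q u0 u1 (Suc n) + Q (Suc (Suc n)) * rec_seq P Q u0 u1 n)
       / (real (Suc (Suc n)))^3"

text \<open>a: a_0 = 1, a_(-1) = 0, recurrence for n >= 1, so a_1 = P(1) a_0 / 1^3.\<close>
definition seq_a :: "(nat \<Rightarrow> real) \<Rightarrow> (nat \<Rightarrow> real) \<Rightarrow> nat \<Rightarrow> real" where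
  "seq_a P Q = rec_seq P Q 1 ((P 1 * 1 + Q 1 * 0) / (real 1)^3)"

definition seq_b :: "(nat \<Rightarrow> real) \<Rightarrow> (nat \<Rightarrow> real) \<Rightarrow> nat \<Rightarrow> real" where
  "seq_b P Q = rec_seq P Q 0 1"

definition P10 :: "nat \<Rightarrow> real" where "P10 n = 2*(2*real n-1)*(11*(real n)^2-11*real n+3)"
definition Q10 :: "nat \<Rightarrow> real" where "Q10 n = 4*(real n-1)*(2*real n-1)*(2*real n-3)"
definition P12 :: "nat \<Rightarrow> real" where "P12 n = (2*real n-1)*(17*(real n)^2-17*real n+5)"
definition Q12 :: "nat \<Rightarrow> real" where "Q12 n = -((real n-1)^3)"
definition P14 :: "nat \<Rightarrow> real" where "P14 n = (2*real n-1)*(13*(real n)^2-13*real n+4)"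
definition Q14 :: "nat \<Rightarrow> real" where "Q14 n = 3*(real n-1)*(3*real n-2)*(3*real n-4)"
definition P16 :: "nat \<Rightarrow> real" where "P16 n = 4*(2*real n-1)*(3*(real n)^2-3*real n+1)"
definition Q16 :: "nat \<Rightarrow> real" where "Q16 n = -16*(real n-1)^3"
definition P18 :: "nat \<Rightarrow> real" where "P18 n = 3*(2*real n-1)*(3*(real n)^2-3*real n+1)"
definition Q18 :: "nat \<Rightarrow> real" where "Q18 n = 27*(real n-1)^3"

definition zeta_int :: "nat \<Rightarrow> real" where
  "zeta_int s = (\<Sum>n. 1 / (real (Suc n))^s)"

definition L_chi3 :: "nat \<Rightarrow> real" where
  "L_chi3 s = (\<Sum>n. real_of_int (Legendre (int (Suc n)) 3) / (real (Suc n))^s)"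

end

theory Submission
  imports Defs "HOL-Real_Asymp.Real_Asymp" "HOL-Complex_Analysis.Complex_Analysis"
begin

text \<open>
  In each case there is a solution \<open>I n\<close> of the recurrence which grows strictly slower than
  \<open>a n\<close>.  Writing \<open>I n = I 0 * a n + \<beta> * b n\<close> with \<open>\<beta> = I 1 - P 1 * I 0\<close> and dividing by \<open>a n\<close>
  gives \<open>b n / a n \<longlonglongrightarrow> - I 0 / \<beta>\<close>.

  For V10, V12, V14 and V16 the solution is a series of values, of derivatives, or of alternating
  values at half-integers of a rational function, in the style of Beukers, Gutnik and Nesterenko;
  the recurrence holds because the corresponding combination of rational functions telescopes,
  with a certificate found by Zeilberger's algorithm.

  For V18 it is, up to the factor \<open>(-27)^n\<close>, the integral of \<open>\<mu> n h * \<nu> n h\<close> over \<open>h > 0\<close>, where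
  \<open>\<mu>\<close> and \<open>\<nu>\<close> are Legendre-type integrals satisfying three-term recurrences in \<open>n\<close> and first-order
  differential systems in \<open>h\<close>; the recurrence is the derivative of a bilinear expression in
  \<open>\<mu>\<close> and \<open>\<nu>\<close>.  The integral with \<open>n = 0\<close> is the real part of a contour integral of
  \<open>(Ln z - \<i> \<pi> / 3)\<^sup>2 / (1 - z + z\<^sup>2)\<close> along a vertical ray from \<open>\<rho> = exp (\<i> \<pi> / 3)\<close>, and rotating
  the contour to the ray \<open>\<rho> x\<close>, \<open>x \<ge> 1\<close>, turns it into the integral of
  \<open>3 (ln x)\<^sup>2 / (1 + x + x\<^sup>2)\<close>, that is, \<open>6 L(\<chi>\<^sub>3, 3)\<close>.
\<close>

section \<open>Solutions of small growth\<close>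

text \<open>No asymptotics of either solution are computed. It suffices to find \<open>c\<close>
  with \<open>a n\<close> at least a positive multiple of \<open>c ^ n\<close> and
  \<open>f n / c ^ n\<close> tending to 0. The constants 6, 5, 4, 6, 3 used for V10, V12, V14, V16,
  V18 lie far below the dominant characteristic roots (about 44.4, 34.0, 27, 23.3, 19.4), so crude
  factor-by-factor bounds on the small solution are enough: up to constants \<open>4 ^ n\<close>,
  \<open>n + 1\<close>, \<open>2 ^ n\<close>, \<open>(n + 1) * 4 ^ n\<close> and
  \<open>(27 / 10) ^ n\<close>. What has to be exact is the boundary data. The small solution obeys
  the recurrence only from \<open>n = 2\<close> on; its value at 0 and its defect \<beta> at
  \<open>n = 1\<close> carry the whole answer. So for \<open>n >= 2\<close> every telescoping or
  integrated term must contribute nothing at either end, and this decides the choice of summation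
  points, shifts and estimates below. V12 is Apery's recurrence for zeta(3) itself, and V10 is
  Apery's recurrence for zeta(2) multiplied termwise by the central binomial coefficients.\<close>

lemma solution_eq_combination:
  fixes P Q f :: "nat \<Rightarrow> real"
  assumes rec: "\<And>n. n \<ge> 2 \<Longrightarrow> real n ^ 3 * f n = P n * f (n - 1) + Q n * f (n - 2)"
  shows "f n = f 0 * seq_a P Q n + (f 1 - P 1 * f 0) * seq_b P Q n"
proof (induction n rule: less_induct)
  case (less n)
  consider "n = 0" | "n = 1" | m where "n = Suc (Suc m)"
    by (metis One_nat_def not0_implies_Suc)
  then show ?case
  proof cases
    case 3
    have A: "seq_a P Q n = (P n * seq_a P Q (Suc m) + Q n * seq_a P Q m) / real n ^ 3"
      and B: "seq_b P Q n = (P n * seq_b P Q (Suc m) + Q n * seq_b P Q m) / real n ^ 3"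
      by (simp_all add: 3 seq_a_def seq_b_def del: of_nat_Suc)
    have "f n = (P n * f (Suc m) + Q n * f m) / real n ^ 3"
      using rec[of n] 3 by (simp add: field_simps)
    also have "P n * f (Suc m) + Q n * f m =
        f 0 * (P n * seq_a P Q (Suc m) + Q n * seq_a P Q m) +
        (f 1 - P 1 * f 0) * (P n * seq_b P Q (Suc m) + Q n * seq_b P Q m)"
      unfolding less[of "Suc m", simplified 3, simplified] less[of m, simplified 3, simplified]
      by (simp add: algebra_simps)
    also have "\<dots> / real n ^ 3 = f 0 * seq_a P Q n + (f 1 - P 1 * f 0) * seq_b P Q n"
      unfolding A B by (simp add: add_divide_distrib diff_divide_distrib algebra_simps)
    finally show ?thesis .
  qed (auto simp: seq_a_def seq_b_def)
qed

lemma seq_a_rec: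
  assumes "n \<ge> 2"
  shows "real n ^ 3 * seq_a P Q n = P n * seq_a P Q (n - 1) + Q n * seq_a P Q (n - 2)"
proof -
  obtain m where "n = 2 + m" using assms le_Suc_ex by blast
  then have "n = Suc (Suc m)" by simp
  then show ?thesis by (simp add: seq_a_def del: of_nat_Suc)
qed

lemma seq_a_0 [simp]: "seq_a P Q 0 = 1"
  and seq_a_1 [simp]: "seq_a P Q (Suc 0) = P 1"
  by (simp_all add: seq_a_def)

lemma seq_a_growth:
  assumes c: "c > 0" and P1: "P 1 > 0" and P2: "P 2 * P 1 + Q 2 \<ge> 8 * c * P 1"
    and PQ: "\<And>n. n \<ge> 3 \<Longrightarrow> c * P n + min 0 (Q n) \<ge> c\<^sup>2 * real n ^ 3"
  shows "seq_a P Q n > 0 \<and> seq_a P Q (Suc (Suc n)) \<ge> c * seq_a P Q (Suc n) \<and> seq_a P Q (Suc n) > 0"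
proof (induction n)
  case 0
  \<comment> \<open>The 8 is \<open>2 ^ 3\<close>, the leading coefficient of the recurrence at
    \<open>n = 2\<close>.\<close>
  have "8 * seq_a P Q 2 = P 2 * P 1 + Q 2"
    using seq_a_rec[of 2 P Q] by simp
  then have "8 * (c * P 1) \<le> 8 * seq_a P Q 2" using P2 by simp
  then show ?case using P1 by (simp add: eval_nat_numeral)
next
  case (Suc n)
  define m where "m = Suc (Suc (Suc n))"
  define u where "u = seq_a P Q (Suc n)"
  define v where "v = seq_a P Q (Suc (Suc n))"
  have u: "u > 0" and v: "v \<ge> c * u" using Suc by (auto simp: u_def v_def)
  have v0: "v > 0" using u v c by (meson less_le_trans mult_pos_pos)
  have eq: "c * (real m ^ 3 * seq_a P Q m) = c * P m * v + c * Q m * u"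
    using seq_a_rec[of m P Q] by (simp add: m_def u_def v_def algebra_simps del: of_nat_Suc)
  have "c * Q m * u \<ge> min 0 (Q m) * v"
  proof (cases "Q m \<ge> 0")
    case True
    then show ?thesis using c u by simp
  next
    case False
    then have "Q m * v \<le> Q m * (c * u)" using v by (intro mult_left_mono_neg) auto
    then show ?thesis using False by (simp add: mult.commute mult.left_commute)
  qed
  then have "c * P m * v + c * Q m * u \<ge> (c * P m + min 0 (Q m)) * v"
    by (simp add: algebra_simps)
  moreover have "(c * P m + min 0 (Q m)) * v \<ge> c\<^sup>2 * real m ^ 3 * v"
    using PQ[of m] v0 by (intro mult_right_mono) (auto simp: m_def)
  ultimately have "c * real m ^ 3 * (c * v) \<le> c * real m ^ 3 * seq_a P Q m"
    using eq by (simp add: power2_eq_square algebra_simps)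
  moreover have "c * real m ^ 3 > 0" using c by (simp add: m_def)
  ultimately have "c * v \<le> seq_a P Q m" by (simp only: mult_le_cancel_left_pos)
  then show ?case using u v0 by (simp add: m_def u_def v_def)
qed

lemma seq_a_lower_bound:
  assumes c: "c > 0" and P1: "P 1 > 0" and "P 2 * P 1 + Q 2 \<ge> 8 * c * P 1"
    and "\<And>n. n \<ge> 3 \<Longrightarrow> c * P n + min 0 (Q n) \<ge> c\<^sup>2 * real n ^ 3"
  shows "seq_a P Q (Suc n) \<ge> P 1 * c ^ n"
proof (induction n)
  case (Suc n)
  have "P 1 * c ^ Suc n \<le> c * seq_a P Q (Suc n)" using Suc c by simp
  also have "\<dots> \<le> seq_a P Q (Suc (Suc n))" using seq_a_growth[OF assms] by blast
  finally show ?case .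
qed simp

text \<open>A solution growing strictly slower than \<open>a\<close> determines the limit of \<open>b / a\<close> through its
  first two values.\<close>

lemma apery_limit:
  fixes P Q f :: "nat \<Rightarrow> real"
  assumes c: "c > 0" and P1: "P 1 > 0" and P2: "P 2 * P 1 + Q 2 \<ge> 8 * c * P 1"
    and PQ: "\<And>n. n \<ge> 3 \<Longrightarrow> c * P n + min 0 (Q n) \<ge> c\<^sup>2 * real n ^ 3"
    and rec: "\<And>n. n \<ge> 2 \<Longrightarrow> real n ^ 3 * f n = P n * f (n - 1) + Q n * f (n - 2)"
    and small: "(\<lambda>n. f n / c ^ n) \<longlonglongrightarrow> 0"
    and b: "f 1 = P 1 * f 0 + \<beta>" "\<beta> \<noteq> 0"
  shows "(\<lambda>n. seq_b P Q n / seq_a P Q n) \<longlonglongrightarrow> - f 0 / \<beta>"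
proof -
  have a_pos: "seq_a P Q n > 0" for n using seq_a_growth[OF c P1 P2 PQ] by blast
  have "(\<lambda>n. f n / seq_a P Q n) \<longlonglongrightarrow> 0"
  proof (rule Lim_null_comparison)
    have "\<bar>f n / seq_a P Q n\<bar> \<le> c / P 1 * \<bar>f n / c ^ n\<bar>" if "n \<ge> 1" for n
    proof -
      have "P 1 * c ^ (n - 1) \<le> seq_a P Q n"
        using seq_a_lower_bound[OF c P1 P2 PQ, of "n - 1"] that by simp
      then have "\<bar>f n\<bar> / seq_a P Q n \<le> \<bar>f n\<bar> / (P 1 * c ^ (n - 1))"
        using P1 c a_pos[of n] by (intro divide_left_mono) auto
      also have "c * c ^ (n - 1) = c ^ n" using that by (cases n) auto
      then have "\<bar>f n\<bar> / (P 1 * c ^ (n - 1)) = c / P 1 * \<bar>f n / c ^ n\<bar>"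
        using c P1 by (simp add: field_simps abs_divide)
      finally show ?thesis using a_pos[of n] by (simp add: abs_divide)
    qed
    then show "\<forall>\<^sub>F n in sequentially. norm (f n / seq_a P Q n) \<le> c / P 1 * \<bar>f n / c ^ n\<bar>"
      by (intro eventually_sequentiallyI[of 1]) simp
    show "(\<lambda>n. c / P 1 * \<bar>f n / c ^ n\<bar>) \<longlonglongrightarrow> 0"
      by (intro tendsto_mult_right_zero tendsto_rabs_zero small)
  qed
  then have "(\<lambda>n. (f n / seq_a P Q n - f 0) / \<beta>) \<longlonglongrightarrow> (0 - f 0) / \<beta>"
    by (intro tendsto_intros b)
  moreover have "(f n / seq_a P Q n - f 0) / \<beta> = seq_b P Q n / seq_a P Q n" for n
  proof -
    have "f n = f 0 * seq_a P Q n + \<beta> * seq_b P Q n"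
      using solution_eq_combination[OF rec, of n] b by simp
    then have "f n / seq_a P Q n - f 0 = \<beta> * (seq_b P Q n / seq_a P Q n)"
      using a_pos[of n] by (simp add: add_divide_distrib)
    then show ?thesis using b by simp
  qed
  ultimately show ?thesis by simp
qed

section \<open>The case of V10\<close>

lemma zeta_int_sums:
  assumes "s \<ge> 2"
  shows "(\<lambda>n. 1 / (real n + 1) ^ s) sums zeta_int s"
proof -
  have "summable (\<lambda>n. 1 / (real n + 1) ^ s)"
    using summable_Suc_iff[THEN iffD2, OF inverse_power_summable[OF assms, where 'a = real]]
    by (simp add: inverse_eq_divide add.commute)
  then show ?thesis by (simp add: zeta_int_def summable_sums add.commute)
qed

lemma zeta_int_sums_shift:
  assumes "s \<ge> 2"
  shows "(\<lambda>n. 1 / (real n + 2) ^ s) sums (zeta_int s - 1)"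
  using sums_Suc_iff[of "\<lambda>n. 1 / (real n + 1) ^ s" "zeta_int s - 1"] zeta_int_sums[OF assms]
  by (simp add: add.commute)

text \<open>Its sums over the positive integers are Apery's linear forms in 1 and zeta(2). The sign
  \<open>(- 1) ^ n\<close> absorbs the alternation, so the sums themselves satisfy the
  recurrence.\<close>

definition R10 :: "nat \<Rightarrow> real \<Rightarrow> real" where
  "R10 n t = (- 1) ^ n * fact n * (\<Prod>j=1..n. t - real j) / (\<Prod>j=0..n. t + real j)\<^sup>2"

lemma R10_0: "R10 0 t = 1 / t\<^sup>2"
  by (simp add: R10_def)

lemma R10_Suc:
  "R10 (Suc n) t = - ((real n + 1) * (t - (real n + 1)) / (t + (real n + 1))\<^sup>2 * R10 n t)"
proof -
  have "(\<Prod>j=1..Suc n. t - real j) = (\<Prod>j=1..n. t - real j) * (t - (real n + 1))"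
    "(\<Prod>j=0..Suc n. t + real j) = (\<Prod>j=0..n. t + real j) * (t + (real n + 1))"
    "(fact (Suc n) :: real) = (real n + 1) * fact n"
    by (simp_all add: add.commute)
  then show ?thesis
    unfolding R10_def by (simp only: power_mult_distrib) (simp add: mult_ac)
qed

text \<open>Shifting \<open>n\<close> along with \<open>t\<close> avoids the quotient of
  \<open>R10 n (t + 1)\<close> by \<open>R10 n t\<close>, whose denominator contains
  \<open>t - n\<close> and so vanishes at a summation point.\<close>

lemma R10_shift:
  assumes "t > 0"
  shows "R10 (Suc n) (t + 1) =
    - ((real n + 1) * t ^ 3 / ((t + (real n + 1))\<^sup>2 * (t + (real n + 2))\<^sup>2) * R10 n t)"
proof (induction n)
  case 0
  have "t + 1 + 1 = t + 2" by simp
  then show ?case using assms by (simp add: R10_Suc R10_0 divide_simps) Groebner_Basis.algebra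
next
  case (Suc n)
  have pos: "t + (real n + 1) \<noteq> 0" "t + (real n + 2) \<noteq> 0" "t + (real n + 3) \<noteq> 0"
    using assms by simp_all
  have "real (Suc n) + 1 = real n + 2" "real (Suc n) + 2 = real n + 3"
    "t + 1 - (real n + 2) = t - (real n + 1)" "t + 1 + (real n + 2) = t + (real n + 3)" by simp_all
  then show ?case
    unfolding R10_Suc[of "Suc n" "t + 1"] Suc R10_Suc[of n t] using pos
    by (simp add: divide_simps diff_diff_eq add_ac)
qed

text \<open>Every factor in \<open>R10_Suc\<close> has absolute value at most 1. Decay in
  \<open>n\<close> is given up: the central binomials contribute at most \<open>4 ^ n\<close>,
  already below \<open>c ^ n\<close> with \<open>c = 6\<close>.\<close>

lemma R10_bound: "t \<ge> 1 \<Longrightarrow> \<bar>R10 n t\<bar> \<le> 1 / t\<^sup>2"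
proof (induction n)
  case (Suc n)
  have "\<bar>(real n + 1) * (t - (real n + 1)) / (t + (real n + 1))\<^sup>2\<bar> \<le> 1"
  proof -
    have "(real n + 1) * \<bar>t - (real n + 1)\<bar> \<le> (t + (real n + 1)) * (t + (real n + 1))"
      using Suc.prems by (intro mult_mono) auto
    then show ?thesis using Suc.prems by (simp add: abs_mult power2_eq_square add.commute)
  qed
  then have "\<bar>R10 (Suc n) t\<bar> \<le> 1 * \<bar>R10 n t\<bar>"
    unfolding R10_Suc abs_minus_cancel abs_mult[of _ "R10 n t"] by (intro mult_right_mono) auto
  then show ?case using Suc by simp
qed (simp add: R10_0)

definition cert10 :: "real \<Rightarrow> real \<Rightarrow> real" where
  "cert10 n t = - t\<^sup>2 + 3 * (2 * n - 1) * t + 11 * n\<^sup>2 - 13 * n + 4"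

text \<open>Every term is a rational multiple of \<open>R10 m t\<close>, so after clearing
  denominators a single polynomial identity in \<open>n\<close> and \<open>t\<close>
  remains.\<close>

lemma R10_telescope:
  fixes m :: nat
  defines "n \<equiv> real m + 2"
  assumes "t > 0"
  shows "n\<^sup>2 * R10 (m + 2) t - (11 * n\<^sup>2 - 11 * n + 3) * R10 (m + 1) t - (n - 1)\<^sup>2 * R10 m t =
    cert10 n (t + 1) * R10 (m + 1) (t + 1) - cert10 n t * R10 (m + 1) t"
proof -
  define X where "X = R10 m t"
  have 1: "R10 (m + 1) t = - ((n - 1) * (t - (n - 1)) / (t + (n - 1))\<^sup>2 * X)"
    using R10_Suc[of m t] by (simp add: n_def X_def add.commute)
  have 2: "R10 (m + 2) t = - (n * (t - n) / (t + n)\<^sup>2 * R10 (m + 1) t)"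
    using R10_Suc[of "m + 1" t] by (simp add: n_def add_ac)
  have 3: "R10 (m + 1) (t + 1) = - ((n - 1) * t ^ 3 / ((t + (n - 1))\<^sup>2 * (t + n)\<^sup>2) * X)"
    using R10_shift[OF assms(2), of m] by (simp add: n_def X_def add_ac)
  have pos: "t + (n - 1) > 0" "t + n > 0" using assms by (simp_all add: n_def)
  show ?thesis
    unfolding 2 3 1 cert10_def X_def[symmetric] using pos
    by (simp add: divide_simps) Groebner_Basis.algebra
qed

definition S10 :: "nat \<Rightarrow> real" where
  "S10 n = (\<Sum>k. R10 n (real k + 1))"

lemma R10_summable: "summable (\<lambda>k. R10 n (real k + 1))"
  by (rule summable_comparison_test'[OF sums_summable[OF zeta_int_sums[of 2]]])
     (use R10_bound[of "real _ + 1" n] in auto)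

lemma S10_bound: "\<bar>S10 n\<bar> \<le> zeta_int 2"
proof -
  have "summable (\<lambda>k. \<bar>R10 n (real k + 1)\<bar>)"
    by (rule summable_comparison_test'[OF sums_summable[OF zeta_int_sums[of 2]]])
     (use R10_bound[of "real _ + 1" n] in auto)
  then have "\<bar>S10 n\<bar> \<le> (\<Sum>k. \<bar>R10 n (real k + 1)\<bar>)"
    unfolding S10_def by (rule summable_rabs)
  also have "\<dots> \<le> (\<Sum>k. 1 / (real k + 1)\<^sup>2)"
    by (intro suminf_le R10_bound sums_summable[OF zeta_int_sums]) (auto simp: \<open>summable (\<lambda>k. \<bar>R10 n (real k + 1)\<bar>)\<close>)
  also have "\<dots> = zeta_int 2" using zeta_int_sums[of 2] by (simp add: sums_iff)
  finally show ?thesis .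
qed

lemma S10_rec:
  fixes m :: nat
  defines "n \<equiv> real m + 2"
  shows "n\<^sup>2 * S10 (m + 2) = (11 * n\<^sup>2 - 11 * n + 3) * S10 (m + 1) + (n - 1)\<^sup>2 * S10 m"
proof -
  define g where "g = (\<lambda>k. cert10 n (real k + 1) * R10 (m + 1) (real k + 1))"
  \<comment> \<open>The certificate is quadratic in \<open>t\<close>, so the bound
    \<open>1 / t ^ 2\<close> is not enough; peeling off one factor with \<open>R10_Suc\<close> gains
    another \<open>1 / t\<close>.\<close>
  have "g \<longlonglongrightarrow> 0"
  proof (rule Lim_null_comparison)
    show "\<forall>\<^sub>F k in sequentially. norm (g k) \<le>
        \<bar>cert10 n (real k + 1)\<bar> * ((n - 1) / (real k + 1 + (n - 1))) * (1 / (real k + 1)\<^sup>2)"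
    proof (rule always_eventually, rule allI)
      fix k
      define t where "t = real k + 1"
      have t: "t \<ge> 1" "n \<ge> 2" by (auto simp: t_def n_def)
      have "R10 (m + 1) t = - ((n - 1) * (t - (n - 1)) / (t + (n - 1))\<^sup>2 * R10 m t)"
        using R10_Suc[of m t] by (simp add: n_def add.commute)
      also have "\<bar>\<dots>\<bar> = (n - 1) * \<bar>t - (n - 1)\<bar> / (t + (n - 1))\<^sup>2 * \<bar>R10 m t\<bar>"
        using t by (simp add: abs_mult)
      also have "\<dots> \<le> (n - 1) / (t + (n - 1)) * (1 / t\<^sup>2)"
      proof (intro mult_mono R10_bound t)
        have "(n - 1) * \<bar>t - (n - 1)\<bar> \<le> (n - 1) * (t + (n - 1))"
          using t by (intro mult_left_mono) auto
        then show "(n - 1) * \<bar>t - (n - 1)\<bar> / (t + (n - 1))\<^sup>2 \<le> (n - 1) / (t + (n - 1))"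
          using t by (simp add: divide_simps power2_eq_square)
      qed (use t in auto)
      finally have "\<bar>cert10 n t\<bar> * \<bar>R10 (m + 1) t\<bar> \<le> \<bar>cert10 n t\<bar> * ((n - 1) / (t + (n - 1)) * (1 / t\<^sup>2))"
        by (rule mult_left_mono) simp
      then show "norm (g k) \<le>
          \<bar>cert10 n (real k + 1)\<bar> * ((n - 1) / (real k + 1 + (n - 1))) * (1 / (real k + 1)\<^sup>2)"
        by (simp add: g_def t_def abs_mult mult.assoc)
    qed
    show "(\<lambda>k. \<bar>cert10 n (real k + 1)\<bar> * ((n - 1) / (real k + 1 + (n - 1))) * (1 / (real k + 1)\<^sup>2)) \<longlonglongrightarrow> 0"
      unfolding cert10_def n_def by real_asymp
  qed
  \<comment> \<open>At the first summation point \<open>t = 1\<close> the factor with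
    \<open>j = 1\<close> vanishes; it is present because \<open>m + 1 >= 1\<close>.\<close>
  moreover have "(\<Prod>j=1..m+1. 1 - real j) = 0" by (rule prod_zero) auto
  then have "g 0 = 0" by (simp add: g_def R10_def)
  ultimately have "(\<lambda>k. g (Suc k) - g k) sums 0"
    using telescope_sums[of g 0] by simp
  moreover have "g (Suc k) - g k = n\<^sup>2 * R10 (m + 2) (real k + 1)
      - (11 * n\<^sup>2 - 11 * n + 3) * R10 (m + 1) (real k + 1) - (n - 1)\<^sup>2 * R10 m (real k + 1)" for k
    using R10_telescope[of "real k + 1" m] by (simp add: g_def n_def add_ac)
  moreover have "(\<lambda>k. n\<^sup>2 * R10 (m + 2) (real k + 1)
      - (11 * n\<^sup>2 - 11 * n + 3) * R10 (m + 1) (real k + 1) - (n - 1)\<^sup>2 * R10 m (real k + 1)) sums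
      (n\<^sup>2 * S10 (m + 2) - (11 * n\<^sup>2 - 11 * n + 3) * S10 (m + 1) - (n - 1)\<^sup>2 * S10 m)"
    unfolding S10_def by (intro sums_diff sums_mult summable_sums R10_summable)
  ultimately show ?thesis using sums_unique2 by fastforce
qed

lemma S10_0: "S10 0 = zeta_int 2"
  using zeta_int_sums[of 2] by (simp add: S10_def R10_0 sums_iff)

text \<open>Partial fractions: the double poles at 0 and -1 have coefficients 1 and 2, and the
  residues -3 and 3 are opposite, so the simple poles telescope.\<close>

lemma S10_1: "S10 1 = 3 * zeta_int 2 - 5"
proof -
  have "(\<lambda>k. 3 * (1 / (real (Suc k) + 1) - 1 / (real k + 1))) sums (3 * (0 - 1 / (real 0 + 1)))"
    by (intro sums_mult telescope_sums) real_asymp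
  note telescope = this
  have "(\<lambda>k. 1 / (real k + 1)\<^sup>2 + 2 * (1 / (real k + 2)\<^sup>2) +
      3 * (1 / (real (Suc k) + 1) - 1 / (real k + 1))) sums (zeta_int 2 + 2 * (zeta_int 2 - 1) + 3 * (0 - 1 / (real 0 + 1)))"
    by (intro sums_add[OF _ telescope] sums_add sums_mult zeta_int_sums zeta_int_sums_shift) auto
  moreover have "1 / (real k + 1)\<^sup>2 + 2 * (1 / (real k + 2)\<^sup>2) +
      3 * (1 / (real (Suc k) + 1) - 1 / (real k + 1)) = R10 1 (real k + 1)" for k
    by (simp add: R10_def divide_simps) Groebner_Basis.algebra
  ultimately show ?thesis by (simp add: S10_def sums_iff)
qed

lemma central_binomial_Suc:
  "real (Suc m) * real (2 * Suc m choose Suc m) = 2 * (2 * real m + 1) * real (2 * m choose m)"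
proof -
  have *: "real (2 * n choose n) = fact (2 * n) / (fact n * fact n)" for n
    by (simp add: binomial_fact)
  have "fact (2 * Suc m) = (2 * real m + 2) * (2 * real m + 1) * fact (2 * m)"
    "fact (Suc m) = (real m + 1) * fact m"
    by (simp_all add: algebra_simps)
  then show ?thesis
    unfolding * by (simp add: divide_simps del: fact_Suc) (simp add: algebra_simps)
qed

text \<open>The relation \<open>n * C n = 2 * (2 * n - 1) * C (n - 1)\<close> for the central
  binomials turns the recurrence of \<open>S10\<close> into that of V10. The defect -10 is read off
  from \<open>2 * (3 * zeta_int 2 - 5) = 6 * zeta_int 2 - 10\<close>, where 6 is
  \<open>P10 1\<close>.\<close>

lemma limit_V10: "(\<lambda>n. seq_b P10 Q10 n / seq_a P10 Q10 n) \<longlonglongrightarrow> zeta_int 2 / 10"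
proof -
  define C where "C = (\<lambda>n. real (2 * n choose n))"
  define f where "f = (\<lambda>n. C n * S10 n)"
  have C_Suc: "real (Suc m) * C (Suc m) = 2 * (2 * real m + 1) * C m" for m
    unfolding C_def by (rule central_binomial_Suc)
  have C_0: "C 0 = 1" and C_1: "C 1 = 2" by (simp_all add: C_def)
  have C_pos: "C n \<ge> 0" for n by (simp add: C_def)
  have C_le: "C n \<le> 4 ^ n" for n
  proof (induction n)
    case (Suc n)
    have "real (Suc n) * C (Suc n) \<le> (4 * real (Suc n)) * 4 ^ n"
      unfolding C_Suc using Suc C_pos[of n] by (intro mult_mono[of _ "4 * real (Suc n)"]) auto
    then show "C (Suc n) \<le> 4 ^ Suc n" by (simp add: mult.assoc mult.left_commute[of 4] del: of_nat_Suc)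
  qed (simp_all add: C_def)
  have "(\<lambda>n. seq_b P10 Q10 n / seq_a P10 Q10 n) \<longlonglongrightarrow> - f 0 / (- 10)"
  proof (rule apery_limit[where c = 6])
    show "6\<^sup>2 * real n ^ 3 \<le> 6 * P10 n + min 0 (Q10 n)" if "n \<ge> 3" for n
    proof -
      \<comment> \<open>Re-expanded around \<open>n = 3\<close>, the difference of the two sides has
        only positive coefficients; the other cases use the same device.\<close>
      define x where "x = real n - 3"
      have "x \<ge> 0" "real n = x + 3" using that by (auto simp: x_def)
      then show ?thesis by (simp add: P10_def Q10_def algebra_simps power2_eq_square power3_eq_cube)
    qed
    show "real n ^ 3 * f n = P10 n * f (n - 1) + Q10 n * f (n - 2)" if n: "n \<ge> 2" for n
    proof -
      obtain m where m: "n = m + 2" using le_add_diff_inverse2[OF n] by metis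
      define c where "c = C m"
      define N where "N = real m + 2"
      have N: "N \<ge> 2" by (simp add: N_def)
      have c1: "C (m + 1) = 2 * (2 * N - 3) / (N - 1) * c"
        using C_Suc[of m] N by (simp add: c_def N_def field_simps)
      have "N * C (m + 2) = 2 * (2 * N - 1) * C (m + 1)"
        using C_Suc[of "m + 1"] by (simp add: N_def algebra_simps)
      then have c2: "C (m + 2) = 2 * (2 * N - 1) / N * (2 * (2 * N - 3) / (N - 1) * c)"
        unfolding c1 using N by (simp add: nonzero_eq_divide_eq mult_ac)
      have "n - 1 = m + 1" "n - 2 = m" "real n = N" by (simp_all add: m N_def)
      then have "P10 n * f (n - 1) + Q10 n * f (n - 2) =
        2 * (2 * N - 1) * (11 * N\<^sup>2 - 11 * N + 3) * (2 * (2 * N - 3) / (N - 1) * c) * S10 (m + 1) +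
        4 * (N - 1) * (2 * N - 1) * (2 * N - 3) * c * S10 m"
        by (simp add: f_def P10_def Q10_def c1[simplified] flip: c_def)
      also have "\<dots> = (2 * (2 * N - 1) * (2 * (2 * N - 3) / (N - 1) * c)) *
         ((11 * N\<^sup>2 - 11 * N + 3) * S10 (m + 1) + (N - 1)\<^sup>2 * S10 m)"
        using N by (simp add: divide_simps) Groebner_Basis.algebra
      also have "\<dots> = (2 * (2 * N - 1) * (2 * (2 * N - 3) / (N - 1) * c)) * (N\<^sup>2 * S10 (m + 2))"
        using S10_rec[of m] by (simp add: N_def)
      also have "\<dots> = N ^ 3 * (C (m + 2) * S10 (m + 2))"
        unfolding c2 using N by (simp add: divide_simps power2_eq_square power3_eq_cube)
      also have "\<dots> = real n ^ 3 * f n" by (simp add: f_def m N_def add.commute)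
      finally show ?thesis by simp
    qed
    show "(\<lambda>n. f n / 6 ^ n) \<longlonglongrightarrow> 0"
    proof (rule Lim_null_comparison)
      show "\<forall>\<^sub>F n in sequentially. norm (f n / 6 ^ n) \<le> zeta_int 2 * (4 / 6) ^ n"
      proof (rule always_eventually, rule allI)
        fix n
        have "\<bar>f n\<bar> \<le> 4 ^ n * zeta_int 2"
          unfolding f_def abs_mult using C_le[of n] C_pos[of n] S10_bound[of n] by (intro mult_mono) auto
        then show "norm (f n / 6 ^ n) \<le> zeta_int 2 * (4 / 6) ^ n"
          unfolding power_divide by (simp add: divide_simps mult.commute)
      qed
      show "(\<lambda>n. zeta_int 2 * (4 / 6) ^ n) \<longlonglongrightarrow> 0"
        by (intro tendsto_mult_right_zero LIMSEQ_realpow_zero) auto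
    qed
    show "f 1 = P10 1 * f 0 + - 10"
      by (simp add: f_def P10_def C_0 C_1[simplified] S10_0 S10_1[simplified])
  qed (auto simp: P10_def Q10_def)
  then show ?thesis by (simp add: f_def C_0 S10_0)
qed

section \<open>The case of V12\<close>

text \<open>Boundary term at infinity. With \<open>h\<close> of order \<open>1 / t\<close>, the
  certificate times \<open>h ^ 2\<close> is merely bounded, but its derivative is of order
  \<open>1 / t\<close>.\<close>

lemma deriv_quadratic_times_square_tendsto_0:
  fixes h h' :: "real \<Rightarrow> real" and a b c A :: real
  assumes h: "\<forall>\<^sub>F t in at_top. (h has_real_derivative h' t) (at t)"
    and h_le: "\<forall>\<^sub>F t in at_top. \<bar>h t\<bar> \<le> A / t"
    and h'_le: "\<forall>\<^sub>F t in at_top. \<bar>h' t\<bar> \<le> A / t\<^sup>2"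
  shows "((\<lambda>t. deriv (\<lambda>t. (a * t\<^sup>2 + b * t + c) * (h t)\<^sup>2) t) \<longlongrightarrow> 0) at_top"
proof (rule Lim_null_comparison)
  show "\<forall>\<^sub>F t in at_top. norm (deriv (\<lambda>t. (a * t\<^sup>2 + b * t + c) * (h t)\<^sup>2) t) \<le>
      \<bar>2 * a * A\<^sup>2 * (1 / t) + b * A\<^sup>2 * (1 / t)\<^sup>2\<bar> +
        2 * A\<^sup>2 * \<bar>a * (1 / t) + b * (1 / t)\<^sup>2 + c * (1 / t) ^ 3\<bar>"
    using h h_le h'_le eventually_gt_at_top[of 0]
  proof eventually_elim
    case (elim t)
    have A: "A \<ge> 0" using elim(2,4) by (smt (verit) divide_neg_pos)
    have "((\<lambda>t. (a * t\<^sup>2 + b * t + c) * (h t)\<^sup>2) has_real_derivative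
        (2 * a * t + b) * (h t)\<^sup>2 + (a * t\<^sup>2 + b * t + c) * (2 * h t * h' t)) (at t)"
      by (rule derivative_eq_intros elim refl | simp add: algebra_simps)+
    then have "deriv (\<lambda>t. (a * t\<^sup>2 + b * t + c) * (h t)\<^sup>2) t =
        (2 * a * t + b) * (h t)\<^sup>2 + (a * t\<^sup>2 + b * t + c) * (2 * h t * h' t)"
      by (rule DERIV_imp_deriv)
    also have "\<bar>\<dots>\<bar> \<le> \<bar>2 * a * t + b\<bar> * \<bar>h t\<bar>\<^sup>2 + \<bar>a * t\<^sup>2 + b * t + c\<bar> * (2 * \<bar>h t\<bar> * \<bar>h' t\<bar>)"
      by (rule order_trans[OF abs_triangle_ineq]) (simp add: abs_mult)
    also have "\<dots> \<le> \<bar>2 * a * t + b\<bar> * (A / t)\<^sup>2 + \<bar>a * t\<^sup>2 + b * t + c\<bar> * (2 * (A / t) * (A / t\<^sup>2))"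
      using elim A by (intro add_mono mult_left_mono mult_mono power_mono) auto
    also have "\<dots> = \<bar>2 * a * A\<^sup>2 * (1 / t) + b * A\<^sup>2 * (1 / t)\<^sup>2\<bar> +
        2 * A\<^sup>2 * \<bar>a * (1 / t) + b * (1 / t)\<^sup>2 + c * (1 / t) ^ 3\<bar>"
    proof -
      have "\<bar>2 * a * t + b\<bar> * (A / t)\<^sup>2 = \<bar>(2 * a * t + b) * (A / t)\<^sup>2\<bar>"
        "\<bar>a * t\<^sup>2 + b * t + c\<bar> * (2 * (A / t) * (A / t\<^sup>2)) = 2 * A\<^sup>2 * \<bar>(a * t\<^sup>2 + b * t + c) * (1 / t) ^ 3\<bar>"
        using elim(4) A by (simp_all add: abs_mult power2_eq_square power3_eq_cube mult_ac)
      moreover have "(2 * a * t + b) * (A / t)\<^sup>2 = 2 * a * A\<^sup>2 * (1 / t) + b * A\<^sup>2 * (1 / t)\<^sup>2"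
        "(a * t\<^sup>2 + b * t + c) * (1 / t) ^ 3 = a * (1 / t) + b * (1 / t)\<^sup>2 + c * (1 / t) ^ 3"
        using elim(4) by (simp_all add: field_simps power2_eq_square power3_eq_cube)
      ultimately show ?thesis by simp
    qed
    finally show ?case by simp
  qed
  have "((\<lambda>t::real. 1 / t) \<longlongrightarrow> 0) at_top" by real_asymp
  then have "((\<lambda>t. \<bar>2 * a * A\<^sup>2 * (1 / t) + b * A\<^sup>2 * (1 / t)\<^sup>2\<bar> +
        2 * A\<^sup>2 * \<bar>a * (1 / t) + b * (1 / t)\<^sup>2 + c * (1 / t) ^ 3\<bar>) \<longlongrightarrow>
      \<bar>2 * a * A\<^sup>2 * 0 + b * A\<^sup>2 * 0\<^sup>2\<bar> + 2 * A\<^sup>2 * \<bar>a * 0 + b * 0\<^sup>2 + c * 0 ^ 3\<bar>) at_top"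
    by (intro tendsto_intros)
  then show "((\<lambda>t. \<bar>2 * a * A\<^sup>2 * (1 / t) + b * A\<^sup>2 * (1 / t)\<^sup>2\<bar> +
        2 * A\<^sup>2 * \<bar>a * (1 / t) + b * (1 / t)\<^sup>2 + c * (1 / t) ^ 3\<bar>) \<longlongrightarrow> 0) at_top"
    by simp
qed

text \<open>Derivatives of long products are controlled through the one-step ratio \<open>q\<close>:
  a bound \<rho> on \<open>q\<close> and \<rho>\<open>/ t\<close> on its derivative propagate by the
  product rule, and the factor \<open>n + 1\<close> counts the factors that may be differentiated.
  V12 uses \<rho> = 1, V16 uses \<rho> = 2.\<close>

lemma recursive_product_bounds:
  fixes h q q' :: "nat \<Rightarrow> real \<Rightarrow> real" and \<rho> :: real
  assumes h_0: "\<And>t. t > 0 \<Longrightarrow> h 0 t = 1 / t"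
    and h_Suc: "\<And>n t. t > 0 \<Longrightarrow> h (Suc n) t = q n t * h n t"
    and q: "\<And>n t. t > 0 \<Longrightarrow> (q n has_real_derivative q' n t) (at t)"
    and q_le: "\<And>n t. t > 0 \<Longrightarrow> \<bar>q n t\<bar> \<le> \<rho>"
    and q'_le: "\<And>n t. t > 0 \<Longrightarrow> \<bar>q' n t\<bar> \<le> \<rho> / t"
    and t: "t > 0"
  shows "(h n has_real_derivative deriv (h n) t) (at t) \<and> \<bar>h n t\<bar> \<le> \<rho> ^ n / t \<and>
    \<bar>deriv (h n) t\<bar> \<le> \<rho> ^ n * (real n + 1) / t\<^sup>2"
proof (induction n)
  case 0
  have "((\<lambda>t. 1 / t) has_real_derivative - (1 / t\<^sup>2)) (at t)"
    using t by (auto intro!: derivative_eq_intros simp: power2_eq_square)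
  then have "(h 0 has_real_derivative - (1 / t\<^sup>2)) (at t)"
    by (rule has_field_derivative_transform_within_open[where S = "{0<..}"])
       (use t h_0 in \<open>auto simp: open_greaterThan\<close>)
  moreover from this have "deriv (h 0) t = - (1 / t\<^sup>2)" by (rule DERIV_imp_deriv)
  ultimately show ?case using t h_0[OF t] by simp
next
  case (Suc n)
  have rho: "\<rho> \<ge> 0" using q_le[OF t] by (meson abs_ge_zero order_trans)
  have "((\<lambda>t. q n t * h n t) has_real_derivative q' n t * h n t + deriv (h n) t * q n t) (at t)"
    using Suc q[OF t] by (intro DERIV_mult) auto
  then have d: "(h (Suc n) has_real_derivative q' n t * h n t + deriv (h n) t * q n t) (at t)"
    by (rule has_field_derivative_transform_within_open[where S = "{0<..}"])
       (use t h_Suc in \<open>auto simp: open_greaterThan\<close>)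
  then have eq: "deriv (h (Suc n)) t = q' n t * h n t + deriv (h n) t * q n t"
    by (rule DERIV_imp_deriv)
  have "\<bar>h (Suc n) t\<bar> \<le> \<rho> * (\<rho> ^ n / t)"
    unfolding h_Suc[OF t] abs_mult using Suc q_le[OF t] rho by (intro mult_mono) auto
  moreover have "\<bar>deriv (h (Suc n)) t\<bar> \<le> \<rho> ^ Suc n * (real (Suc n) + 1) / t\<^sup>2"
  proof -
    have "\<bar>deriv (h (Suc n)) t\<bar> \<le> \<bar>q' n t\<bar> * \<bar>h n t\<bar> + \<bar>deriv (h n) t\<bar> * \<bar>q n t\<bar>"
      unfolding eq by (rule order_trans[OF abs_triangle_ineq]) (simp add: abs_mult)
    also have "\<dots> \<le> (\<rho> / t) * (\<rho> ^ n / t) + (\<rho> ^ n * (real n + 1) / t\<^sup>2) * \<rho>"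
      using Suc q_le[OF t] q'_le[OF t] rho t by (intro add_mono mult_mono) auto
    also have "\<dots> = \<rho> ^ Suc n * (real (Suc n) + 1) / t\<^sup>2"
      using t by (simp add: field_simps power2_eq_square)
    finally show ?thesis .
  qed
  ultimately show ?case using d eq by simp
qed

text \<open>Differentiating a telescoping identity between squares gives a telescoping identity
  between the products \<open>h * h'\<close>. Since \<open>k\<close> vanishes at the first point
  \<open>u\<close>, \<open>G\<close> has a double zero there, so the lower boundary term
  \<open>deriv G u\<close> disappears as well.\<close>

lemma telescoping_derivative_sum:
  fixes h0 h1 h2 k :: "real \<Rightarrow> real" and \<alpha> \<beta> \<gamma> :: real
  defines "G \<equiv> \<lambda>t. (\<alpha> * t\<^sup>2 + \<beta> * t + \<gamma>) * (k t)\<^sup>2"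
  assumes u: "u > 0"
    and eq: "\<And>t. t > 0 \<Longrightarrow> a * (h2 t)\<^sup>2 + b * (h1 t)\<^sup>2 + c * (h0 t)\<^sup>2 = G (t + 1) - G t"
    and h0: "\<And>t. t > 0 \<Longrightarrow> (h0 has_real_derivative h0' t) (at t)"
    and h1: "\<And>t. t > 0 \<Longrightarrow> (h1 has_real_derivative h1' t) (at t)"
    and h2: "\<And>t. t > 0 \<Longrightarrow> (h2 has_real_derivative h2' t) (at t)"
    and k: "\<And>t. t > 0 \<Longrightarrow> (k has_real_derivative k' t) (at t)"
    and k_le: "\<And>t. t > 0 \<Longrightarrow> \<bar>k t\<bar> \<le> A / t"
    and k'_le: "\<And>t. t > 0 \<Longrightarrow> \<bar>k' t\<bar> \<le> A / t\<^sup>2"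
    and k_u: "k u = 0"
    and S0: "(\<lambda>j. h0 (u + real j) * h0' (u + real j)) sums S0"
    and S1: "(\<lambda>j. h1 (u + real j) * h1' (u + real j)) sums S1"
    and S2: "(\<lambda>j. h2 (u + real j) * h2' (u + real j)) sums S2"
  shows "a * S2 + b * S1 + c * S0 = 0"
proof -
  have dG: "(G has_real_derivative
      (2 * \<alpha> * t + \<beta>) * (k t)\<^sup>2 + (\<alpha> * t\<^sup>2 + \<beta> * t + \<gamma>) * (2 * k t * k' t)) (at t)" if "t > 0" for t
    unfolding G_def by (rule derivative_eq_intros k that refl | simp add: algebra_simps)+
  have dG': "(G has_real_derivative deriv G t) (at t)" if "t > 0" for t
    using dG[OF that] by (metis DERIV_imp_deriv)
  have D: "2 * (a * (h2 t * h2' t) + b * (h1 t * h1' t) + c * (h0 t * h0' t)) =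
      deriv G (t + 1) - deriv G t" if t: "t > 0" for t
  proof -
    have "((\<lambda>t. G (t + 1) - G t) has_real_derivative deriv G (t + 1) * 1 - deriv G t) (at t)"
      by (intro DERIV_diff DERIV_chain2[where f = G] dG')
         (use t in \<open>auto intro!: derivative_eq_intros\<close>)
    then have 1: "((\<lambda>t. a * (h2 t)\<^sup>2 + b * (h1 t)\<^sup>2 + c * (h0 t)\<^sup>2) has_real_derivative
        deriv G (t + 1) * 1 - deriv G t) (at t)"
      by (rule has_field_derivative_transform_within_open[where S = "{0<..}"])
         (use t eq in \<open>auto simp: open_greaterThan\<close>)
    have 2: "((\<lambda>t. a * (h2 t)\<^sup>2 + b * (h1 t)\<^sup>2 + c * (h0 t)\<^sup>2) has_real_derivative
        2 * (a * (h2 t * h2' t) + b * (h1 t * h1' t) + c * (h0 t * h0' t))) (at t)"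
      by (rule derivative_eq_intros h0 h1 h2 t refl | simp add: algebra_simps)+
    show ?thesis using DERIV_unique[OF 1 2] by simp
  qed
  have "((\<lambda>t. deriv G t) \<longlongrightarrow> 0) at_top"
    unfolding G_def
    by (rule deriv_quadratic_times_square_tendsto_0[where h' = k' and A = A])
       (use k k_le k'_le in \<open>auto intro!: eventually_at_top_linorderI[of 1]\<close>)
  moreover have "filterlim (\<lambda>j. u + real j) at_top sequentially" by real_asymp
  ultimately have "(\<lambda>j. deriv G (u + real j)) \<longlonglongrightarrow> 0"
    by (rule filterlim_compose)
  then have "(\<lambda>j. deriv G (u + real (Suc j)) - deriv G (u + real j)) sums (0 - deriv G (u + real 0))"
    by (rule telescope_sums)
  moreover have "deriv G u = 0" using DERIV_imp_deriv[OF dG[OF u]] k_u by simp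
  moreover have "deriv G (u + real (Suc j)) - deriv G (u + real j) =
      2 * (a * (h2 (u + real j) * h2' (u + real j)) + b * (h1 (u + real j) * h1' (u + real j)) +
        c * (h0 (u + real j) * h0' (u + real j)))" for j
    using D[of "u + real j"] u by (simp add: add_ac)
  moreover have "(\<lambda>j. 2 * (a * (h2 (u + real j) * h2' (u + real j)) + b * (h1 (u + real j) * h1' (u + real j)) +
        c * (h0 (u + real j) * h0' (u + real j)))) sums (2 * (a * S2 + b * S1 + c * S0))"
    by (intro sums_mult sums_add S0 S1 S2)
  ultimately show ?thesis using sums_unique2 by fastforce
qed

section \<open>Apery's linear forms in 1 and zeta(3)\<close>

definition h12 :: "nat \<Rightarrow> real \<Rightarrow> real" where
  "h12 n t = (\<Prod>j=1..n. t - real j) / (\<Prod>j=0..n. t + real j)"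

lemma h12_0: "h12 0 t = 1 / t"
  by (simp add: h12_def)

lemma h12_Suc: "h12 (Suc n) t = (t - (real n + 1)) / (t + (real n + 1)) * h12 n t"
proof -
  have "(\<Prod>j=1..Suc n. t - real j) = (\<Prod>j=1..n. t - real j) * (t - (real n + 1))"
    "(\<Prod>j=0..Suc n. t + real j) = (\<Prod>j=0..n. t + real j) * (t + (real n + 1))"
    by (simp_all add: add.commute)
  then show ?thesis unfolding h12_def by (simp only:) (simp add: mult_ac)
qed

text \<open>As for \<open>R10_shift\<close>, the simultaneous shift in \<open>n\<close> and
  \<open>t\<close> leaves no factor \<open>t - n\<close> in a denominator.\<close>

lemma h12_shift:
  assumes "t > 0"
  shows "h12 (Suc n) (t + 1) = t\<^sup>2 / ((t + (real n + 1)) * (t + (real n + 2))) * h12 n t"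
proof (induction n)
  case 0
  have "t + 1 + 1 = t + 2" by simp
  then show ?case using assms by (simp add: h12_Suc h12_0 divide_simps power2_eq_square)
next
  case (Suc n)
  have pos: "t + (real n + 1) \<noteq> 0" "t + (real n + 2) \<noteq> 0" "t + (real n + 3) \<noteq> 0"
    using assms by simp_all
  have "real (Suc n) + 1 = real n + 2" "real (Suc n) + 2 = real n + 3"
    "t + 1 - (real n + 2) = t - (real n + 1)" "t + 1 + (real n + 2) = t + (real n + 3)" by simp_all
  then show ?case
    unfolding h12_Suc[of "Suc n" "t + 1"] Suc h12_Suc[of n t] using pos
    by (simp add: divide_simps diff_diff_eq add_ac)
qed

lemma h12_bounds:
  assumes "t > 0"
  shows "(h12 n has_real_derivative deriv (h12 n) t) (at t) \<and> \<bar>h12 n t\<bar> \<le> 1 ^ n / t \<and>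
    \<bar>deriv (h12 n) t\<bar> \<le> 1 ^ n * (real n + 1) / t\<^sup>2"
proof (rule recursive_product_bounds[where q' = "\<lambda>n t. 2 * (real n + 1) / (t + (real n + 1))\<^sup>2"])
  fix n and t :: real assume t: "t > 0"
  show "((\<lambda>t. (t - (real n + 1)) / (t + (real n + 1))) has_real_derivative
      2 * (real n + 1) / (t + (real n + 1))\<^sup>2) (at t)"
    using t by (auto intro!: derivative_eq_intros simp: power2_eq_square field_simps)
  show "\<bar>(t - (real n + 1)) / (t + (real n + 1))\<bar> \<le> 1" using t by simp
  have "2 * (real n + 1) * t \<le> (t + (real n + 1))\<^sup>2"
    using sum_squares_ge_zero[of t "real n + 1"] by (simp add: power2_sum power2_eq_square algebra_simps)
  then show "\<bar>2 * (real n + 1) / (t + (real n + 1))\<^sup>2\<bar> \<le> 1 / t"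
    using t by (simp add: divide_simps)
qed (use assms in \<open>auto simp: h12_0 h12_Suc\<close>)

text \<open>The summand is minus one half of the derivative of \<open>(h12 n) ^ 2\<close>; the half
  normalises \<open>I12 0\<close> to \<open>zeta_int 3\<close>.\<close>

definition I12 :: "nat \<Rightarrow> real" where
  "I12 n = (\<Sum>k. - (h12 n (1 + real k) * deriv (h12 n) (1 + real k)))"

lemma inverse_cube_eq: "A / (1 + real k) * (B / (1 + real k)\<^sup>2) = A * B * (1 / (real k + 1) ^ 3)"
  by (simp add: power2_eq_square power3_eq_cube add.commute)

lemma I12_term_bound: "\<bar>h12 n (1 + real k) * deriv (h12 n) (1 + real k)\<bar> \<le> (real n + 1) * (1 / (real k + 1) ^ 3)"
proof -
  have "\<bar>h12 n (1 + real k)\<bar> * \<bar>deriv (h12 n) (1 + real k)\<bar> \<le> 1 / (1 + real k) * ((real n + 1) / (1 + real k)\<^sup>2)"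
    using h12_bounds[of "1 + real k" n] by (intro mult_mono) auto
  then show ?thesis unfolding inverse_cube_eq by (simp add: abs_mult)
qed

lemma I12_sums: "(\<lambda>k. h12 n (1 + real k) * deriv (h12 n) (1 + real k)) sums - I12 n"
proof -
  have "summable (\<lambda>k. h12 n (1 + real k) * deriv (h12 n) (1 + real k))"
    by (rule summable_comparison_test'[OF sums_summable[OF sums_mult[OF zeta_int_sums[of 3], of "real n + 1"]]])
       (use I12_term_bound[of n] in auto)
  then show ?thesis by (simp add: I12_def suminf_minus summable_sums)
qed

lemma I12_bound: "\<bar>I12 n\<bar> \<le> (real n + 1) * zeta_int 3"
proof -
  have *: "(\<lambda>k. (real n + 1) * (1 / (real k + 1) ^ 3)) sums ((real n + 1) * zeta_int 3)"
    by (intro sums_mult zeta_int_sums) simp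
  have "norm (\<Sum>k. h12 n (1 + real k) * deriv (h12 n) (1 + real k)) \<le> (\<Sum>k. (real n + 1) * (1 / (real k + 1) ^ 3))"
    by (rule norm_suminf_le) (use * I12_term_bound[of n] in \<open>auto simp: sums_iff\<close>)
  then show ?thesis using * I12_sums[of n] by (simp add: sums_iff)
qed

lemma I12_rec:
  fixes m :: nat
  defines "n \<equiv> real m + 2"
  shows "n ^ 3 * I12 (m + 2) = (2 * n - 1) * (17 * n\<^sup>2 - 17 * n + 5) * I12 (m + 1) - (n - 1) ^ 3 * I12 m"
proof -
  have "n ^ 3 * (- I12 (m + 2)) + (- ((2 * n - 1) * (17 * n\<^sup>2 - 17 * n + 5))) * (- I12 (m + 1)) + (n - 1) ^ 3 * (- I12 m) = 0"
  \<comment> \<open>The quadratic is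
    \<open>4 * (2 * n - 1) * ((2 * n - 1) ^ 2 - t * (2 * t - 1))\<close>. With
    \<open>t = - k\<close> and up to sign this is Zagier's certificate for the Apery
    numbers.\<close>
  proof (rule telescoping_derivative_sum[where u = 1 and k = "h12 (m + 1)" and
        \<alpha> = "- 8 * (2 * n - 1)" and \<beta> = "4 * (2 * n - 1)" and \<gamma> = "4 * (2 * n - 1) ^ 3" and
        A = "1 ^ (m + 1) * (real (m + 1) + 1)"])
    fix t :: real assume t: "t > 0"
    define X where "X = h12 m t"
    have 1: "h12 (m + 1) t = (t - (n - 1)) / (t + (n - 1)) * X"
      using h12_Suc[of m t] by (simp add: n_def X_def add.commute)
    have 2: "h12 (m + 2) t = (t - n) / (t + n) * ((t - (n - 1)) / (t + (n - 1)) * X)"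
      using h12_Suc[of "m + 1" t] 1 by (simp add: n_def add_ac)
    have 3: "h12 (m + 1) (t + 1) = t\<^sup>2 / ((t + (n - 1)) * (t + n)) * X"
      using h12_shift[OF t, of m] by (simp add: n_def X_def add_ac)
    have pos: "t + (n - 1) > 0" "t + n > 0" using t by (simp_all add: n_def)
    show "n ^ 3 * (h12 (m + 2) t)\<^sup>2 + - ((2 * n - 1) * (17 * n\<^sup>2 - 17 * n + 5)) * (h12 (m + 1) t)\<^sup>2 +
         (n - 1) ^ 3 * (h12 m t)\<^sup>2 =
         (- 8 * (2 * n - 1) * (t + 1)\<^sup>2 + 4 * (2 * n - 1) * (t + 1) + 4 * (2 * n - 1) ^ 3) * (h12 (m + 1) (t + 1))\<^sup>2 -
         (- 8 * (2 * n - 1) * t\<^sup>2 + 4 * (2 * n - 1) * t + 4 * (2 * n - 1) ^ 3) * (h12 (m + 1) t)\<^sup>2"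
      unfolding 1 2 3 X_def[symmetric] power_mult_distrib power_divide using pos
      by (simp add: divide_simps) Groebner_Basis.algebra
    show "\<bar>h12 (m + 1) t\<bar> \<le> 1 ^ (m + 1) * (real (m + 1) + 1) / t"
      using h12_bounds[OF t, of "m + 1"] t by (auto simp: divide_simps)
    show "\<bar>deriv (h12 (m + 1)) t\<bar> \<le> 1 ^ (m + 1) * (real (m + 1) + 1) / t\<^sup>2"
      using h12_bounds[OF t, of "m + 1"] by simp
  next
    have "(\<Prod>j=1..m+1. 1 - real j) = 0" by (rule prod_zero) auto
    then show "h12 (m + 1) 1 = 0" by (simp add: h12_def)
  qed (use h12_bounds I12_sums in auto)
  then show ?thesis by (simp add: algebra_simps)
qed

lemma I12_0: "I12 0 = zeta_int 3"
proof -
  have "deriv (h12 0) t = - (1 / t\<^sup>2)" if "t > 0" for t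
    unfolding h12_0[abs_def] using that
    by (intro DERIV_imp_deriv) (auto intro!: derivative_eq_intros simp: power2_eq_square)
  then have "(\<lambda>k. - (h12 0 (1 + real k) * deriv (h12 0) (1 + real k))) = (\<lambda>k. 1 / (real k + 1) ^ 3)"
    by (auto simp: h12_0 power2_eq_square power3_eq_cube add.commute)
  then show ?thesis using zeta_int_sums[of 3] by (simp add: I12_def sums_iff)
qed

text \<open>With \<open>h12 1 t = 2 / (t + 1) - 1 / t\<close> the two cubes give the zeta terms, and
  the cross terms combine to a difference of consecutive inverse squares, which telescopes.\<close>

lemma I12_1: "I12 1 = 5 * zeta_int 3 - 6"
proof -
  have h: "h12 1 t = 2 / (t + 1) - 1 / t" if "t > 0" for t
    using that by (simp add: h12_def divide_simps)
  have d: "deriv (h12 1) t = 1 / t\<^sup>2 - 2 / (t + 1)\<^sup>2" if t: "t > 0" for t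
  proof (rule DERIV_imp_deriv, rule has_field_derivative_transform_within_open[where S = "{0<..}"])
    show "((\<lambda>t. 2 / (t + 1) - 1 / t) has_real_derivative 1 / t\<^sup>2 - 2 / (t + 1)\<^sup>2) (at t)"
      using t by (auto intro!: derivative_eq_intros simp: power2_eq_square)
  qed (use t h in \<open>auto simp: open_greaterThan\<close>)
  have telescope: "(\<lambda>k. 2 * (1 / (real (Suc k) + 1)\<^sup>2 - 1 / (real k + 1)\<^sup>2)) sums (2 * (0 - 1 / (real 0 + 1)\<^sup>2))"
    by (intro sums_mult telescope_sums) real_asymp
  have "(\<lambda>k. 4 * (1 / (real k + 2) ^ 3) + 1 / (real k + 1) ^ 3 + 2 * (1 / (real (Suc k) + 1)\<^sup>2 - 1 / (real k + 1)\<^sup>2))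
      sums (4 * (zeta_int 3 - 1) + zeta_int 3 + 2 * (0 - 1 / (real 0 + 1)\<^sup>2))"
    by (intro sums_add[OF _ telescope] sums_add sums_mult zeta_int_sums zeta_int_sums_shift) auto
  moreover have "4 * (1 / (real k + 2) ^ 3) + 1 / (real k + 1) ^ 3 + 2 * (1 / (real (Suc k) + 1)\<^sup>2 - 1 / (real k + 1)\<^sup>2) =
      - (h12 1 (1 + real k) * deriv (h12 1) (1 + real k))" for k
  proof -
    define t where "t = real k + 1"
    have t: "t > 0" "real k + 2 = t + 1" "real (Suc k) + 1 = t + 1" "1 + real k = t" "real k + 1 = t"
      by (simp_all add: t_def)
    show ?thesis
      unfolding t h[OF t(1)] d[OF t(1)] using t(1)
      by (simp add: divide_simps) Groebner_Basis.algebra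
  qed
  ultimately show ?thesis by (simp add: I12_def sums_iff)
qed

lemma limit_V12: "(\<lambda>n. seq_b P12 Q12 n / seq_a P12 Q12 n) \<longlonglongrightarrow> zeta_int 3 / 6"
proof -
  have "(\<lambda>n. seq_b P12 Q12 n / seq_a P12 Q12 n) \<longlonglongrightarrow> - I12 0 / (- 6)"
  proof (rule apery_limit[where c = 5])
    show "5\<^sup>2 * real n ^ 3 \<le> 5 * P12 n + min 0 (Q12 n)" if "n \<ge> 3" for n
    proof -
      define x where "x = real n - 3"
      have x: "x \<ge> 0" "real n = x + 3" using that by (auto simp: x_def)
      have "5 * P12 n = 25 * (x + 3) ^ 3 + (145 * x ^ 3 + 1050 * x\<^sup>2 + 2520 * x + 2000)"
        "5 * P12 n + Q12 n = 25 * (x + 3) ^ 3 + (144 * x ^ 3 + 1044 * x\<^sup>2 + 2508 * x + 1992)"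
        unfolding P12_def Q12_def x(2) by Groebner_Basis.algebra+
      moreover have "145 * x ^ 3 + 1050 * x\<^sup>2 + 2520 * x + 2000 \<ge> 0" "144 * x ^ 3 + 1044 * x\<^sup>2 + 2508 * x + 1992 \<ge> 0"
        using x(1) by simp_all
      ultimately have "25 * (x + 3) ^ 3 \<le> 5 * P12 n" "25 * (x + 3) ^ 3 \<le> 5 * P12 n + Q12 n"
        by simp_all
      then show ?thesis by (simp add: x(2) min_def)
    qed
    show "real n ^ 3 * I12 n = P12 n * I12 (n - 1) + Q12 n * I12 (n - 2)" if n: "n \<ge> 2" for n
    proof -
      obtain m where "n = m + 2" using le_add_diff_inverse2[OF n] by metis
      then show ?thesis using I12_rec[of m] by (simp add: P12_def Q12_def add.commute)
    qed
    show "(\<lambda>n. I12 n / 5 ^ n) \<longlonglongrightarrow> 0"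
    proof (rule Lim_null_comparison)
      show "\<forall>\<^sub>F n in sequentially. norm (I12 n / 5 ^ n) \<le> zeta_int 3 * ((real n + 1) / 5 ^ n)"
        using I12_bound by (intro always_eventually) (auto simp: divide_simps mult_ac)
      show "(\<lambda>n. zeta_int 3 * ((real n + 1) / 5 ^ n)) \<longlonglongrightarrow> 0"
        by (intro tendsto_mult_right_zero) real_asymp
    qed
    show "I12 1 = P12 1 * I12 0 + - 6" by (simp add: P12_def I12_0 I12_1[simplified])
  qed (auto simp: P12_def Q12_def)
  then show ?thesis by (simp add: I12_0)
qed

section \<open>The case of V16\<close>

text \<open>Unlike \<open>h12\<close>, this has no zero at a positive point. For
  \<open>n >= 2\<close> it vanishes at \<open>s = - 1 / 2\<close>, one unit to the left of the first
  summation point, which is why the telescoping function is built from a shifted copy.\<close>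

definition h16 :: "nat \<Rightarrow> real \<Rightarrow> real" where
  "h16 n s = (\<Prod>j<n. 2 * s + real j) / (\<Prod>j=0..n. s + real j)"

lemma h16_0: "h16 0 s = 1 / s"
  by (simp add: h16_def)

lemma h16_Suc: "h16 (Suc n) s = (2 * s + real n) / (s + (real n + 1)) * h16 n s"
proof -
  have "(\<Prod>j<Suc n. 2 * s + real j) = (\<Prod>j<n. 2 * s + real j) * (2 * s + real n)"
    "(\<Prod>j=0..Suc n. s + real j) = (\<Prod>j=0..n. s + real j) * (s + (real n + 1))"
    by (simp_all add: add.commute)
  then show ?thesis unfolding h16_def by (simp only:) (simp add: mult_ac)
qed

lemma h16_bounds:
  assumes "s > 0"
  shows "(h16 n has_real_derivative deriv (h16 n) s) (at s) \<and> \<bar>h16 n s\<bar> \<le> 2 ^ n / s \<and>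
    \<bar>deriv (h16 n) s\<bar> \<le> 2 ^ n * (real n + 1) / s\<^sup>2"
proof (rule recursive_product_bounds[where q' = "\<lambda>n s. (real n + 2) / (s + (real n + 1))\<^sup>2"])
  fix n and t :: real assume t: "t > 0"
  show "((\<lambda>t. (2 * t + real n) / (t + (real n + 1))) has_real_derivative
      (real n + 2) / (t + (real n + 1))\<^sup>2) (at t)"
    using t by (auto intro!: derivative_eq_intros simp: power2_eq_square field_simps)
  show "\<bar>(2 * t + real n) / (t + (real n + 1))\<bar> \<le> 2" using t by (simp add: divide_simps)
  have "(real n + 2) * t \<le> 2 * (t + (real n + 1))\<^sup>2"
    using t by (simp add: power2_sum power2_eq_square algebra_simps)
  then show "\<bar>(real n + 2) / (t + (real n + 1))\<^sup>2\<bar> \<le> 2 / t"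
    using t by (simp add: divide_simps)
qed (use assms in \<open>auto simp: h16_0 h16_Suc\<close>)

text \<open>Shifted so that the double zero of the telescoping function sits at the first
  summation point \<open>1/2\<close>.\<close>

definition k16 :: "nat \<Rightarrow> real \<Rightarrow> real" where
  "k16 m s = 2 * (2 * s - 1) / (s + (real m + 1)) * h16 m s"

text \<open>Identifies \<open>k16 m s\<close> with \<open>h16 (m + 2) (s - 1)\<close> after the
  common factor \<open>s - 1\<close> has been cancelled; the cancelled form is also correct at
  \<open>s = 1\<close>, where the shifted quotient would be a division by zero.\<close>

lemma k16_shift:
  assumes "s > 0"
  shows "k16 m (s + 1) = h16 (m + 2) s"
proof (induction m)
  case 0
  then show ?case using assms
    by (simp add: k16_def h16_0 h16_Suc numeral_2_eq_2 divide_simps) (simp add: algebra_simps)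
next
  case (Suc m)
  have pos: "s + (real m + 1) \<noteq> 0" "s + (real m + 2) \<noteq> 0" "s + (real m + 3) \<noteq> 0"
    using assms by simp_all
  have "k16 (Suc m) (s + 1) = (2 * s + (real m + 2)) / (s + (real m + 3)) * k16 m (s + 1)"
    unfolding k16_def h16_Suc using pos by (simp add: divide_simps add_ac)
  also have "\<dots> = h16 (Suc m + 2) s"
    using Suc h16_Suc[of "m + 2" s] by (simp add: add_ac)
  finally show ?case .
qed

lemma k16_deriv_bounds:
  assumes "s > 0"
  shows "(k16 m has_real_derivative deriv (k16 m) s) (at s) \<and>
    \<bar>k16 m s\<bar> \<le> 2 ^ m * (4 * (real m + 2)) / s \<and>
    \<bar>deriv (k16 m) s\<bar> \<le> 2 ^ m * (4 * (real m + 2)) / s\<^sup>2"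
proof -
  define q where "q = (\<lambda>s. 2 * (2 * s - 1) / (s + (real m + 1)))"
  define q' where "q' = (4 * real m + 6) / (s + (real m + 1))\<^sup>2"
  have q: "(q has_real_derivative q') (at s)"
    unfolding q_def q'_def using assms
    by (auto intro!: derivative_eq_intros simp: power2_eq_square divide_simps)
  have q_le: "\<bar>q s\<bar> \<le> 4" using assms by (simp add: q_def abs_if divide_simps)
  have "(4 * real m + 6) * s \<le> 4 * (s + (real m + 1))\<^sup>2"
    using assms by (simp add: power2_sum power2_eq_square algebra_simps)
  then have q'_le: "\<bar>q'\<bar> \<le> 4 / s" using assms by (simp add: q'_def divide_simps)
  note h = h16_bounds[OF assms, of m]
  have d: "(k16 m has_real_derivative q' * h16 m s + deriv (h16 m) s * q s) (at s)"
    unfolding k16_def[abs_def] using DERIV_mult[OF q, of "h16 m" "deriv (h16 m) s"] h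
    by (simp add: q_def)
  then have eq: "deriv (k16 m) s = q' * h16 m s + deriv (h16 m) s * q s" by (rule DERIV_imp_deriv)
  have "\<bar>k16 m s\<bar> = \<bar>q s\<bar> * \<bar>h16 m s\<bar>" by (simp add: k16_def q_def abs_mult)
  also have "\<dots> \<le> 4 * (2 ^ m / s)" using q_le h by (intro mult_mono) auto
  also have "\<dots> \<le> 2 ^ m * (4 * (real m + 2)) / s" using assms by (simp add: divide_simps)
  finally have 1: "\<bar>k16 m s\<bar> \<le> 2 ^ m * (4 * (real m + 2)) / s" .
  have "\<bar>deriv (k16 m) s\<bar> \<le> \<bar>q'\<bar> * \<bar>h16 m s\<bar> + \<bar>deriv (h16 m) s\<bar> * \<bar>q s\<bar>"
    unfolding eq by (rule order_trans[OF abs_triangle_ineq]) (simp add: abs_mult)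
  also have "\<dots> \<le> 4 / s * (2 ^ m / s) + 2 ^ m * (real m + 1) / s\<^sup>2 * 4"
    using q_le q'_le h assms by (intro add_mono mult_mono) auto
  also have "\<dots> = 2 ^ m * (4 * (real m + 2)) / s\<^sup>2"
    using assms by (simp add: field_simps power2_eq_square)
  finally show ?thesis using 1 d eq by simp
qed

definition I16 :: "nat \<Rightarrow> real" where
  "I16 n = (\<Sum>k. - (h16 n (1 / 2 + real k) * deriv (h16 n) (1 / 2 + real k)))"

text \<open>Among the terms \<open>8 / n ^ 3\<close>, those with even \<open>n\<close> reproduce the
  zeta series and those with odd \<open>n\<close> are the cubes of half-odd numbers; pairing
  neighbours separates them.\<close>

lemma half_odd_cubes_sums: "(\<lambda>k. 1 / (1 / 2 + real k) ^ 3) sums (7 * zeta_int 3)"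
proof -
  have "(\<lambda>k. 8 * (1 / (real k + 1) ^ 3)) sums (8 * zeta_int 3)"
    by (intro sums_mult zeta_int_sums) simp
  then have "(\<lambda>k. \<Sum>i\<in>{k*2..<k*2+2}. 8 * (1 / (real i + 1) ^ 3)) sums (8 * zeta_int 3)"
    by (rule sums_group) simp
  moreover have "(\<lambda>k. 1 / (real k + 1) ^ 3) sums zeta_int 3"
    by (intro zeta_int_sums) simp
  ultimately have "(\<lambda>k. (\<Sum>i\<in>{k*2..<k*2+2}. 8 * (1 / (real i + 1) ^ 3)) - 1 / (real k + 1) ^ 3) sums (8 * zeta_int 3 - zeta_int 3)"
    by (rule sums_diff)
  moreover have "(\<Sum>i\<in>{k*2..<k*2+2}. 8 * (1 / (real i + 1) ^ 3)) - 1 / (real k + 1) ^ 3 = 1 / (1 / 2 + real k) ^ 3" for k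
  proof -
    have "{k*2..<k*2+2} = {k*2, k*2+1}" by auto
    moreover have "8 * (1 / (real k * 2 + 1) ^ 3) = 1 / (1 / 2 + real k) ^ 3"
      "8 * (1 / (real k * 2 + 2) ^ 3) = 1 / (real k + 1) ^ 3"
      by (simp_all add: divide_simps power3_eq_cube) (simp_all add: algebra_simps)
    ultimately show ?thesis by (simp add: add_ac)
  qed
  ultimately show ?thesis by simp
qed

lemma I16_term_bound:
  "\<bar>h16 n (1 / 2 + real k) * deriv (h16 n) (1 / 2 + real k)\<bar> \<le> 4 ^ n * (real n + 1) * (1 / (1 / 2 + real k) ^ 3)"
proof -
  define s where "s = 1 / 2 + real k"
  have s: "s > 0" by (simp add: s_def add_pos_nonneg)
  have "\<bar>h16 n s\<bar> * \<bar>deriv (h16 n) s\<bar> \<le> 2 ^ n / s * (2 ^ n * (real n + 1) / s\<^sup>2)"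
    using h16_bounds[OF s, of n] s by (intro mult_mono) auto
  also have "\<dots> = 4 ^ n * (real n + 1) * (1 / s ^ 3)"
    using power_mult_distrib[of 2 "2 :: real" n] by (simp add: power2_eq_square power3_eq_cube mult_ac)
  finally show ?thesis by (simp add: abs_mult s_def)
qed

lemma I16_sums: "(\<lambda>k. h16 n (1 / 2 + real k) * deriv (h16 n) (1 / 2 + real k)) sums - I16 n"
proof -
  have "summable (\<lambda>k. h16 n (1 / 2 + real k) * deriv (h16 n) (1 / 2 + real k))"
    by (rule summable_comparison_test'[OF sums_summable[OF sums_mult[OF half_odd_cubes_sums, of "4 ^ n * (real n + 1)"]]])
       (use I16_term_bound[of n] in auto)
  then show ?thesis by (simp add: I16_def suminf_minus summable_sums)
qed

lemma I16_bound: "\<bar>I16 n\<bar> \<le> 4 ^ n * (real n + 1) * (7 * zeta_int 3)"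
proof -
  have *: "(\<lambda>k. 4 ^ n * (real n + 1) * (1 / (1 / 2 + real k) ^ 3)) sums (4 ^ n * (real n + 1) * (7 * zeta_int 3))"
    by (intro sums_mult half_odd_cubes_sums)
  have "norm (\<Sum>k. h16 n (1 / 2 + real k) * deriv (h16 n) (1 / 2 + real k)) \<le> (\<Sum>k. 4 ^ n * (real n + 1) * (1 / (1 / 2 + real k) ^ 3))"
    by (rule norm_suminf_le) (use * I16_term_bound[of n] in \<open>auto simp: sums_iff\<close>)
  then show ?thesis using * I16_sums[of n] by (simp add: sums_iff)
qed

lemma I16_rec:
  fixes m :: nat
  defines "n \<equiv> real m + 2"
  shows "n ^ 3 * I16 (m + 2) = 4 * (2 * n - 1) * (3 * n\<^sup>2 - 3 * n + 1) * I16 (m + 1) - 16 * (n - 1) ^ 3 * I16 m"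
proof -
  have "n ^ 3 * (- I16 (m + 2)) + (- (4 * (2 * n - 1) * (3 * n\<^sup>2 - 3 * n + 1))) * (- I16 (m + 1)) + 16 * (n - 1) ^ 3 * (- I16 m) = 0"
  \<comment> \<open>This quadratic is the expansion of \<open>- 4 * (2 * n - 1) * x ^ 2 - 8 * n * (2
    * n - 1) * x - n ^ 2 * (7 * n - 4)\<close> at \<open>x = s - 1\<close>, matching the shift
    inside \<open>k16\<close>.\<close>
  proof (rule telescoping_derivative_sum[where u = "1 / 2" and k = "k16 m" and
        \<alpha> = "- 4 * (2 * n - 1)" and \<beta> = "8 * (2 * n - 1) - 8 * n * (2 * n - 1)" and
        \<gamma> = "- 4 * (2 * n - 1) + 8 * n * (2 * n - 1) - n\<^sup>2 * (7 * n - 4)" and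
        A = "2 ^ m * (4 * (real m + 2))"])
    fix s :: real assume s: "s > 0"
    define X where "X = h16 m s"
    have 1: "h16 (m + 1) s = (2 * s + (n - 2)) / (s + (n - 1)) * X"
      using h16_Suc[of m s] by (simp add: n_def X_def add.commute)
    have 2: "h16 (m + 2) s = (2 * s + (n - 1)) / (s + n) * ((2 * s + (n - 2)) / (s + (n - 1)) * X)"
      using h16_Suc[of "m + 1" s] 1 by (simp add: n_def add_ac)
    have 3: "k16 m s = 2 * (2 * s - 1) / (s + (n - 1)) * X"
      by (simp add: k16_def n_def X_def add_ac)
    have pos: "s + (n - 1) > 0" "s + n > 0" using s by (simp_all add: n_def)
    show "n ^ 3 * (h16 (m + 2) s)\<^sup>2 + - (4 * (2 * n - 1) * (3 * n\<^sup>2 - 3 * n + 1)) * (h16 (m + 1) s)\<^sup>2 +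
         16 * (n - 1) ^ 3 * (h16 m s)\<^sup>2 =
         (- 4 * (2 * n - 1) * (s + 1)\<^sup>2 + (8 * (2 * n - 1) - 8 * n * (2 * n - 1)) * (s + 1) +
          (- 4 * (2 * n - 1) + 8 * n * (2 * n - 1) - n\<^sup>2 * (7 * n - 4))) * (k16 m (s + 1))\<^sup>2 -
         (- 4 * (2 * n - 1) * s\<^sup>2 + (8 * (2 * n - 1) - 8 * n * (2 * n - 1)) * s +
          (- 4 * (2 * n - 1) + 8 * n * (2 * n - 1) - n\<^sup>2 * (7 * n - 4))) * (k16 m s)\<^sup>2"
      unfolding k16_shift[OF s] unfolding 1 2 3 X_def[symmetric] power_mult_distrib power_divide using pos
      by (simp add: divide_simps) Groebner_Basis.algebra
  qed (use h16_bounds k16_deriv_bounds I16_sums in \<open>auto simp: k16_def\<close>)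
  then show ?thesis by (simp add: algebra_simps)
qed

lemma I16_0: "I16 0 = 7 * zeta_int 3"
proof -
  have "deriv (h16 0) t = - (1 / t\<^sup>2)" if "t > 0" for t
    unfolding h16_0[abs_def] using that
    by (intro DERIV_imp_deriv) (auto intro!: derivative_eq_intros simp: power2_eq_square)
  then have "- (h16 0 (1 / 2 + real k) * deriv (h16 0) (1 / 2 + real k)) = 1 / (1 / 2 + real k) ^ 3" for k
    by (simp add: h16_0 power2_eq_square power3_eq_cube add_pos_nonneg)
  then show ?thesis using half_odd_cubes_sums by (simp add: I16_def sums_iff)
qed

text \<open>The function \<open>h16 1\<close> collapses to \<open>2 / (s + 1)\<close>, so the series
  is 4 times the one for \<open>I16 0\<close> with its first term, 8, removed.\<close>

lemma I16_1: "I16 1 = 28 * zeta_int 3 - 32"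
proof -
  have h: "h16 1 t = 2 / (t + 1)" if "t > 0" for t
    using that by (simp add: h16_def divide_simps)
  have d: "deriv (h16 1) t = - (2 / (t + 1)\<^sup>2)" if t: "t > 0" for t
  proof (rule DERIV_imp_deriv, rule has_field_derivative_transform_within_open[where S = "{0<..}"])
    show "((\<lambda>t. 2 / (t + 1)) has_real_derivative - (2 / (t + 1)\<^sup>2)) (at t)"
      using t by (auto intro!: derivative_eq_intros simp: power2_eq_square)
  qed (use t h in \<open>auto simp: open_greaterThan\<close>)
  have "(\<lambda>k. 1 / (1 / 2 + real (Suc k)) ^ 3) sums (7 * zeta_int 3 - 8)"
    using half_odd_cubes_sums by (subst sums_Suc_iff) (simp add: power3_eq_cube)
  then have "(\<lambda>k. 4 * (1 / (1 / 2 + real (Suc k)) ^ 3)) sums (4 * (7 * zeta_int 3 - 8))"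
    by (rule sums_mult)
  moreover have "4 * (1 / (1 / 2 + real (Suc k)) ^ 3) = - (h16 1 (1 / 2 + real k) * deriv (h16 1) (1 / 2 + real k))" for k
  proof -
    define t where "t = 1 / 2 + real k"
    have t: "t > 0" "1 / 2 + real (Suc k) = t + 1" "1 / 2 + real k = t"
      by (simp_all add: t_def add_pos_nonneg)
    show ?thesis
      unfolding t h[OF t(1)] d[OF t(1)] using t(1) by (simp add: power2_eq_square power3_eq_cube)
  qed
  ultimately show ?thesis by (simp add: I16_def sums_iff)
qed

lemma limit_V16: "(\<lambda>n. seq_b P16 Q16 n / seq_a P16 Q16 n) \<longlonglongrightarrow> 7 / 32 * zeta_int 3"
proof -
  have "(\<lambda>n. seq_b P16 Q16 n / seq_a P16 Q16 n) \<longlonglongrightarrow> - I16 0 / (- 32)"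
  \<comment> \<open>Here \<open>c\<close> must exceed 4, as the bound on \<open>I16 n\<close> is of
    order \<open>(n + 1) * 4 ^ n\<close>.\<close>
  proof (rule apery_limit[where c = 6])
    show "6\<^sup>2 * real n ^ 3 \<le> 6 * P16 n + min 0 (Q16 n)" if "n \<ge> 3" for n
    proof -
      define x where "x = real n - 3"
      have x: "x \<ge> 0" "real n = x + 3" using that by (auto simp: x_def)
      have "6 * P16 n = 36 * (x + 3) ^ 3 + (108 * x ^ 3 + 756 * x\<^sup>2 + 1740 * x + 1308)"
        "6 * P16 n + Q16 n = 36 * (x + 3) ^ 3 + (92 * x ^ 3 + 660 * x\<^sup>2 + 1548 * x + 1180)"
        unfolding P16_def Q16_def x(2) by Groebner_Basis.algebra+
      moreover have "108 * x ^ 3 + 756 * x\<^sup>2 + 1740 * x + 1308 \<ge> 0" "92 * x ^ 3 + 660 * x\<^sup>2 + 1548 * x + 1180 \<ge> 0"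
        using x(1) by simp_all
      ultimately have "36 * (x + 3) ^ 3 \<le> 6 * P16 n" "36 * (x + 3) ^ 3 \<le> 6 * P16 n + Q16 n"
        by simp_all
      then show ?thesis by (simp add: x(2) min_def)
    qed
    show "real n ^ 3 * I16 n = P16 n * I16 (n - 1) + Q16 n * I16 (n - 2)" if n: "n \<ge> 2" for n
    proof -
      obtain m where "n = m + 2" using le_add_diff_inverse2[OF n] by metis
      then show ?thesis using I16_rec[of m] by (simp add: P16_def Q16_def add.commute)
    qed
    show "(\<lambda>n. I16 n / 6 ^ n) \<longlonglongrightarrow> 0"
    proof (rule Lim_null_comparison)
      show "\<forall>\<^sub>F n in sequentially. norm (I16 n / 6 ^ n) \<le> 7 * zeta_int 3 * (4 ^ n * (real n + 1) / 6 ^ n)"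
        using I16_bound by (intro always_eventually) (auto simp: divide_simps mult_ac)
      show "(\<lambda>n. 7 * zeta_int 3 * (4 ^ n * (real n + 1) / 6 ^ n)) \<longlonglongrightarrow> 0"
        by (intro tendsto_mult_right_zero) real_asymp
    qed
    show "I16 1 = P16 1 * I16 0 + - 32" by (simp add: P16_def I16_0 I16_1[simplified])
  qed (auto simp: P16_def Q16_def)
  then show ?thesis by (simp add: I16_0)
qed

section \<open>The case of V14\<close>

definition f14 :: "nat \<Rightarrow> real \<Rightarrow> real" where
  "f14 n s = (\<Prod>j<n. 2 * s + real j) * (\<Prod>j=1..n. s - real j) / (\<Prod>j=0..n. s + real j)\<^sup>2"

lemma f14_0: "f14 0 s = 1 / s\<^sup>2"
  by (simp add: f14_def)

lemma f14_Suc: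
  "f14 (Suc n) s = (2 * s + real n) * (s - (real n + 1)) / (s + (real n + 1))\<^sup>2 * f14 n s"
proof -
  have "(\<Prod>j<Suc n. 2 * s + real j) = (\<Prod>j<n. 2 * s + real j) * (2 * s + real n)"
    "(\<Prod>j=1..Suc n. s - real j) = (\<Prod>j=1..n. s - real j) * (s - (real n + 1))"
    "(\<Prod>j=0..Suc n. s + real j) = (\<Prod>j=0..n. s + real j) * (s + (real n + 1))"
    by (simp_all add: add.commute)
  then show ?thesis unfolding f14_def by (simp only: power_mult_distrib) (simp add: mult_ac)
qed

text \<open>The factor \<open>s - m\<close> stays on the left because it vanishes at the summation
  point \<open>s = m\<close>; in this form the relation holds for every positive
  \<open>s\<close>.\<close>

lemma f14_shift:
  assumes "s > 0"
  shows "2 * (2 * s + 1) * (s - real m) * f14 m (s + 1) =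
    s\<^sup>2 * (2 * s + real m) * (2 * s + (real m + 1)) / (s + (real m + 1))\<^sup>2 * f14 m s"
proof (induction m)
  case 0
  then show ?case using assms by (simp add: f14_0 divide_simps)
next
  case (Suc m)
  have pos: "s + (real m + 1) \<noteq> 0" "s + (real m + 2) \<noteq> 0"
    using assms by simp_all
  have "2 * (2 * s + 1) * (s - real (Suc m)) * f14 (Suc m) (s + 1) =
      (2 * s + (real m + 2)) * (s - (real m + 1)) / (s + (real m + 2))\<^sup>2 *
      (2 * (2 * s + 1) * (s - real m) * f14 m (s + 1))"
    unfolding f14_Suc by (simp add: add_ac mult_ac)
  also have "\<dots> = s\<^sup>2 * (2 * s + (real m + 1)) * (2 * s + (real m + 2)) / (s + (real m + 2))\<^sup>2 * f14 (Suc m) s"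
    unfolding Suc f14_Suc using pos by (simp add: divide_simps)
  finally show ?case by (simp add: add_ac)
qed

lemma f14_bound: "s > 0 \<Longrightarrow> \<bar>f14 n s\<bar> \<le> 2 ^ n / s\<^sup>2"
proof (induction n)
  case (Suc n)
  have "\<bar>(2 * s + real n) * (s - (real n + 1)) / (s + (real n + 1))\<^sup>2\<bar> \<le> 2"
  proof -
    have "(2 * s + real n) * \<bar>s - (real n + 1)\<bar> \<le> (2 * (s + (real n + 1))) * (s + (real n + 1))"
      using Suc.prems by (intro mult_mono) auto
    then have "(2 * s + real n) * \<bar>s - (real n + 1)\<bar> \<le> 2 * (s + (real n + 1))\<^sup>2"
      by (simp only: mult.assoc power2_eq_square)
    then show ?thesis using Suc.prems by (simp add: abs_mult divide_simps)
  qed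
  then have "\<bar>f14 (Suc n) s\<bar> \<le> 2 * (2 ^ n / s\<^sup>2)"
    unfolding f14_Suc abs_mult[of _ "f14 n s"] using Suc by (intro mult_mono) auto
  then show ?case by simp
qed (simp add: f14_0)

text \<open>For every \<open>n\<close> the degrees differ by exactly 2. A quadratic certificate
  therefore cancels the decay completely, and the telescoping function of V14 does not tend to
  0.\<close>

lemma f14_tendsto: "((\<lambda>s. s\<^sup>2 * f14 n s) \<longlongrightarrow> 2 ^ n) at_top"
proof (induction n)
  case 0
  have "\<forall>\<^sub>F s in at_top. (1::real) = s\<^sup>2 * f14 0 s"
    using eventually_gt_at_top[of 0] by eventually_elim (simp add: f14_0)
  then show ?case using tendsto_const[of "1::real"] by (simp cong: filterlim_cong)
next
  case (Suc n)
  have "((\<lambda>s. (2 * s + real n) * (s - (real n + 1)) / (s + (real n + 1))\<^sup>2) \<longlongrightarrow> 2) at_top"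
    by real_asymp
  from tendsto_mult[OF this Suc] show ?case
    by (simp add: f14_Suc mult_ac)
qed

definition cert14 :: "real \<Rightarrow> real \<Rightarrow> real" where
  "cert14 n s = (15 * n - 8) * s\<^sup>2 + 13 * n * (2 * n - 1) * s + n\<^sup>2 * (7 * n - 3)"

text \<open>The certificate is taken at \<open>s - 1\<close>, so that the factor
  \<open>2 * s - 1\<close> and, at \<open>s = 1\<close>, either \<open>s - (m + 1)\<close> or a
  factor of \<open>f14 m\<close> make this vanish at both starting points \<open>1 / 2\<close> and
  1.\<close>

definition e14 :: "nat \<Rightarrow> real \<Rightarrow> real" where
  "e14 m s = 2 * (2 * s - 1) * (s - (real m + 1)) * cert14 (real m + 2) (s - 1) / (s + (real m + 1))\<^sup>2 * f14 m s"

lemma e14_shift: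
  assumes "s > 0"
  shows "e14 m (s + 1) = s\<^sup>2 * (2 * s + real m) * (2 * s + (real m + 1)) * cert14 (real m + 2) s /
    ((s + (real m + 1))\<^sup>2 * (s + (real m + 2))\<^sup>2) * f14 m s"
proof -
  have "e14 m (s + 1) = cert14 (real m + 2) s / (s + (real m + 2))\<^sup>2 * (2 * (2 * s + 1) * (s - real m) * f14 m (s + 1))"
    by (simp add: e14_def add_ac mult_ac)
  then show ?thesis unfolding f14_shift[OF assms] by (simp add: mult_ac)
qed

lemma f14_telescope:
  fixes m :: nat
  defines "n \<equiv> real m + 2"
  assumes "s > 0"
  shows "n ^ 3 * f14 (m + 2) s - (2 * n - 1) * (13 * n\<^sup>2 - 13 * n + 4) * f14 (m + 1) s -
    3 * (n - 1) * (3 * n - 2) * (3 * n - 4) * f14 m s = e14 m s - e14 m (s + 1)"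
proof -
  define X where "X = f14 m s"
  have 1: "f14 (m + 1) s = (2 * s + (n - 2)) * (s - (n - 1)) / (s + (n - 1))\<^sup>2 * X"
    using f14_Suc[of m s] by (simp add: n_def X_def add.commute)
  have 2: "f14 (m + 2) s = (2 * s + (n - 1)) * (s - n) / (s + n)\<^sup>2 * f14 (m + 1) s"
    using f14_Suc[of "m + 1" s] by (simp add: n_def add_ac)
  have 3: "e14 m s = 2 * (2 * s - 1) * (s - (n - 1)) * cert14 n (s - 1) / (s + (n - 1))\<^sup>2 * X"
    by (simp add: e14_def n_def X_def add.commute)
  have 4: "e14 m (s + 1) = s\<^sup>2 * (2 * s + (n - 2)) * (2 * s + (n - 1)) * cert14 n s / ((s + (n - 1))\<^sup>2 * (s + n)\<^sup>2) * X"
    using e14_shift[OF assms(2), of m] by (simp add: n_def X_def add_ac)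
  have pos: "s + (n - 1) > 0" "s + n > 0" using assms by (simp_all add: n_def)
  show ?thesis
    unfolding 2 3 4 1 cert14_def X_def[symmetric] using pos
    by (simp add: divide_simps) Groebner_Basis.algebra
qed

text \<open>The limit is \<open>4 * (15 * n - 8) * 2 ^ m\<close> with \<open>n = m + 2\<close>,
  hence nonzero. It is reached by writing the rational factor as a function \<open>F\<close> of
  \<open>1 / s\<close> that is continuous at 0.\<close>

lemma e14_convergent: "convergent (\<lambda>k. e14 m ((real k + 1) / 2))"
proof -
  define n where "n = real m + 2"
  define F where "F = (\<lambda>u::real. 2 * (2 - u) * (1 - (real m + 1) * u) *
    ((15 * n - 8) * (1 - u)\<^sup>2 + 13 * n * (2 * n - 1) * (u * (1 - u)) + n\<^sup>2 * (7 * n - 3) * u\<^sup>2) /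
    (1 + (real m + 1) * u)\<^sup>2)"
  have eq: "e14 m s = F (1 / s) * (s\<^sup>2 * f14 m s)" if "s > 0" for s
  proof -
    have "F (1 / s) * s\<^sup>2 = 2 * (2 * s - 1) * (s - (real m + 1)) * cert14 n (s - 1) / (s + (real m + 1))\<^sup>2"
    proof -
      have "2 - 1 / s = (2 * s - 1) / s" "1 - (real m + 1) * (1 / s) = (s - (real m + 1)) / s"
        "1 + (real m + 1) * (1 / s) = (s + (real m + 1)) / s"
        "(15 * n - 8) * (1 - 1 / s)\<^sup>2 + 13 * n * (2 * n - 1) * (1 / s * (1 - 1 / s)) + n\<^sup>2 * (7 * n - 3) * (1 / s)\<^sup>2
         = cert14 n (s - 1) / s\<^sup>2"
        using that by (simp_all add: divide_simps cert14_def power2_eq_square)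
      then show ?thesis
        unfolding F_def using that by (simp add: power_divide power2_eq_square)
    qed
    then show ?thesis by (simp add: e14_def n_def mult.assoc[symmetric])
  qed
  have u: "(\<lambda>k. 1 / ((real k + 1) / 2)) \<longlonglongrightarrow> 0" by real_asymp
  have "isCont F 0" unfolding F_def by (intro continuous_intros) auto
  then have "(\<lambda>k. F (1 / ((real k + 1) / 2))) \<longlonglongrightarrow> F 0"
    using u by (rule isCont_tendsto_compose)
  moreover have "filterlim (\<lambda>k. (real k + 1) / 2) at_top sequentially" by real_asymp
  then have "(\<lambda>k. ((real k + 1) / 2)\<^sup>2 * f14 m ((real k + 1) / 2)) \<longlonglongrightarrow> 2 ^ m"
    by (rule filterlim_compose[OF f14_tendsto])
  ultimately have "(\<lambda>k. F (1 / ((real k + 1) / 2)) * (((real k + 1) / 2)\<^sup>2 * f14 m ((real k + 1) / 2))) \<longlonglongrightarrow> F 0 * 2 ^ m"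
    by (rule tendsto_mult)
  moreover have "e14 m ((real k + 1) / 2) = F (1 / ((real k + 1) / 2)) * (((real k + 1) / 2)\<^sup>2 * f14 m ((real k + 1) / 2))" for k
    by (rule eq) simp
  ultimately show ?thesis unfolding convergent_def by auto
qed

text \<open>The shift \<open>s\<close> to \<open>s + 1\<close> moves the index by two. With
  alternating signs such a sum telescopes through differences of neighbours
  \<open>e k - e (k + 1)\<close>, so mere convergence of \<open>e\<close> kills the term at
  infinity; the limit need not be 0.\<close>

lemma alternating_telescope_sums:
  fixes e :: "nat \<Rightarrow> real"
  assumes "convergent e"
  shows "(\<lambda>k. (- 1) ^ Suc k * (e k - e (k + 2))) sums (e 1 - e 0)"
proof -
  define w where "w = (\<lambda>k. (- 1) ^ Suc k * (e k - e (Suc k)))"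
  obtain l where l: "e \<longlonglongrightarrow> l" using assms by (auto simp: convergent_def)
  have "(\<lambda>k. e k - e (Suc k)) \<longlonglongrightarrow> l - l" by (intro tendsto_diff l LIMSEQ_Suc)
  then have "(\<lambda>k. norm (w k)) \<longlonglongrightarrow> 0"
    by (simp add: w_def abs_mult power_abs tendsto_rabs_zero_iff)
  then have "w \<longlonglongrightarrow> 0" by (rule tendsto_norm_zero_cancel)
  then have "(\<lambda>k. w k - w (Suc k)) sums (w 0 - 0)" by (rule telescope_sums')
  moreover have "w k - w (Suc k) = (- 1) ^ Suc k * (e k - e (k + 2))" for k
    by (simp add: w_def algebra_simps)
  ultimately show ?thesis by (simp add: w_def)
qed

definition I14 :: "nat \<Rightarrow> real" where
  "I14 n = (\<Sum>k. (- 1) ^ Suc k * f14 n ((real k + 1) / 2))"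

lemma I14_term_bound: "norm ((- 1) ^ Suc k * f14 n ((real k + 1) / 2)) \<le> 4 * 2 ^ n * (1 / (real k + 1)\<^sup>2)"
proof -
  have "\<bar>f14 n ((real k + 1) / 2)\<bar> \<le> 2 ^ n / ((real k + 1) / 2)\<^sup>2" by (rule f14_bound) simp
  also have "\<dots> = 4 * 2 ^ n * (1 / (real k + 1)\<^sup>2)" by (simp add: power_divide)
  finally show ?thesis by (simp add: abs_mult power_abs)
qed

lemma I14_sums: "(\<lambda>k. (- 1) ^ Suc k * f14 n ((real k + 1) / 2)) sums I14 n"
proof -
  have "summable (\<lambda>k. 4 * 2 ^ n * (1 / (real k + 1)\<^sup>2))"
    by (intro sums_summable[OF sums_mult[OF zeta_int_sums]]) simp
  then have "summable (\<lambda>k. (- 1) ^ Suc k * f14 n ((real k + 1) / 2))"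
    by (rule summable_comparison_test') (rule I14_term_bound)
  then show ?thesis unfolding I14_def by (rule summable_sums)
qed

lemma I14_bound: "\<bar>I14 n\<bar> \<le> 4 * 2 ^ n * zeta_int 2"
proof -
  have *: "(\<lambda>k. 4 * 2 ^ n * (1 / (real k + 1)\<^sup>2)) sums (4 * 2 ^ n * zeta_int 2)"
    by (intro sums_mult zeta_int_sums) simp
  have "norm (I14 n) \<le> (\<Sum>k. 4 * 2 ^ n * (1 / (real k + 1)\<^sup>2))"
    unfolding I14_def by (rule norm_suminf_le[OF I14_term_bound]) (use * in \<open>simp add: sums_iff\<close>)
  then show ?thesis using * by (simp add: sums_iff)
qed

lemma I14_rec:
  fixes m :: nat
  defines "n \<equiv> real m + 2"
  shows "n ^ 3 * I14 (m + 2) = (2 * n - 1) * (13 * n\<^sup>2 - 13 * n + 4) * I14 (m + 1) +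
    3 * (n - 1) * (3 * n - 2) * (3 * n - 4) * I14 m"
proof -
  define e where "e = (\<lambda>k. e14 m ((real k + 1) / 2))"
  have "e 0 = 0" by (simp add: e_def e14_def)
  \<comment> \<open>For \<open>m = 0\<close> the factor \<open>s - (m + 1)\<close> vanishes at
    \<open>s = 1\<close>; for larger \<open>m\<close> the numerator of \<open>f14 m\<close>
    does.\<close>
  moreover have "e 1 = 0"
  proof (cases "m = 0")
    case False
    then have "(\<Prod>j=1..m. 1 - real j) = 0" by (intro prod_zero) auto
    then show ?thesis by (simp add: e_def e14_def f14_def)
  qed (simp add: e_def e14_def)
  ultimately have "(\<lambda>k. (- 1) ^ Suc k * (e k - e (k + 2))) sums 0"
    using alternating_telescope_sums[of e] e14_convergent[of m] by (simp add: e_def)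
  moreover have "(- 1) ^ Suc k * (e k - e (k + 2)) =
      n ^ 3 * ((- 1) ^ Suc k * f14 (m + 2) ((real k + 1) / 2)) -
      (2 * n - 1) * (13 * n\<^sup>2 - 13 * n + 4) * ((- 1) ^ Suc k * f14 (m + 1) ((real k + 1) / 2)) -
      3 * (n - 1) * (3 * n - 2) * (3 * n - 4) * ((- 1) ^ Suc k * f14 m ((real k + 1) / 2))" for k
  proof -
    have "(real (k + 2) + 1) / 2 = (real k + 1) / 2 + 1" by simp
    then have "e k - e (k + 2) = e14 m ((real k + 1) / 2) - e14 m ((real k + 1) / 2 + 1)"
      by (simp only: e_def)
    also have "\<dots> = n ^ 3 * f14 (m + 2) ((real k + 1) / 2) -
      (2 * n - 1) * (13 * n\<^sup>2 - 13 * n + 4) * f14 (m + 1) ((real k + 1) / 2) -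
      3 * (n - 1) * (3 * n - 2) * (3 * n - 4) * f14 m ((real k + 1) / 2)"
      unfolding n_def by (rule f14_telescope[symmetric]) simp
    finally show ?thesis by (simp only: right_diff_distrib mult.left_commute)
  qed
  moreover have "(\<lambda>k. n ^ 3 * ((- 1) ^ Suc k * f14 (m + 2) ((real k + 1) / 2)) -
      (2 * n - 1) * (13 * n\<^sup>2 - 13 * n + 4) * ((- 1) ^ Suc k * f14 (m + 1) ((real k + 1) / 2)) -
      3 * (n - 1) * (3 * n - 2) * (3 * n - 4) * ((- 1) ^ Suc k * f14 m ((real k + 1) / 2))) sums
      (n ^ 3 * I14 (m + 2) - (2 * n - 1) * (13 * n\<^sup>2 - 13 * n + 4) * I14 (m + 1) -
      3 * (n - 1) * (3 * n - 2) * (3 * n - 4) * I14 m)"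
    by (intro sums_diff sums_mult I14_sums)
  ultimately have "0 = n ^ 3 * I14 (m + 2) - (2 * n - 1) * (13 * n\<^sup>2 - 13 * n + 4) * I14 (m + 1) -
      3 * (n - 1) * (3 * n - 2) * (3 * n - 4) * I14 m"
    by (simp only: sums_unique2)
  then show ?thesis by simp
qed

text \<open>Twice the terms with even denominators minus all terms; the denominator
  \<open>k + 1\<close> is even exactly for odd \<open>k\<close>.\<close>

lemma alternating_squares_sums: "(\<lambda>k. (- 1) ^ Suc k * (1 / (real k + 1)\<^sup>2)) sums (- zeta_int 2 / 2)"
proof -
  define f where "f = (\<lambda>k::nat. if odd k then 2 * (1 / (real k + 1)\<^sup>2) else 0)"
  have "(\<lambda>j. 1 / 2 * (1 / (real j + 1)\<^sup>2)) sums (1 / 2 * zeta_int 2)"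
    by (intro sums_mult zeta_int_sums) simp
  moreover have "1 / 2 * (1 / (real j + 1)\<^sup>2) = f (2 * j + 1)" for j
    by (simp add: f_def divide_simps power2_eq_square) (simp add: algebra_simps)
  ultimately have "(\<lambda>j. f (2 * j + 1)) sums (1 / 2 * zeta_int 2)" by simp
  then have "f sums (1 / 2 * zeta_int 2)"
  proof (subst (asm) sums_mono_reindex)
    show "strict_mono (\<lambda>j::nat. 2 * j + 1)" by (auto simp: strict_mono_def)
    show "f k = 0" if "k \<notin> range (\<lambda>j. 2 * j + 1)" for k
      using that unfolding f_def by (metis oddE rangeI)
  qed
  then have "(\<lambda>k. f k - 1 / (real k + 1)\<^sup>2) sums (1 / 2 * zeta_int 2 - zeta_int 2)"
    by (intro sums_diff zeta_int_sums) auto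
  moreover have "f k - 1 / (real k + 1)\<^sup>2 = (- 1) ^ Suc k * (1 / (real k + 1)\<^sup>2)" for k
    by (simp add: f_def)
  ultimately show ?thesis by simp
qed

lemma I14_0: "I14 0 = - 2 * zeta_int 2"
proof -
  have "(\<lambda>k. 4 * ((- 1) ^ Suc k * (1 / (real k + 1)\<^sup>2))) sums (4 * (- zeta_int 2 / 2))"
    by (intro sums_mult alternating_squares_sums)
  moreover have "4 * ((- 1) ^ Suc k * (1 / (real k + 1)\<^sup>2)) = (- 1) ^ Suc k * f14 0 ((real k + 1) / 2)" for k
    by (simp add: f14_0 power_divide)
  ultimately show ?thesis by (simp add: I14_def sums_iff)
qed

text \<open>With \<open>x = k + 1\<close>, the partial fractions of \<open>f14 1 (x / 2)\<close> are
  \<open>- 4 / x + 4 / (x + 2) + 16 / (x + 2) ^ 2\<close>. The simple poles form the pattern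
  \<open>e k - e (k + 2)\<close>; the double pole is the alternating series of squares moved by two,
  which keeps its sign.\<close>

lemma I14_1: "I14 1 = 14 - 8 * zeta_int 2"
proof -
  define e where "e = (\<lambda>k. - 4 / (real k + 1))"
  have "e \<longlonglongrightarrow> 0" unfolding e_def by real_asymp
  then have 1: "(\<lambda>k. (- 1) ^ Suc k * (e k - e (k + 2))) sums (e 1 - e 0)"
    by (intro alternating_telescope_sums convergentI)
  define g where "g = (\<lambda>k. (- 1) ^ Suc k * (1 / (real k + 1)\<^sup>2))"
  have "(\<lambda>k. g (k + 2)) sums (- zeta_int 2 / 2 - (\<Sum>i<2. g i))"
    by (rule sums_split_initial_segment) (unfold g_def, rule alternating_squares_sums)
  then have "(\<lambda>k. 16 * g (k + 2)) sums (16 * (- zeta_int 2 / 2 - (\<Sum>i<2. g i)))"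
    by (rule sums_mult)
  from sums_add[OF 1 this]
  have "(\<lambda>k. (- 1) ^ Suc k * (e k - e (k + 2)) + 16 * g (k + 2)) sums (e 1 - e 0 + 16 * (- zeta_int 2 / 2 - (\<Sum>i<2. g i)))" .
  moreover have "(- 1) ^ Suc k * (e k - e (k + 2)) + 16 * g (k + 2) = (- 1) ^ Suc k * f14 1 ((real k + 1) / 2)" for k
  proof -
    define x where "x = real k + 1"
    have x: "x > 0" by (simp add: x_def)
    have A: "e k - e (k + 2) + 16 * (1 / (x + 2)\<^sup>2) = f14 1 (x / 2)"
    proof -
      have "e k = - 4 / x" "e (k + 2) = - 4 / (x + 2)" by (simp_all add: e_def x_def add_ac)
      moreover have "f14 1 (x / 2) = 2 * (x / 2) * (x / 2 - 1) / (x / 2 * (x / 2 + 1))\<^sup>2"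
        by (simp add: f14_def)
      moreover have "\<dots> = 8 * (x - 2) / (x * (x + 2)\<^sup>2)"
        using x by (simp add: divide_simps power2_eq_square)
      moreover have "- 4 / x - (- 4 / (x + 2)) + 16 * (1 / (x + 2)\<^sup>2) = 8 * (x - 2) / (x * (x + 2)\<^sup>2)"
        using x by (simp add: divide_simps) Groebner_Basis.algebra
      ultimately show ?thesis by simp
    qed
    have "g (k + 2) = (- 1) ^ Suc k * (1 / (x + 2)\<^sup>2)"
      by (simp add: g_def x_def add_ac)
    then show ?thesis
      unfolding x_def[symmetric] A[symmetric] by (simp only: distrib_left mult.left_commute)
  qed
  moreover have "e 1 - e 0 + 16 * (- zeta_int 2 / 2 - (\<Sum>i<2. g i)) = 14 - 8 * zeta_int 2"
    by (simp add: e_def g_def numeral_2_eq_2)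
  ultimately show ?thesis by (simp add: I14_def sums_iff)
qed

lemma limit_V14: "(\<lambda>n. seq_b P14 Q14 n / seq_a P14 Q14 n) \<longlonglongrightarrow> zeta_int 2 / 7"
proof -
  have "(\<lambda>n. seq_b P14 Q14 n / seq_a P14 Q14 n) \<longlonglongrightarrow> - I14 0 / 14"
  proof (rule apery_limit[where c = 4])
    show "4\<^sup>2 * real n ^ 3 \<le> 4 * P14 n + min 0 (Q14 n)" if "n \<ge> 3" for n
    proof -
      define x where "x = real n - 3"
      have "x \<ge> 0" "real n = x + 3" using that by (auto simp: x_def)
      then show ?thesis by (simp add: P14_def Q14_def algebra_simps power2_eq_square power3_eq_cube)
    qed
    show "real n ^ 3 * I14 n = P14 n * I14 (n - 1) + Q14 n * I14 (n - 2)" if n: "n \<ge> 2" for n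
    proof -
      obtain m where "n = m + 2" using le_add_diff_inverse2[OF n] by metis
      then show ?thesis using I14_rec[of m] by (simp add: P14_def Q14_def add.commute)
    qed
    show "(\<lambda>n. I14 n / 4 ^ n) \<longlonglongrightarrow> 0"
    proof (rule Lim_null_comparison)
      show "\<forall>\<^sub>F n in sequentially. norm (I14 n / 4 ^ n) \<le> 4 * zeta_int 2 * (2 ^ n / 4 ^ n)"
        using I14_bound by (intro always_eventually) (auto simp: divide_simps mult_ac)
      show "(\<lambda>n. 4 * zeta_int 2 * (2 ^ n / 4 ^ n)) \<longlonglongrightarrow> 0"
        by (intro tendsto_mult_right_zero) real_asymp
    qed
    show "I14 1 = P14 1 * I14 0 + 14" by (simp add: P14_def I14_0 I14_1[simplified])
  qed (auto simp: P14_def Q14_def)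
  then show ?thesis by (simp add: I14_0)
qed

section \<open>The integrals for V18\<close>

definition y18 :: "real \<Rightarrow> real \<Rightarrow> real" where
  "y18 h t = 2 + h - (1 + h * t) - (1 + h) / (1 + h * t)"

text \<open>This is \<open>2 * h ^ n * Q_n (1 + 2 / h)\<close> with \<open>Q_n\<close> the Legendre
  function of the second kind, as the recurrence and the values at \<open>n = 0\<close> and
  \<open>n = 1\<close> show.\<close>

definition mu18 :: "nat \<Rightarrow> real \<Rightarrow> real" where
  "mu18 n h = integral {0..1} (\<lambda>t. y18 h t ^ n * (h / (1 + h * t)))"

text \<open>By \<open>K18_eq\<close> a quadratic form in \<open>t\<close> and \<open>1 - t\<close>.
  Its middle coefficient \<open>3 * h + 2\<close> and its discriminant
  \<open>- h ^ 2 * (4 * h + 3)\<close> supply the coefficients in the recurrence for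
  \<open>nu18\<close>.\<close>

definition K18 :: "real \<Rightarrow> real \<Rightarrow> real" where
  "K18 h t = (h * t)\<^sup>2 - (2 * h + 1) * (h * t) + (1 + h)\<^sup>2"

text \<open>After rescaling by powers of the root of the discriminant of \<open>K18\<close>, these
  satisfy Legendre's recurrence at a purely imaginary argument.\<close>

definition nu18 :: "nat \<Rightarrow> real \<Rightarrow> real" where
  "nu18 n h = integral {0..1} (\<lambda>t. (t * (1 - t)) ^ n / K18 h t ^ Suc n)"

lemma one_plus_pos: "h > 0 \<Longrightarrow> t \<ge> 0 \<Longrightarrow> 1 + h * t > (0::real)"
  by (simp add: add_pos_nonneg)

lemma y18_eq: "h > 0 \<Longrightarrow> t \<ge> 0 \<Longrightarrow> y18 h t = h\<^sup>2 * (t * (1 - t)) / (1 + h * t)"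
  using one_plus_pos[of h t] by (simp add: y18_def divide_simps) Groebner_Basis.algebra

lemma K18_eq: "K18 h t = (1 + h) * t\<^sup>2 + (3 * h + 2) * (t * (1 - t)) + (1 + h)\<^sup>2 * (1 - t)\<^sup>2"
  unfolding K18_def by Groebner_Basis.algebra

lemma K18_ge_1:
  assumes "h > 0" "t \<in> {0..1}"
  shows "K18 h t \<ge> 1"
proof -
  have "K18 h t = 1 + (h * t\<^sup>2 + 3 * h * (t * (1 - t)) + (2 * h + h\<^sup>2) * (1 - t)\<^sup>2)"
    unfolding K18_def by Groebner_Basis.algebra
  then show ?thesis using assms by simp
qed

lemma mu18_integrable: "h > 0 \<Longrightarrow> (\<lambda>t. y18 h t ^ n * (h / (1 + h * t))) integrable_on {0..1}"
  using one_plus_pos[of h] unfolding y18_def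
  by (intro integrable_continuous_real continuous_intros) (auto simp: less_imp_neq[symmetric])

lemma nu18_integrable: "h > 0 \<Longrightarrow> (\<lambda>t. (t * (1 - t)) ^ n / K18 h t ^ Suc n) integrable_on {0..1}"
proof (intro integrable_continuous_real continuous_intros)
  assume "h > 0"
  then show "\<forall>t\<in>{0..1}. K18 h t ^ Suc n \<noteq> 0" using K18_ge_1 by fastforce
  show "continuous_on {0..1} (K18 h)" unfolding K18_def by (intro continuous_intros)
qed

section \<open>Recurrences in \<open>n\<close> and closed forms of the first integrals\<close>

text \<open>The primitive is \<open>(e - w) * y ^ (m + 1)\<close> with \<open>e = 1 + h * t\<close>
  and \<open>w = (1 + h) / e\<close>. From \<open>e * w = 1 + h\<close> and
  \<open>e + w = 2 + h - y\<close> one gets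
  \<open>(e - w) ^ 2 = h ^ 2 - 2 * (2 + h) * y + y ^ 2\<close>, so its derivative involves only
  powers of \<open>y\<close>; and \<open>y18\<close> vanishes at both ends.\<close>

lemma mu18_rec:
  assumes h: "h > 0"
  shows "(real m + 2) * mu18 (m + 2) h =
    (2 * real m + 3) * (2 + h) * mu18 (m + 1) h - (real m + 1) * h\<^sup>2 * mu18 m h"
proof -
  define F where "F = (\<lambda>t. (1 + h * t - (1 + h) / (1 + h * t)) * y18 h t ^ (m + 1))"
  define k where "k = (\<lambda>t. h / (1 + h * t))"
  have "((\<lambda>t. (2 * real m + 3) * (2 + h) * (y18 h t ^ (m + 1) * k t) - (real m + 2) * (y18 h t ^ (m + 2) * k t)
      - (real m + 1) * h\<^sup>2 * (y18 h t ^ m * k t)) has_integral F 1 - F 0) {0..1}"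
  proof (rule fundamental_theorem_of_calculus)
    fix t :: real assume "t \<in> {0..1}"
    define e where "e = 1 + h * t"
    define y where "y = y18 h t"
    have e: "e > 0" using one_plus_pos[OF h] \<open>t \<in> {0..1}\<close> by (simp add: e_def)
    have y: "y * e = (2 + h) * e - e\<^sup>2 - (1 + h)"
      using e by (simp add: y_def y18_def e_def[symmetric] field_simps power2_eq_square)
    have "(y18 h has_real_derivative - h + (1 + h) * h / e\<^sup>2) (at t within {0..1})"
      unfolding y18_def[abs_def] using e
      by (auto intro!: derivative_eq_intros simp: e_def power2_eq_square)
    from DERIV_power[OF this, of "m + 1"]
    have dy: "((\<lambda>t. y18 h t ^ (m + 1)) has_real_derivative (real m + 1) * (- h + (1 + h) * h / e\<^sup>2) * y ^ m) (at t within {0..1})"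
      by (simp add: y_def mult_ac add.commute)
    have "((\<lambda>t. 1 + h * t - (1 + h) / (1 + h * t)) has_real_derivative h + (1 + h) * h / e\<^sup>2) (at t within {0..1})"
      using e by (auto intro!: derivative_eq_intros simp: e_def power2_eq_square)
    from DERIV_mult[OF this dy]
    have "(F has_real_derivative (h + (1 + h) * h / e\<^sup>2) * y ^ (m + 1) +
        (real m + 1) * (- h + (1 + h) * h / e\<^sup>2) * y ^ m * (e - (1 + h) / e)) (at t within {0..1})"
      by (simp add: F_def[abs_def] e_def y_def)
    moreover have "(h + (1 + h) * h / e\<^sup>2) * y ^ (m + 1) +
        (real m + 1) * (- h + (1 + h) * h / e\<^sup>2) * y ^ m * (e - (1 + h) / e) =
        (2 * real m + 3) * (2 + h) * (y ^ (m + 1) * (h / e)) - (real m + 2) * (y ^ (m + 2) * (h / e)) - (real m + 1) * h\<^sup>2 * (y ^ m * (h / e))"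
    proof -
      define w where "w = (1 + h) / e"
      define q where "q = h / e"
      have w: "w = 2 + h - e - y" using y e by (simp add: w_def field_simps power2_eq_square)
      have "e * w = 1 + h" using e by (simp add: w_def)
      then have sq: "(e - w)\<^sup>2 = h\<^sup>2 - 2 * (2 + h) * y + y\<^sup>2" using w by Groebner_Basis.algebra
      have "(1 + h) * h / e\<^sup>2 = w * q" "h = e * q"
        using e by (simp_all add: w_def q_def power2_eq_square)
      then have "(h + (1 + h) * h / e\<^sup>2) * y ^ (m + 1) + (real m + 1) * (- h + (1 + h) * h / e\<^sup>2) * y ^ m * (e - w) =
          (e + w) * q * (y * y ^ m) - (real m + 1) * q * (e - w)\<^sup>2 * y ^ m"
        by (simp only:) (simp add: algebra_simps power2_eq_square)
      also have "\<dots> = (2 * real m + 3) * (2 + h) * (y ^ (m + 1) * q) - (real m + 2) * (y ^ (m + 2) * q) - (real m + 1) * h\<^sup>2 * (y ^ m * q)"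
      proof -
        have "e + w = 2 + h - y" using w by simp
        then show ?thesis unfolding sq by (simp only:) (simp add: algebra_simps power2_eq_square)
      qed
      finally show ?thesis by (simp only: w_def q_def)
    qed
    ultimately show "(F has_vector_derivative (2 * real m + 3) * (2 + h) * (y18 h t ^ (m + 1) * k t) - (real m + 2) * (y18 h t ^ (m + 2) * k t)
      - (real m + 1) * h\<^sup>2 * (y18 h t ^ m * k t)) (at t within {0..1})"
      by (simp add: has_real_derivative_iff_has_vector_derivative k_def y_def e_def)
  qed simp
  moreover have "((\<lambda>t. (2 * real m + 3) * (2 + h) * (y18 h t ^ (m + 1) * k t) - (real m + 2) * (y18 h t ^ (m + 2) * k t)
      - (real m + 1) * h\<^sup>2 * (y18 h t ^ m * k t)) has_integral
      (2 * real m + 3) * (2 + h) * mu18 (m + 1) h - (real m + 2) * mu18 (m + 2) h - (real m + 1) * h\<^sup>2 * mu18 m h) {0..1}"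
    unfolding mu18_def k_def
    by (intro has_integral_diff has_integral_mult_right integrable_integral mu18_integrable h)
  ultimately have "(2 * real m + 3) * (2 + h) * mu18 (m + 1) h - (real m + 2) * mu18 (m + 2) h - (real m + 1) * h\<^sup>2 * mu18 m h = F 1 - F 0"
    using has_integral_unique by blast
  moreover have "F 0 = 0" "F 1 = 0" using h by (simp_all add: F_def y18_def)
  ultimately show ?thesis by simp
qed

lemma mu18_0: "h > 0 \<Longrightarrow> mu18 0 h = ln (1 + h)"
proof -
  assume h: "h > 0"
  have "((\<lambda>t. h / (1 + h * t)) has_integral ln (1 + h * 1) - ln (1 + h * 0)) {0..1}"
  proof (rule fundamental_theorem_of_calculus)
    fix t :: real assume "t \<in> {0..1}"
    then have "1 + h * t > 0" using one_plus_pos[OF h] by simp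
    then show "((\<lambda>t. ln (1 + h * t)) has_vector_derivative h / (1 + h * t)) (at t within {0..1})"
      unfolding has_real_derivative_iff_has_vector_derivative[symmetric]
      by (auto intro!: derivative_eq_intros)
  qed simp
  then show ?thesis by (simp add: mu18_def integral_unique)
qed

lemma mu18_1: "h > 0 \<Longrightarrow> mu18 1 h = (2 + h) * ln (1 + h) - 2 * h"
proof -
  assume h: "h > 0"
  have "((\<lambda>t. (2 + h) * (y18 h t ^ 0 * (h / (1 + h * t))) - y18 h t ^ 1 * (h / (1 + h * t))) has_integral
      (1 + h * 1 - (1 + h) / (1 + h * 1)) - (1 + h * 0 - (1 + h) / (1 + h * 0))) {0..1}"
  proof (rule fundamental_theorem_of_calculus)
    fix t :: real assume "t \<in> {0..1}"
    then have pos: "1 + h * t > 0" using one_plus_pos[OF h] by simp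
    then have "((\<lambda>t. 1 + h * t - (1 + h) / (1 + h * t)) has_real_derivative
        h + (1 + h) * h / (1 + h * t)\<^sup>2) (at t within {0..1})"
      by (auto intro!: derivative_eq_intros simp: power2_eq_square)
    moreover have "h + (1 + h) * h / (1 + h * t)\<^sup>2 =
        (2 + h) * (y18 h t ^ 0 * (h / (1 + h * t))) - y18 h t ^ 1 * (h / (1 + h * t))"
      using pos by (simp add: y18_def divide_simps) Groebner_Basis.algebra
    ultimately show "((\<lambda>t. 1 + h * t - (1 + h) / (1 + h * t)) has_vector_derivative
        (2 + h) * (y18 h t ^ 0 * (h / (1 + h * t))) - y18 h t ^ 1 * (h / (1 + h * t))) (at t within {0..1})"
      by (simp only: has_real_derivative_iff_has_vector_derivative)
  qed simp
  moreover have "((\<lambda>t. (2 + h) * (y18 h t ^ 0 * (h / (1 + h * t))) - y18 h t ^ 1 * (h / (1 + h * t))) has_integral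
      (2 + h) * mu18 0 h - mu18 1 h) {0..1}"
    unfolding mu18_def
    by (intro has_integral_diff has_integral_mult_right integrable_integral mu18_integrable h)
  ultimately have "(2 + h) * mu18 0 h - mu18 1 h = (1 + h * 1 - (1 + h) / (1 + h * 1)) - (1 + h * 0 - (1 + h) / (1 + h * 0))"
    using has_integral_unique by blast
  then show ?thesis using h by (simp add: mu18_0)
qed

text \<open>One primitive serves twice: for \<open>n >= 1\<close> it vanishes at both ends and
  yields the recurrence, while for \<open>n = 0\<close> its boundary values yield
  \<open>nu18 1\<close>.\<close>

lemma nu18_FTC:
  assumes h: "h > 0" and t: "t \<in> {0..1}"
  defines "F \<equiv> \<lambda>n t. ((1 + h) * t\<^sup>2 - (1 + h)\<^sup>2 * (1 - t)\<^sup>2) * (t * (1 - t)) ^ n / K18 h t ^ Suc n"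
  shows "(F n has_real_derivative
     (2 * real n + 1) * (3 * h + 2) * ((t * (1 - t)) ^ n / K18 h t ^ Suc n) +
     (real n + 1) * (h\<^sup>2 * (4 * h + 3)) * ((t * (1 - t)) ^ Suc n / K18 h t ^ Suc (Suc n)) -
     real n * ((t * (1 - t)) ^ (n - 1) / K18 h t ^ n)) (at t within {0..1})"
proof -
  define k where "k = K18 h t"
  have k: "k > 0" using K18_ge_1[OF h t] by (simp add: k_def)
  define k' where "k' = 2 * h\<^sup>2 * t - (2 * h + 1) * h"
  define v where "v = (1 + h) * t\<^sup>2 - (1 + h)\<^sup>2 * (1 - t)\<^sup>2"
  define v' where "v' = 2 * (1 + h) * t + 2 * (1 + h)\<^sup>2 * (1 - t)"
  define p where "p = (t * (1 - t)) ^ (n - 1)"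
  define u where "u = t * (1 - t)"
  have dk: "(K18 h has_real_derivative k') (at t within {0..1})"
    unfolding K18_def[abs_def] k'_def by (auto intro!: derivative_eq_intros simp: power2_eq_square algebra_simps)
  have dv: "((\<lambda>t. (1 + h) * t\<^sup>2 - (1 + h)\<^sup>2 * (1 - t)\<^sup>2) has_real_derivative v') (at t within {0..1})"
    unfolding v'_def by (auto intro!: derivative_eq_intros simp: power2_eq_square algebra_simps)
  have du: "((\<lambda>t. (t * (1 - t)) ^ n) has_real_derivative real n * ((1 - 2 * t) * p)) (at t within {0..1})"
    unfolding p_def by (auto intro!: derivative_eq_intros simp: algebra_simps)
  have dkn: "((\<lambda>t. K18 h t ^ Suc n) has_real_derivative (real n + 1) * (k ^ n * k')) (at t within {0..1})"
    using DERIV_power[OF dk, of "Suc n"] by (simp add: k_def algebra_simps)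
  have dF: "(F n has_real_derivative
      ((v' * u ^ n + real n * ((1 - 2 * t) * p) * v) * k ^ Suc n - v * u ^ n * ((real n + 1) * (k ^ n * k'))) / (k ^ Suc n * k ^ Suc n))
      (at t within {0..1})"
    unfolding F_def
    using DERIV_divide[OF DERIV_mult[OF dv du] dkn] k by (simp add: v_def u_def k_def)
  \<comment> \<open>The exponent \<open>n - 1\<close> is truncated at \<open>n = 0\<close>; the
    factor \<open>real n\<close> makes the identity true there too.\<close>
  have np: "real n * u ^ n = real n * (u * p)" by (cases n) (simp_all add: p_def u_def)
  have k_eq: "k = (1 + h) * t\<^sup>2 + (3 * h + 2) * u + (1 + h)\<^sup>2 * (1 - t)\<^sup>2"
    by (simp add: k_def K18_eq u_def)
  \<comment> \<open>These two identities express everything that differentiation produces through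
    \<open>k\<close> and \<open>u\<close> alone, so the derivative is a combination of three
    neighbouring integrands.\<close>
  have id1: "v' * k - v * k' = (3 * h + 2) * k + h\<^sup>2 * (4 * h + 3) * u"
    unfolding v'_def v_def k_eq k'_def u_def by Groebner_Basis.algebra
  have id2: "(1 - 2 * t) * v * k - v * u * k' = 2 * (3 * h + 2) * u * k + h\<^sup>2 * (4 * h + 3) * u\<^sup>2 - k\<^sup>2"
    unfolding v'_def v_def k_eq k'_def u_def by Groebner_Basis.algebra
  have "((v' * u ^ n + real n * ((1 - 2 * t) * p) * v) * k ^ Suc n - v * u ^ n * ((real n + 1) * (k ^ n * k'))) / (k ^ Suc n * k ^ Suc n)
      = (u ^ n * (v' * k - v * k') + real n * p * ((1 - 2 * t) * v * k - v * u * k')) / (k\<^sup>2 * k ^ n)"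
  proof -
    have "(v' * u ^ n + real n * ((1 - 2 * t) * p) * v) * k ^ Suc n - v * u ^ n * ((real n + 1) * (k ^ n * k'))
       = k ^ n * ((v' * u ^ n + real n * ((1 - 2 * t) * p) * v) * k - v * (u ^ n + real n * u ^ n) * k')"
      by (simp add: algebra_simps)
    also have "\<dots> = k ^ n * (u ^ n * (v' * k - v * k') + real n * p * ((1 - 2 * t) * v * k - v * u * k'))"
      unfolding np by (simp add: algebra_simps)
    finally show ?thesis using k by (simp add: power2_eq_square mult_ac)
  qed
  also have "\<dots> = (2 * real n + 1) * (3 * h + 2) * (u ^ n / k ^ Suc n) +
     (real n + 1) * (h\<^sup>2 * (4 * h + 3)) * (u ^ Suc n / k ^ Suc (Suc n)) - real n * (p / k ^ n)"
  proof -
    have "u ^ n * (v' * k - v * k') + real n * p * ((1 - 2 * t) * v * k - v * u * k') =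
       (2 * real n + 1) * (3 * h + 2) * (u ^ n * k) + (real n + 1) * (h\<^sup>2 * (4 * h + 3)) * (u ^ n * u) - real n * p * k\<^sup>2"
      unfolding id1 id2
    proof -
      have "U * ((3 * h + 2) * k + h\<^sup>2 * (4 * h + 3) * u) +
          N * p * (2 * (3 * h + 2) * u * k + h\<^sup>2 * (4 * h + 3) * u\<^sup>2 - k\<^sup>2) =
          (2 * N + 1) * (3 * h + 2) * (U * k) + (N + 1) * (h\<^sup>2 * (4 * h + 3)) * (U * u) - N * p * k\<^sup>2"
        if "N * U = N * (u * p)" for N U :: real
        using that by Groebner_Basis.algebra
      from this[OF np] show "u ^ n * ((3 * h + 2) * k + h\<^sup>2 * (4 * h + 3) * u) +
          real n * p * (2 * (3 * h + 2) * u * k + h\<^sup>2 * (4 * h + 3) * u\<^sup>2 - k\<^sup>2) =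
          (2 * real n + 1) * (3 * h + 2) * (u ^ n * k) + (real n + 1) * (h\<^sup>2 * (4 * h + 3)) * (u ^ n * u) - real n * p * k\<^sup>2" .
    qed
    then show ?thesis
      using k by (simp only: add_divide_distrib diff_divide_distrib) (simp add: power2_eq_square mult_ac)
  qed
  finally show ?thesis using dF by (simp add: k_def u_def p_def)
qed

lemma nu18_rec:
  assumes h: "h > 0"
  shows "(real m + 2) * (h\<^sup>2 * (4 * h + 3)) * nu18 (m + 2) h =
    (real m + 1) * nu18 m h - (2 * real m + 3) * (3 * h + 2) * nu18 (m + 1) h"
proof -
  define \<phi> where "\<phi> = (\<lambda>n t. (t * (1 - t)) ^ n / K18 h t ^ Suc n)"
  define F where "F = (\<lambda>t. ((1 + h) * t\<^sup>2 - (1 + h)\<^sup>2 * (1 - t)\<^sup>2) * (t * (1 - t)) ^ Suc m / K18 h t ^ Suc (Suc m))"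
  have "((\<lambda>t. (2 * real m + 3) * (3 * h + 2) * \<phi> (Suc m) t + (real m + 2) * (h\<^sup>2 * (4 * h + 3)) * \<phi> (Suc (Suc m)) t -
     (real m + 1) * \<phi> m t) has_integral F 1 - F 0) {0..1}"
  proof (rule fundamental_theorem_of_calculus)
    fix t :: real assume "t \<in> {0..1}"
    then show "(F has_vector_derivative (2 * real m + 3) * (3 * h + 2) * \<phi> (Suc m) t +
        (real m + 2) * (h\<^sup>2 * (4 * h + 3)) * \<phi> (Suc (Suc m)) t - (real m + 1) * \<phi> m t) (at t within {0..1})"
      using nu18_FTC[OF h, of t "Suc m"]
      by (simp add: has_real_derivative_iff_has_vector_derivative F_def[abs_def] \<phi>_def add.commute)
  qed simp
  moreover have "((\<lambda>t. (2 * real m + 3) * (3 * h + 2) * \<phi> (Suc m) t + (real m + 2) * (h\<^sup>2 * (4 * h + 3)) * \<phi> (Suc (Suc m)) t -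
     (real m + 1) * \<phi> m t) has_integral
     (2 * real m + 3) * (3 * h + 2) * nu18 (Suc m) h + (real m + 2) * (h\<^sup>2 * (4 * h + 3)) * nu18 (Suc (Suc m)) h
     - (real m + 1) * nu18 m h) {0..1}"
    unfolding nu18_def \<phi>_def
    by (intro has_integral_diff has_integral_add has_integral_mult_right integrable_integral nu18_integrable h)
  ultimately have "(2 * real m + 3) * (3 * h + 2) * nu18 (Suc m) h + (real m + 2) * (h\<^sup>2 * (4 * h + 3)) * nu18 (Suc (Suc m)) h
     - (real m + 1) * nu18 m h = F 1 - F 0"
    using has_integral_unique by blast
  moreover have "F 0 = 0" "F 1 = 0" by (simp_all add: F_def)
  ultimately show ?thesis by simp
qed

lemma nu18_rec_eq:
  "h > 0 \<Longrightarrow> nu18 (m + 2) h =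
    ((real m + 1) * nu18 m h - (2 * real m + 3) * (3 * h + 2) * nu18 (m + 1) h) / ((real m + 2) * (h\<^sup>2 * (4 * h + 3)))"
  using nu18_rec[of h m] by (simp add: nonzero_eq_divide_eq mult.commute)

text \<open>The constant 2 is the boundary contribution: the primitive with \<open>n = 0\<close> is
  1 at \<open>t = 1\<close> and -1 at \<open>t = 0\<close>.\<close>

lemma nu18_1:
  assumes h: "h > 0"
  shows "h\<^sup>2 * (4 * h + 3) * nu18 1 h = 2 - (3 * h + 2) * nu18 0 h"
proof -
  have "((\<lambda>t. (2 * real 0 + 1) * (3 * h + 2) * ((t * (1 - t)) ^ 0 / K18 h t ^ Suc 0) +
     (real 0 + 1) * (h\<^sup>2 * (4 * h + 3)) * ((t * (1 - t)) ^ Suc 0 / K18 h t ^ Suc (Suc 0)) -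
     real 0 * ((t * (1 - t)) ^ (0 - 1) / K18 h t ^ 0)) has_integral
     ((1 + h) * 1\<^sup>2 - (1 + h)\<^sup>2 * (1 - 1)\<^sup>2) * (1 * (1 - 1)) ^ 0 / K18 h 1 ^ Suc 0 -
     ((1 + h) * 0\<^sup>2 - (1 + h)\<^sup>2 * (1 - 0)\<^sup>2) * (0 * (1 - 0)) ^ 0 / K18 h 0 ^ Suc 0) {0..1}"
    by (rule fundamental_theorem_of_calculus)
       (use nu18_FTC[OF h, of _ 0] in \<open>simp_all only: has_real_derivative_iff_has_vector_derivative zero_le_one\<close>)
  then have "((\<lambda>t. (3 * h + 2) * ((t * (1 - t)) ^ 0 / K18 h t ^ Suc 0) +
     (h\<^sup>2 * (4 * h + 3)) * ((t * (1 - t)) ^ Suc 0 / K18 h t ^ Suc (Suc 0))) has_integral 2) {0..1}"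
    using h by (simp add: K18_eq)
  moreover have "((\<lambda>t. (3 * h + 2) * ((t * (1 - t)) ^ 0 / K18 h t ^ Suc 0) +
     (h\<^sup>2 * (4 * h + 3)) * ((t * (1 - t)) ^ Suc 0 / K18 h t ^ Suc (Suc 0))) has_integral
     (3 * h + 2) * nu18 0 h + (h\<^sup>2 * (4 * h + 3)) * nu18 (Suc 0) h) {0..1}"
    unfolding nu18_def
    by (intro has_integral_add has_integral_mult_right integrable_integral nu18_integrable h)
  ultimately have "2 = (3 * h + 2) * nu18 0 h + (h\<^sup>2 * (4 * h + 3)) * nu18 (Suc 0) h"
    by (rule has_integral_unique)
  then show ?thesis by simp
qed

lemma nu18_1_eq: "h > 0 \<Longrightarrow> nu18 1 h = (2 - (3 * h + 2) * nu18 0 h) / (h\<^sup>2 * (4 * h + 3))"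
  using nu18_1[of h] by (simp add: nonzero_eq_divide_eq mult.commute)

text \<open>The elementary integral is a difference of two arctangents;
  \<open>2 * h + 1 = (r ^ 2 - 1) / 2\<close> lets the doubling formula merge them. The factor
  \<open>3 * arctan r - pi\<close> is \<open>3 * (Arg z - pi / 3)\<close> for
  \<open>z = (1 + i * r) / 2\<close>, the link with \<open>f18\<close>.\<close>

lemma nu18_0:
  assumes h: "h > 0"
  shows "nu18 0 h = 2 * (3 * arctan (sqrt (4 * h + 3)) - pi) / (h * sqrt (4 * h + 3))"
proof -
  define r where "r = sqrt (4 * h + 3)"
  have r2: "r\<^sup>2 = 4 * h + 3" using h by (simp add: r_def)
  have r: "r > 1" using h unfolding r_def by (simp add: real_less_rsqrt)
  define F where "F = (\<lambda>t. 2 / (h * r) * arctan ((2 * h * t - 2 * h - 1) / r))"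
  have "((\<lambda>t. (t * (1 - t)) ^ 0 / K18 h t ^ Suc 0) has_integral F 1 - F 0) {0..1}"
  proof (rule fundamental_theorem_of_calculus)
    fix t :: real assume t: "t \<in> {0..1}"
    define x where "x = 2 * h * t - 2 * h - 1"
    have "4 * K18 h t = r\<^sup>2 + x\<^sup>2" unfolding K18_def r2 x_def by Groebner_Basis.algebra
    moreover have "K18 h t > 0" using K18_ge_1[OF h t] by simp
    moreover have "(F has_real_derivative 2 / (h * r) * (2 * h / r / (1 + (x / r)\<^sup>2))) (at t within {0..1})"
    proof -
      have "((\<lambda>t. (2 * h * t - 2 * h - 1) / r) has_real_derivative 2 * h / r) (at t within {0..1})"
        using r by (auto intro!: derivative_eq_intros)
      from DERIV_cmult[OF DERIV_chain2[OF DERIV_arctan this], of "2 / (h * r)"]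
      show ?thesis by (simp add: F_def x_def divide_inverse mult_ac)
    qed
    moreover have "2 / (h * r) * (2 * h / r / (1 + (x / r)\<^sup>2)) = 4 / (r\<^sup>2 + x\<^sup>2)"
      using h r by (simp add: divide_simps add_pos_nonneg power2_eq_square)
    ultimately show "(F has_vector_derivative (t * (1 - t)) ^ 0 / K18 h t ^ Suc 0) (at t within {0..1})"
      by (simp add: has_real_derivative_iff_has_vector_derivative flip: \<open>4 * K18 h t = r\<^sup>2 + x\<^sup>2\<close>)
  qed simp
  then have "nu18 0 h = F 1 - F 0" unfolding nu18_def by (rule integral_unique)
  also have "\<dots> = 2 / (h * r) * (arctan ((2 * h + 1) / r) - arctan (1 / r))"
  proof -
    have "(2 * h * 1 - 2 * h - 1) / r = - (1 / r)" "(2 * h * 0 - 2 * h - 1) / r = - ((2 * h + 1) / r)"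
      using r by (simp_all add: field_simps)
    then show ?thesis unfolding F_def by (simp only: arctan_minus) (simp add: right_diff_distrib)
  qed
  also have "arctan (1 / r) = pi / 2 - arctan r"
    using arctan_inverse[of r] r by (simp add: inverse_eq_divide)
  also have "arctan ((2 * h + 1) / r) = 2 * arctan r - pi / 2"
  proof -
    have "2 * arctan (1 / r) = arctan (2 * (1 / r) / (1 - (1 / r)\<^sup>2))"
      using r by (intro arctan_double) auto
    also have "2 * (1 / r) / (1 - (1 / r)\<^sup>2) = 1 / ((2 * h + 1) / r)"
    proof -
      have "r\<^sup>2 - 1 \<noteq> 0" "2 * h + 1 = (r\<^sup>2 - 1) / 2" using r2 h by auto
      then show ?thesis using r by (simp add: divide_simps power2_eq_square)
    qed
    also have "arctan (1 / ((2 * h + 1) / r)) = pi / 2 - arctan ((2 * h + 1) / r)"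
      using arctan_inverse[of "(2 * h + 1) / r"] r h by (simp add: inverse_eq_divide)
    finally show ?thesis using \<open>arctan (1 / r) = pi / 2 - arctan r\<close> by simp
  qed
  finally show ?thesis by (simp add: r_def)
qed

section \<open>Differential systems in \<open>h\<close>\<close>

text \<open>No differentiation under the integral sign: the closed forms for \<open>n = 0\<close>
  and \<open>n = 1\<close> are differentiated, and the three-term recurrence carries the formulas
  upward. The order of the recurrence forces two consecutive indices in the induction, and each step
  rewrites the second formula into the shape of the first.\<close>

lemma mu18_deriv:
  assumes h: "h > 0"
  shows "(mu18 m has_real_derivative
      (real m * mu18 m h + ((2 * real m + 1) * (2 + h) * mu18 m h - (real m + 1) * mu18 (m + 1) h) / h) / (2 * (1 + h))) (at h) \<and>
    (mu18 (m + 1) has_real_derivative (real m + 1) / (2 * (1 + h)) * (mu18 (m + 1) h + h * mu18 m h)) (at h)"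
proof (induction m)
  case 0
  have d: "((\<lambda>h. ln (1 + h)) has_real_derivative 1 / (1 + h)) (at h)"
    using h by (auto intro!: derivative_eq_intros)
  have "(mu18 0 has_real_derivative 1 / (1 + h)) (at h)"
    by (rule has_field_derivative_transform_within_open[OF d, where S = "{0<..}"])
       (use h in \<open>auto simp: mu18_0\<close>)
  moreover have "((2 + h) * mu18 0 h - mu18 1 h) / h / (2 * (1 + h)) = 1 / (1 + h)"
    using h by (simp add: mu18_0 mu18_1[simplified] divide_simps)
  moreover have "((\<lambda>h. (2 + h) * ln (1 + h) - 2 * h) has_real_derivative (0 + 1) * ln (1 + h) + 1 / (1 + h) * (2 + h) - 2 * 1) (at h)"
    by (intro DERIV_diff DERIV_mult DERIV_add DERIV_const DERIV_ident DERIV_cmult d)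
  then have "((\<lambda>h. (2 + h) * ln (1 + h) - 2 * h) has_real_derivative ln (1 + h) + 1 / (1 + h) * (2 + h) - 2) (at h)"
    by simp
  then have "(mu18 1 has_real_derivative ln (1 + h) + 1 / (1 + h) * (2 + h) - 2) (at h)"
    by (rule has_field_derivative_transform_within_open[where S = "{0<..}"])
       (use h in \<open>auto simp: mu18_1[simplified]\<close>)
  moreover have "ln (1 + h) + 1 / (1 + h) * (2 + h) - 2 = 1 / (2 * (1 + h)) * (mu18 1 h + h * mu18 0 h)"
    using h by (simp add: mu18_0 mu18_1[simplified] divide_simps) (simp add: algebra_simps)
  ultimately show ?case by simp
next
  case (Suc m)
  define N where "N = real m"
  define a where "a = mu18 m h"
  define b where "b = mu18 (m + 1) h"
  have N: "N \<ge> 0" by (simp add: N_def)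
  have rec: "mu18 (m + 2) h = ((2 * N + 3) * (2 + h) * b - (N + 1) * h\<^sup>2 * a) / (N + 2)"
    using mu18_rec[OF h, of m] N by (simp add: N_def a_def b_def field_simps)
  have da: "(mu18 m has_real_derivative (N * a + ((2 * N + 1) * (2 + h) * a - (N + 1) * b) / h) / (2 * (1 + h))) (at h)"
    and db: "(mu18 (m + 1) has_real_derivative (N + 1) / (2 * (1 + h)) * (b + h * a)) (at h)"
    using Suc by (simp_all add: N_def a_def b_def)
  have A: "(N + 1) / (2 * (1 + h)) * (b + h * a) =
      ((N + 1) * b + ((2 * (N + 1) + 1) * (2 + h) * b - (N + 2) * (((2 * N + 3) * (2 + h) * b - (N + 1) * h\<^sup>2 * a) / (N + 2))) / h) / (2 * (1 + h))"
    using h N by (simp add: divide_simps) Groebner_Basis.algebra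
  have d2: "((\<lambda>h. h\<^sup>2) has_real_derivative 2 * h) (at h)"
    by (auto intro!: derivative_eq_intros)
  have "((\<lambda>h. ((2 * N + 3) * ((2 + h) * mu18 (m + 1) h) - (N + 1) * (h\<^sup>2 * mu18 m h)) / (N + 2)) has_real_derivative
      ((2 * N + 3) * ((0 + 1) * mu18 (m + 1) h + ((N + 1) / (2 * (1 + h)) * (b + h * a)) * (2 + h)) -
       (N + 1) * (2 * h * mu18 m h + ((N * a + ((2 * N + 1) * (2 + h) * a - (N + 1) * b) / h) / (2 * (1 + h))) * h\<^sup>2)) / (N + 2)) (at h)"
    by (intro DERIV_cdivide DERIV_diff DERIV_cmult DERIV_mult DERIV_add DERIV_const DERIV_ident d2 da db)
  then have "((\<lambda>h. ((2 * N + 3) * (2 + h) * mu18 (m + 1) h - (N + 1) * h\<^sup>2 * mu18 m h) / (N + 2)) has_real_derivative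
      ((2 * N + 3) * (b + (2 + h) * ((N + 1) / (2 * (1 + h)) * (b + h * a))) -
       (N + 1) * (2 * h * a + h\<^sup>2 * ((N * a + ((2 * N + 1) * (2 + h) * a - (N + 1) * b) / h) / (2 * (1 + h))))) / (N + 2)) (at h)"
    by (simp only: mult.assoc a_def b_def add_0_left mult_1_left mult.commute[of _ "2 + h"] mult.commute[of _ "h\<^sup>2"])
  then have "(mu18 (m + 2) has_real_derivative
      ((2 * N + 3) * (b + (2 + h) * ((N + 1) / (2 * (1 + h)) * (b + h * a))) -
       (N + 1) * (2 * h * a + h\<^sup>2 * ((N * a + ((2 * N + 1) * (2 + h) * a - (N + 1) * b) / h) / (2 * (1 + h))))) / (N + 2)) (at h)"
  proof (rule has_field_derivative_transform_within_open[where S = "{0<..}"])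
    fix x :: real assume "x \<in> {0<..}"
    then show "((2 * N + 3) * (2 + x) * mu18 (m + 1) x - (N + 1) * x\<^sup>2 * mu18 m x) / (N + 2) = mu18 (m + 2) x"
      using mu18_rec[of x m] N by (simp add: N_def field_simps)
  qed (use h in auto)
  moreover have "((2 * N + 3) * (b + (2 + h) * ((N + 1) / (2 * (1 + h)) * (b + h * a))) -
       (N + 1) * (2 * h * a + h\<^sup>2 * ((N * a + ((2 * N + 1) * (2 + h) * a - (N + 1) * b) / h) / (2 * (1 + h))))) / (N + 2) =
      (N + 2) / (2 * (1 + h)) * (((2 * N + 3) * (2 + h) * b - (N + 1) * h\<^sup>2 * a) / (N + 2) + h * b)"
    using h N by (simp add: divide_simps) Groebner_Basis.algebra
  ultimately have "(mu18 (m + 2) has_real_derivative (N + 2) / (2 * (1 + h)) * (mu18 (m + 2) h + h * b)) (at h)"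
    by (simp only: rec)
  moreover have "(mu18 (m + 1) has_real_derivative
      ((N + 1) * b + ((2 * (N + 1) + 1) * (2 + h) * b - (N + 2) * mu18 (m + 2) h) / h) / (2 * (1 + h))) (at h)"
    using db unfolding A rec .
  ultimately show ?case by (simp add: N_def b_def add_ac)
qed

text \<open>Same scheme as \<open>mu18_deriv\<close>, started from the arctangent form of
  \<open>nu18 0\<close> and from \<open>nu18 1\<close> expressed through it.\<close>

lemma nu18_deriv:
  assumes h: "h > 0"
  shows "(nu18 m has_real_derivative (real m + 1) * 3 / (2 * (1 + h)) * (h * nu18 (m + 1) h - nu18 m h)) (at h) \<and>
    (nu18 (m + 1) has_real_derivative (real m + 2) * 3 / (2 * (1 + h)) * (h * nu18 (m + 2) h - nu18 (m + 1) h)) (at h)"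
proof (induction m)
  case 0
  define r where "r = sqrt (4 * h + 3)"
  define \<theta> where "\<theta> = 3 * arctan r - pi"
  define x where "x = nu18 0 h"
  have r2: "r\<^sup>2 = 4 * h + 3" using h by (simp add: r_def)
  have r: "r > 0" using h by (simp add: r_def)
  have "((\<lambda>h. sqrt (4 * h + 3)) has_real_derivative 2 / r) (at h)"
    using h by (auto intro!: derivative_eq_intros simp: r_def field_simps)
  note dr = this[folded r_def]
  have "((\<lambda>h. 3 * arctan (sqrt (4 * h + 3)) - pi) has_real_derivative 3 * (inverse (1 + r\<^sup>2) * (2 / r))) (at h)"
    using DERIV_diff[OF DERIV_cmult[OF DERIV_chain2[OF DERIV_arctan dr], of 3] DERIV_const[of pi]]
    by (simp add: r_def)
  from DERIV_divide[OF DERIV_cmult[OF this, of 2] DERIV_mult[OF DERIV_ident dr]]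
  have "((\<lambda>h. 2 * (3 * arctan (sqrt (4 * h + 3)) - pi) / (h * sqrt (4 * h + 3))) has_real_derivative
      (2 * (3 * (inverse (1 + r\<^sup>2) * (2 / r))) * (h * r) - 2 * \<theta> * (1 * r + 2 / r * h)) / (h * r * (h * r))) (at h)"
    using h r by (simp add: r_def \<theta>_def)
  moreover have "x = 2 * \<theta> / (h * r)" using nu18_0[OF h] by (simp add: x_def r_def \<theta>_def)
  then have th: "2 * \<theta> = x * h * r" using h r by simp
  have "(2 * (3 * (inverse (1 + r\<^sup>2) * (2 / r))) * (h * r) - 2 * \<theta> * (1 * r + 2 / r * h)) / (h * r * (h * r)) =
      3 / (2 * (1 + h)) * (h * ((2 - (3 * h + 2) * x) / (h\<^sup>2 * (4 * h + 3))) - x)"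
  proof -
    have "1 + r\<^sup>2 \<noteq> 0" by (simp add: add_pos_nonneg less_imp_neq[symmetric])
    then have "2 * (3 * (inverse (1 + r\<^sup>2) * (2 / r))) * (h * r) = 12 * h / (1 + r\<^sup>2)"
      using r by (simp add: divide_simps)
    moreover have "x * h * r * (1 * r + 2 / r * h) = x * h * (r\<^sup>2 + 2 * h)"
      using r by (simp add: field_simps power2_eq_square)
    moreover have "h * r * (h * r) = h\<^sup>2 * r\<^sup>2" by (simp add: power2_eq_square)
    ultimately have "(2 * (3 * (inverse (1 + r\<^sup>2) * (2 / r))) * (h * r) - 2 * \<theta> * (1 * r + 2 / r * h)) / (h * r * (h * r)) =
        (12 * h / (1 + r\<^sup>2) - x * h * (r\<^sup>2 + 2 * h)) / (h\<^sup>2 * r\<^sup>2)" by (simp only: th)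
    also have "\<dots> = 3 / (2 * (1 + h)) * (h * ((2 - (3 * h + 2) * x) / (h\<^sup>2 * (4 * h + 3))) - x)"
      unfolding r2 using h by (simp add: divide_simps) Groebner_Basis.algebra
    finally show ?thesis .
  qed
  moreover have n1: "nu18 1 h = (2 - (3 * h + 2) * x) / (h\<^sup>2 * (4 * h + 3))"
    using nu18_1_eq[OF h] by (simp add: x_def)
  ultimately have d0': "((\<lambda>h. 2 * (3 * arctan (sqrt (4 * h + 3)) - pi) / (h * sqrt (4 * h + 3))) has_real_derivative
      3 / (2 * (1 + h)) * (h * nu18 1 h - x)) (at h)" by simp
  have d0: "(nu18 0 has_real_derivative 3 / (2 * (1 + h)) * (h * nu18 1 h - x)) (at h)"
    by (rule has_field_derivative_transform_within_open[OF d0', where S = "{0<..}"])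
       (use h in \<open>auto simp: nu18_0\<close>)
  define y where "y = nu18 1 h"
  have n2: "nu18 2 h = (x - 3 * (3 * h + 2) * y) / (2 * (h\<^sup>2 * (4 * h + 3)))"
    using nu18_rec_eq[OF h, of 0] by (simp add: x_def y_def numeral_2_eq_2)
  have "((\<lambda>h. (2 - (3 * h + 2) * nu18 0 h) / (h\<^sup>2 * (4 * h + 3))) has_real_derivative
      ((- (3 * x + (3 / (2 * (1 + h)) * (h * y - x)) * (3 * h + 2))) * (h\<^sup>2 * (4 * h + 3)) -
       (2 - (3 * h + 2) * x) * (12 * h\<^sup>2 + 6 * h)) / (h\<^sup>2 * (4 * h + 3) * (h\<^sup>2 * (4 * h + 3)))) (at h)"
    unfolding x_def y_def
  proof (rule DERIV_divide)
    show "((\<lambda>h. 2 - (3 * h + 2) * nu18 0 h) has_real_derivative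
        - (3 * nu18 0 h + (3 / (2 * (1 + h)) * (h * nu18 1 h - nu18 0 h)) * (3 * h + 2))) (at h)"
      by (rule derivative_eq_intros d0[unfolded x_def] refl | simp)+
    show "((\<lambda>h. h\<^sup>2 * (4 * h + 3)) has_real_derivative 12 * h\<^sup>2 + 6 * h) (at h)"
      by (auto intro!: derivative_eq_intros simp: power2_eq_square algebra_simps)
  qed (use h in auto)
  then have "(nu18 1 has_real_derivative
      ((- (3 * x + (3 / (2 * (1 + h)) * (h * y - x)) * (3 * h + 2))) * (h\<^sup>2 * (4 * h + 3)) -
       (2 - (3 * h + 2) * x) * (12 * h\<^sup>2 + 6 * h)) / (h\<^sup>2 * (4 * h + 3) * (h\<^sup>2 * (4 * h + 3)))) (at h)"
  proof (rule has_field_derivative_transform_within_open[where S = "{0<..}"])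
    fix z :: real assume "z \<in> {0<..}"
    then show "(2 - (3 * z + 2) * nu18 0 z) / (z\<^sup>2 * (4 * z + 3)) = nu18 1 z"
      using nu18_1_eq[of z] by simp
  qed (use h in auto)
  moreover have "((- (3 * x + (3 / (2 * (1 + h)) * (h * y - x)) * (3 * h + 2))) * (h\<^sup>2 * (4 * h + 3)) -
       (2 - (3 * h + 2) * x) * (12 * h\<^sup>2 + 6 * h)) / (h\<^sup>2 * (4 * h + 3) * (h\<^sup>2 * (4 * h + 3))) =
      2 * 3 / (2 * (1 + h)) * (h * ((x - 3 * (3 * h + 2) * y) / (2 * (h\<^sup>2 * (4 * h + 3)))) - y)"
    unfolding n1[folded y_def] using h by (simp add: divide_simps) Groebner_Basis.algebra
  ultimately have "(nu18 1 has_real_derivative 2 * 3 / (2 * (1 + h)) * (h * nu18 2 h - nu18 1 h)) (at h)"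
    by (simp only: n2 y_def)
  then show ?case using d0 by (simp add: x_def numeral_2_eq_2)
next
  case (Suc m)
  define N where "N = real m"
  define a where "a = nu18 m h"
  define b where "b = nu18 (m + 1) h"
  define D where "D = h\<^sup>2 * (4 * h + 3)"
  have N: "N \<ge> 0" by (simp add: N_def)
  have D: "D > 0" using h by (simp add: D_def)
  have rec: "nu18 (m + 2) h = ((N + 1) * a - (2 * N + 3) * (3 * h + 2) * b) / ((N + 2) * D)"
    using nu18_rec_eq[OF h, of m] by (simp add: N_def a_def b_def D_def)
  have rec': "nu18 (m + 3) h = ((N + 2) * b - (2 * N + 5) * (3 * h + 2) * nu18 (m + 2) h) / ((N + 3) * D)"
  proof -
    have "real (m + 1) + 1 = N + 2" "2 * real (m + 1) + 3 = 2 * N + 5" "real (m + 1) + 2 = N + 3"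
      "m + 1 + 2 = m + 3" "m + 1 + 1 = m + 2"
      by (simp_all add: N_def)
    then show ?thesis using nu18_rec_eq[OF h, of "m + 1"] by (simp only: b_def D_def)
  qed
  have da: "(nu18 m has_real_derivative (N + 1) * 3 / (2 * (1 + h)) * (h * b - a)) (at h)"
    and db: "(nu18 (m + 1) has_real_derivative (N + 2) * 3 / (2 * (1 + h)) * (h * nu18 (m + 2) h - b)) (at h)"
    using Suc by (simp_all add: N_def a_def b_def)
  define c where "c = nu18 (m + 2) h"
  have "((\<lambda>h. ((N + 1) * nu18 m h - (2 * N + 3) * (3 * h + 2) * nu18 (m + 1) h) / ((N + 2) * (h\<^sup>2 * (4 * h + 3)))) has_real_derivative
      (((N + 1) * ((N + 1) * 3 / (2 * (1 + h)) * (h * b - a)) - (2 * N + 3) * (3 * b + ((N + 2) * 3 / (2 * (1 + h)) * (h * c - b)) * (3 * h + 2))) * ((N + 2) * D) -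
       ((N + 1) * a - (2 * N + 3) * (3 * h + 2) * b) * ((N + 2) * (12 * h\<^sup>2 + 6 * h))) / ((N + 2) * D * ((N + 2) * D))) (at h)"
    unfolding D_def a_def b_def
  proof (rule DERIV_divide)
    show "((\<lambda>h. (N + 1) * nu18 m h - (2 * N + 3) * (3 * h + 2) * nu18 (m + 1) h) has_real_derivative
        (N + 1) * ((N + 1) * 3 / (2 * (1 + h)) * (h * nu18 (m + 1) h - nu18 m h)) -
        (2 * N + 3) * (3 * nu18 (m + 1) h + ((N + 2) * 3 / (2 * (1 + h)) * (h * c - nu18 (m + 1) h)) * (3 * h + 2))) (at h)"
    proof -
      have "((\<lambda>h. 3 * h + 2) has_real_derivative 3) (at h)" by (auto intro!: derivative_eq_intros)
      then have "((\<lambda>h. (N + 1) * nu18 m h - (2 * N + 3) * ((3 * h + 2) * nu18 (m + 1) h)) has_real_derivative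
          (N + 1) * ((N + 1) * 3 / (2 * (1 + h)) * (h * b - a)) -
          (2 * N + 3) * (3 * nu18 (m + 1) h + ((N + 2) * 3 / (2 * (1 + h)) * (h * nu18 (m + 2) h - b)) * (3 * h + 2))) (at h)"
        by (intro DERIV_diff DERIV_cmult DERIV_mult da db)
      then show ?thesis by (simp only: mult.assoc a_def b_def c_def)
    qed
    show "((\<lambda>h. (N + 2) * (h\<^sup>2 * (4 * h + 3))) has_real_derivative (N + 2) * (12 * h\<^sup>2 + 6 * h)) (at h)"
      by (intro DERIV_cmult) (auto intro!: derivative_eq_intros simp: power2_eq_square algebra_simps)
  qed (use h N in auto)
  then have "(nu18 (m + 2) has_real_derivative
      (((N + 1) * ((N + 1) * 3 / (2 * (1 + h)) * (h * b - a)) - (2 * N + 3) * (3 * b + ((N + 2) * 3 / (2 * (1 + h)) * (h * c - b)) * (3 * h + 2))) * ((N + 2) * D) -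
       ((N + 1) * a - (2 * N + 3) * (3 * h + 2) * b) * ((N + 2) * (12 * h\<^sup>2 + 6 * h))) / ((N + 2) * D * ((N + 2) * D))) (at h)"
  proof (rule has_field_derivative_transform_within_open[where S = "{0<..}"])
    fix z :: real assume "z \<in> {0<..}"
    then show "((N + 1) * nu18 m z - (2 * N + 3) * (3 * z + 2) * nu18 (m + 1) z) / ((N + 2) * (z\<^sup>2 * (4 * z + 3))) = nu18 (m + 2) z"
      using nu18_rec_eq[of z m] by (simp add: N_def)
  qed (use h in auto)
  moreover have "(((N + 1) * ((N + 1) * 3 / (2 * (1 + h)) * (h * b - a)) - (2 * N + 3) * (3 * b + ((N + 2) * 3 / (2 * (1 + h)) * (h * c - b)) * (3 * h + 2))) * ((N + 2) * D) -
       ((N + 1) * a - (2 * N + 3) * (3 * h + 2) * b) * ((N + 2) * (12 * h\<^sup>2 + 6 * h))) / ((N + 2) * D * ((N + 2) * D)) =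
      (N + 3) * 3 / (2 * (1 + h)) * (h * (((N + 2) * b - (2 * N + 5) * (3 * h + 2) * c) / ((N + 3) * D)) - c)"
    unfolding rec[folded c_def] using h N D unfolding D_def by (simp add: divide_simps) Groebner_Basis.algebra
  ultimately have "(nu18 (m + 2) has_real_derivative (N + 3) * 3 / (2 * (1 + h)) * (h * nu18 (m + 3) h - nu18 (m + 2) h)) (at h)"
    by (simp only: rec' c_def)
  then show ?case using db by (simp add: N_def b_def eval_nat_numeral add_ac)
qed

section \<open>Estimates for the two families\<close>

text \<open>With \<open>e = 1 + h * t\<close> and \<open>s = sqrt (1 + h)\<close>, the gap
  \<open>(s - 1) ^ 2 - y18 h t\<close> equals \<open>(e - s) ^ 2 / e\<close>, so the maximum is at
  \<open>e = s\<close>. The bound \<open>h ^ 2\<close> serves the limit of small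
  \<open>h\<close>.\<close>

lemma y18_bounds:
  assumes h: "h > 0" and t: "t \<in> {0..1}"
  shows "0 \<le> y18 h t" "y18 h t \<le> (sqrt (1 + h) - 1)\<^sup>2" "y18 h t \<le> h\<^sup>2"
proof -
  define e where "e = 1 + h * t"
  have e: "e \<ge> 1" using h t by (simp add: e_def)
  have y: "y18 h t = h\<^sup>2 * (t * (1 - t)) / e" using y18_eq[of h t] h t by (simp add: e_def)
  show "0 \<le> y18 h t" using e t unfolding y by simp
  have "t * (1 - t) \<le> 1 * 1" using t by (intro mult_mono) auto
  then have "h\<^sup>2 * (t * (1 - t)) \<le> h\<^sup>2 * 1" by (intro mult_left_mono) auto
  also have "\<dots> \<le> h\<^sup>2 * e" using e by (intro mult_left_mono) auto
  finally show "y18 h t \<le> h\<^sup>2" using e unfolding y by (simp add: divide_simps)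
  define s where "s = sqrt (1 + h)"
  have s2: "s\<^sup>2 = 1 + h" using h by (simp add: s_def)
  have "(s - 1)\<^sup>2 - y18 h t = (e - s)\<^sup>2 / e"
    unfolding y18_def e_def[symmetric] using e s2
    by (simp add: divide_simps) Groebner_Basis.algebra
  moreover have "(e - s)\<^sup>2 / e \<ge> 0" using e by simp
  ultimately show "y18 h t \<le> (sqrt (1 + h) - 1)\<^sup>2" unfolding s_def by simp
qed

lemma mu18_nonneg: "h > 0 \<Longrightarrow> mu18 n h \<ge> 0"
  unfolding mu18_def using y18_bounds(1)[of h] one_plus_pos[of h]
  by (intro integral_nonneg mu18_integrable) (auto intro!: mult_nonneg_nonneg divide_nonneg_nonneg simp: less_imp_le)

lemma mu18_le:
  assumes h: "h > 0" and M: "\<And>t. t \<in> {0..1} \<Longrightarrow> y18 h t \<le> M"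
  shows "mu18 n h \<le> M ^ n * ln (1 + h)"
proof -
  have "mu18 n h \<le> integral {0..1} (\<lambda>t. M ^ n * (y18 h t ^ 0 * (h / (1 + h * t))))"
    unfolding mu18_def
  proof (rule integral_le[OF mu18_integrable[OF h]])
    show "(\<lambda>t. M ^ n * (y18 h t ^ 0 * (h / (1 + h * t)))) integrable_on {0..1}"
      using integrable_on_cmult_left[OF mu18_integrable[OF h, of 0], of "M ^ n"] by simp
    fix t :: real assume t: "t \<in> {0..1}"
    have "y18 h t ^ n \<le> M ^ n" using M[OF t] y18_bounds(1)[OF h t] by (intro power_mono) auto
    then have "y18 h t ^ n * (h / (1 + h * t)) \<le> M ^ n * (h / (1 + h * t))"
      using h t by (intro mult_right_mono) auto
    then show "y18 h t ^ n * (h / (1 + h * t)) \<le> M ^ n * (y18 h t ^ 0 * (h / (1 + h * t)))"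
      by simp
  qed
  also have "\<dots> = M ^ n * mu18 0 h" unfolding mu18_def by (rule integral_mult_right)
  finally show ?thesis by (simp add: mu18_0[OF h])
qed

lemma nu18_nonneg: "h > 0 \<Longrightarrow> nu18 n h \<ge> 0"
  unfolding nu18_def
proof (intro integral_nonneg nu18_integrable)
  fix t :: real assume "h > 0" "t \<in> {0..1}"
  then show "0 \<le> (t * (1 - t)) ^ n / K18 h t ^ Suc n"
    using K18_ge_1[of h t] by (intro divide_nonneg_nonneg zero_le_power mult_nonneg_nonneg) auto
qed auto

lemma nu18_le:
  assumes h: "h > 0" and N: "N > 0" and K: "\<And>t. t \<in> {0..1} \<Longrightarrow> N * (t * (1 - t)) \<le> K18 h t"
  shows "nu18 n h \<le> nu18 0 h / N ^ n"
proof -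
  have "nu18 n h \<le> integral {0..1} (\<lambda>t. (1 / N ^ n) * ((t * (1 - t)) ^ 0 / K18 h t ^ Suc 0))"
    unfolding nu18_def
  proof (rule integral_le[OF nu18_integrable[OF h]])
    show "(\<lambda>t. (1 / N ^ n) * ((t * (1 - t)) ^ 0 / K18 h t ^ Suc 0)) integrable_on {0..1}"
      using integrable_on_cmult_left[OF nu18_integrable[OF h, of 0], of "1 / N ^ n"] by simp
    fix t :: real assume t: "t \<in> {0..1}"
    define u where "u = t * (1 - t)"
    have k: "K18 h t > 0" using K18_ge_1[OF h t] by simp
    have u: "u \<ge> 0" using t by (simp add: u_def)
    have "(N * u) ^ n \<le> K18 h t ^ n" using K[OF t] N u by (intro power_mono) (auto simp: u_def)
    then have "u ^ n / K18 h t ^ n \<le> 1 / N ^ n"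
      using k N by (simp add: divide_simps power_mult_distrib mult.commute)
    then have "u ^ n / K18 h t ^ n * (1 / K18 h t) \<le> 1 / N ^ n * (1 / K18 h t)"
      using k by (intro mult_right_mono) auto
    then show "(t * (1 - t)) ^ n / K18 h t ^ Suc n \<le> (1 / N ^ n) * ((t * (1 - t)) ^ 0 / K18 h t ^ Suc 0)"
      by (simp add: u_def mult.commute)
  qed
  also have "\<dots> = 1 / N ^ n * nu18 0 h" unfolding nu18_def by (rule integral_mult_right)
  finally show ?thesis by simp
qed

text \<open>Arithmetic-geometric mean for the outer terms of \<open>K18_eq\<close>: the constant is
  the middle coefficient \<open>3 * h + 2\<close> plus twice the root of the product of the outer
  ones, that is \<open>2 * s ^ 3\<close>.\<close>

lemma K18_ge:
  assumes h: "h > 0" and s: "s = sqrt (1 + h)"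
  shows "(2 * s ^ 3 + 3 * s\<^sup>2 - 1) * (t * (1 - t)) \<le> K18 h t"
proof -
  have s2: "s\<^sup>2 = 1 + h" using h s by simp
  have "K18 h t - (2 * s ^ 3 + 3 * s\<^sup>2 - 1) * (t * (1 - t)) = (s * t - s\<^sup>2 * (1 - t))\<^sup>2"
    using s2 unfolding K18_def by Groebner_Basis.algebra
  also have "\<dots> \<ge> 0" by simp
  finally show ?thesis by simp
qed

lemma nu18_0_bounds:
  assumes h: "h > 0"
  shows "nu18 0 h \<le> 1" "1 / ((1 + h)\<^sup>2 + h\<^sup>2) \<le> nu18 0 h"
proof -
  have int: "(\<lambda>t. (t * (1 - t)) ^ 0 / K18 h t ^ Suc 0) integrable_on {0..1}"
    by (rule nu18_integrable[OF h])
  have K: "1 \<le> K18 h t" "K18 h t \<le> (1 + h)\<^sup>2 + h\<^sup>2" if t: "t \<in> {0..1}" for t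
  proof -
    show "1 \<le> K18 h t" by (rule K18_ge_1[OF h t])
    have "(h * t)\<^sup>2 \<le> h\<^sup>2" using h t by (intro power_mono) (auto intro: mult_left_le)
    moreover have "(2 * h + 1) * (h * t) \<ge> 0" using h t by simp
    ultimately show "K18 h t \<le> (1 + h)\<^sup>2 + h\<^sup>2" by (simp add: K18_def)
  qed
  have "nu18 0 h \<le> integral {0..1} (\<lambda>t::real. 1)"
    unfolding nu18_def using K(1) by (intro integral_le int) (auto simp: divide_simps)
  then show "nu18 0 h \<le> 1" by simp
  have "integral {0..1} (\<lambda>t::real. 1 / ((1 + h)\<^sup>2 + h\<^sup>2)) \<le> nu18 0 h"
    unfolding nu18_def using K h
    by (intro integral_le int) (auto intro!: divide_left_mono mult_pos_pos simp: add_pos_pos dest: less_le_trans[OF zero_less_one])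
  then show "1 / ((1 + h)\<^sup>2 + h\<^sup>2) \<le> nu18 0 h" by simp
qed

text \<open>For \<open>h >= 1\<close> the closed form and \<open>arctan r < pi / 2\<close> suffice.
  The closed form has a removable singularity at \<open>h = 0\<close>, so for \<open>h < 1\<close>
  the bound \<open>nu18 0 h <= 1\<close> is used, together with
  \<open>s ^ 3 <= 4 <= 2 * pi\<close>.\<close>

lemma nu18_0_decay:
  assumes h: "h > 0" and s: "s = sqrt (1 + h)"
  shows "nu18 0 h \<le> 2 * pi / s ^ 3"
proof -
  have s2: "s\<^sup>2 = 1 + h" and s1: "s > 1" using h s by auto
  have s3: "s ^ 3 = s * (1 + h)" by (simp add: s2[symmetric] power3_eq_cube power2_eq_square)
  show ?thesis
  proof (cases "h \<ge> 1")
    case True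
    define r where "r = sqrt (4 * h + 3)"
    have r: "s \<le> r" "r > 0" using h s by (auto simp: r_def)
    have "nu18 0 h = 2 * (3 * arctan r - pi) / (h * r)" using nu18_0[OF h] by (simp add: r_def)
    also have "\<dots> \<le> pi / (h * r)"
      using arctan_ubound[of r] h r by (intro divide_right_mono) auto
    also have "\<dots> \<le> pi / ((1 + h) / 2 * s)"
      using True r s1 h by (intro divide_left_mono mult_mono mult_pos_pos) auto
    also have "\<dots> = 2 * pi / s ^ 3" by (simp add: s3 mult.commute)
    finally show ?thesis .
  next
    case False
    have "s < 2" using False s by (simp add: real_sqrt_less_iff[of _ 4, simplified])
    then have "s ^ 3 \<le> 2 * 2" unfolding s3 using False s1 h by (intro mult_mono) auto
    also have "\<dots> \<le> 2 * pi" using pi_gt3 by simp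
    finally have "1 \<le> 2 * pi / s ^ 3" using s1 by (simp add: divide_simps)
    then show ?thesis using nu18_0_bounds(1)[OF h] by linarith
  qed
qed

text \<open>Since \<open>N = (s + 1) ^ 2 * (2 * s - 1)\<close>, the supremum of
  \<open>(s - 1) ^ 2 / N\<close> is \<open>1 / (9 + 6 * sqrt 3)\<close>, about 0.052, attained at
  \<open>s = 2 + sqrt 3\<close>; times 27 it is the modulus of the small characteristic root. Any
  constant below \<open>1 / 9\<close> would serve, since \<open>27 / 9 = 3\<close> is the
  \<open>c\<close> of V18.\<close>

lemma mu18_nu18_le:
  assumes h: "h > 0"
  shows "mu18 n h * nu18 n h \<le> (1 / 10) ^ n * (mu18 0 h * nu18 0 h)"
proof -
  define s where "s = sqrt (1 + h)"
  define N where "N = 2 * s ^ 3 + 3 * s\<^sup>2 - 1"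
  have s1: "s > 1" using h by (simp add: s_def)
  have "N - 10 * (s - 1)\<^sup>2 = (s - 1) * (2 * s\<^sup>2 - 5 * s + 15) + 4"
    unfolding N_def by Groebner_Basis.algebra
  moreover have "2 * s\<^sup>2 - 5 * s + 15 = 2 * (s - 5 / 4)\<^sup>2 + 95 / 8"
    by (simp add: power2_eq_square algebra_simps)
  then have "2 * s\<^sup>2 - 5 * s + 15 \<ge> 0" by simp
  then have "(s - 1) * (2 * s\<^sup>2 - 5 * s + 15) \<ge> 0" using s1 by simp
  ultimately have N: "10 * (s - 1)\<^sup>2 \<le> N" "N > 0"
    using zero_le_power2[of "s - 1"] by linarith+
  have "mu18 n h * nu18 n h \<le> (((s - 1)\<^sup>2) ^ n * mu18 0 h) * (nu18 0 h / N ^ n)"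
    using mu18_le[OF h y18_bounds(2)[OF h], of n] nu18_le[OF h N(2), of n] K18_ge[OF h s_def]
      mu18_nonneg[OF h, of n] nu18_nonneg[OF h, of n] h
    by (intro mult_mono) (auto simp: N_def s_def mu18_0)
  also have "\<dots> = ((s - 1)\<^sup>2 / N) ^ n * (mu18 0 h * nu18 0 h)"
    by (simp add: power_divide)
  also have "\<dots> \<le> (1 / 10) ^ n * (mu18 0 h * nu18 0 h)"
    using N mu18_nonneg[OF h, of 0] nu18_nonneg[OF h, of 0]
    by (intro mult_right_mono power_mono) (auto simp: divide_simps)
  finally show ?thesis .
qed

text \<open>The coefficients come from an ansatz with unknown Laurent polynomials in \<open>h\<close>: they are chosen
  so that the derivative is the recurrence applied to \<open>mu18 n h * nu18 n h\<close>.\<close>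

definition C18 :: "nat \<Rightarrow> real \<Rightarrow> real" where
  "C18 m h = (let n = real m + 1 in
     - 4 * n\<^sup>2 * h * (3 + 4 * h) * (mu18 (m + 1) h * nu18 (m + 1) h) +
     (n * (2 * n - 1) / h - 6 * n\<^sup>2) * (mu18 (m + 1) h * nu18 m h) +
     (- 3 * n * (2 * n - 1) * h + 2 * n * (5 * n - 1) * h\<^sup>2 + 8 * n * (3 * n - 1) * h ^ 3) * (mu18 m h * nu18 (m + 1) h) +
     (- 2 * (2 * n - 1)\<^sup>2 / h - 4 * (2 * n - 1) * (3 * n - 2) - 6 * (n - 1) * (2 * n - 1) * h) * (mu18 m h * nu18 m h))"

text \<open>The last product stands for \<open>(n - 1) ^ 3\<close> times the product of the
  integrals of index \<open>m - 1\<close>, written through indices \<open>m\<close> and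
  \<open>m + 1\<close> so that \<open>m = 0\<close> is covered, where \<open>n - 1 = 0\<close>
  removes it. For larger indices \<open>C18_deriv_Suc\<close> puts it back with the
  recurrences.\<close>

lemma C18_deriv:
  fixes m :: nat
  defines "n \<equiv> real m + 1"
  assumes h: "h > 0"
  shows "(C18 m has_real_derivative
    27 * n ^ 3 * (mu18 (m + 1) h * nu18 (m + 1) h) +
    3 * (2 * n - 1) * (3 * n\<^sup>2 - 3 * n + 1) * (mu18 m h * nu18 m h) -
    (n - 1) * (((2 * n - 1) * (2 + h) * mu18 m h - n * mu18 (m + 1) h) *
      ((2 * n - 1) * (3 * h + 2) * nu18 m h + n * (h\<^sup>2 * (4 * h + 3)) * nu18 (m + 1) h) / h\<^sup>2)) (at h)"
proof -
  define a where "a = mu18 m h"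
  define b where "b = mu18 (m + 1) h"
  define x where "x = nu18 m h"
  define y where "y = nu18 (m + 1) h"
  define a' where "a' = (real m * a + ((2 * real m + 1) * (2 + h) * a - (real m + 1) * b) / h) / (2 * (1 + h))"
  define b' where "b' = (real m + 1) / (2 * (1 + h)) * (b + h * a)"
  define x' where "x' = (real m + 1) * 3 / (2 * (1 + h)) * (h * y - x)"
  define y' where "y' = 3 / (2 * (1 + h)) * ((n * x - (2 * n + 1) * (3 * h + 2) * y) / (h * (4 * h + 3)) - (n + 1) * y)"
  have n: "n > 0" and m: "real m = n - 1" by (simp_all add: n_def)
  have da: "(mu18 m has_real_derivative a') (at h)" and db: "(mu18 (m + 1) has_real_derivative b') (at h)"
    using mu18_deriv[OF h, of m] by (simp_all only: a'_def b'_def a_def b_def)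
  have "(real m + 2) * 3 / (2 * (1 + h)) * (h * nu18 (m + 2) h - nu18 (m + 1) h) = y'"
  proof -
    have "nu18 (m + 2) h = (n * x - (2 * n + 1) * (3 * h + 2) * y) / ((n + 1) * (h\<^sup>2 * (4 * h + 3)))"
      using nu18_rec[OF h, of m] h n by (simp add: n_def x_def y_def nonzero_eq_divide_eq mult_ac add_ac)
    then show ?thesis
      unfolding y'_def y_def[symmetric] using h n
      by (simp add: n_def[symmetric] add.commute[of _ 2]) (simp add: n_def divide_simps power2_eq_square, simp add: algebra_simps)
  qed
  then have dx: "(nu18 m has_real_derivative x') (at h)" and dy: "(nu18 (m + 1) has_real_derivative y') (at h)"
    using nu18_deriv[OF h, of m] by (simp_all only: x'_def x_def y_def)
  define c11 where "c11 = (\<lambda>h::real. - 4 * n\<^sup>2 * h * (3 + 4 * h))"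
  define c10 where "c10 = (\<lambda>h::real. n * (2 * n - 1) / h - 6 * n\<^sup>2)"
  define c01 where "c01 = (\<lambda>h::real. - 3 * n * (2 * n - 1) * h + 2 * n * (5 * n - 1) * h\<^sup>2 + 8 * n * (3 * n - 1) * h ^ 3)"
  define c00 where "c00 = (\<lambda>h::real. - 2 * (2 * n - 1)\<^sup>2 / h - 4 * (2 * n - 1) * (3 * n - 2) - 6 * (n - 1) * (2 * n - 1) * h)"
  have d11: "(c11 has_real_derivative - 4 * n\<^sup>2 * (3 + 8 * h)) (at h)"
    unfolding c11_def by (auto intro!: derivative_eq_intros simp: algebra_simps)
  have d10: "(c10 has_real_derivative - (n * (2 * n - 1) / h\<^sup>2)) (at h)"
    unfolding c10_def using h by (auto intro!: derivative_eq_intros simp: power2_eq_square)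
  have d01: "(c01 has_real_derivative - 3 * n * (2 * n - 1) + 4 * n * (5 * n - 1) * h + 24 * n * (3 * n - 1) * h\<^sup>2) (at h)"
    unfolding c01_def by (auto intro!: derivative_eq_intros)
  have d00: "(c00 has_real_derivative 2 * (2 * n - 1)\<^sup>2 / h\<^sup>2 - 6 * (n - 1) * (2 * n - 1)) (at h)"
    unfolding c00_def using h by (auto intro!: derivative_eq_intros simp: power2_eq_square)
  have "C18 m = (\<lambda>h. c11 h * (mu18 (m + 1) h * nu18 (m + 1) h) + c10 h * (mu18 (m + 1) h * nu18 m h) +
      c01 h * (mu18 m h * nu18 (m + 1) h) + c00 h * (mu18 m h * nu18 m h))"
    by (rule ext) (simp only: C18_def Let_def c11_def c10_def c01_def c00_def n_def)
  moreover have "((\<lambda>h. c11 h * (mu18 (m + 1) h * nu18 (m + 1) h) + c10 h * (mu18 (m + 1) h * nu18 m h) +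
      c01 h * (mu18 m h * nu18 (m + 1) h) + c00 h * (mu18 m h * nu18 m h)) has_real_derivative
      ((- 4 * n\<^sup>2 * (3 + 8 * h)) * (mu18 (m + 1) h * nu18 (m + 1) h) + (b' * nu18 (m + 1) h + y' * mu18 (m + 1) h) * c11 h) +
      ((- (n * (2 * n - 1) / h\<^sup>2)) * (mu18 (m + 1) h * nu18 m h) + (b' * nu18 m h + x' * mu18 (m + 1) h) * c10 h) +
      ((- 3 * n * (2 * n - 1) + 4 * n * (5 * n - 1) * h + 24 * n * (3 * n - 1) * h\<^sup>2) * (mu18 m h * nu18 (m + 1) h) +
        (a' * nu18 (m + 1) h + y' * mu18 m h) * c01 h) +
      ((2 * (2 * n - 1)\<^sup>2 / h\<^sup>2 - 6 * (n - 1) * (2 * n - 1)) * (mu18 m h * nu18 m h) + (a' * nu18 m h + x' * mu18 m h) * c00 h)) (at h)"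
    by (intro DERIV_add DERIV_mult d11 d10 d01 d00 da db dx dy)
  moreover have "((- 4 * n\<^sup>2 * (3 + 8 * h)) * (b * y) + (b' * y + y' * b) * c11 h) +
      ((- (n * (2 * n - 1) / h\<^sup>2)) * (b * x) + (b' * x + x' * b) * c10 h) +
      ((- 3 * n * (2 * n - 1) + 4 * n * (5 * n - 1) * h + 24 * n * (3 * n - 1) * h\<^sup>2) * (a * y) +
        (a' * y + y' * a) * c01 h) +
      ((2 * (2 * n - 1)\<^sup>2 / h\<^sup>2 - 6 * (n - 1) * (2 * n - 1)) * (a * x) + (a' * x + x' * a) * c00 h) =
    27 * n ^ 3 * (b * y) + 3 * (2 * n - 1) * (3 * n\<^sup>2 - 3 * n + 1) * (a * x) -
    (n - 1) * (((2 * n - 1) * (2 + h) * a - n * b) * ((2 * n - 1) * (3 * h + 2) * x + n * (h\<^sup>2 * (4 * h + 3)) * y) / h\<^sup>2)"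
    unfolding a'_def b'_def x'_def y'_def c11_def c10_def c01_def c00_def m using h
    by (simp add: divide_simps) Groebner_Basis.algebra
  ultimately show ?thesis by (simp only: a_def b_def x_def y_def)
qed

lemma C18_deriv_Suc:
  fixes m :: nat
  defines "n \<equiv> real m + 2"
  assumes h: "h > 0"
  shows "(C18 (m + 1) has_real_derivative
    27 * n ^ 3 * (mu18 (m + 2) h * nu18 (m + 2) h) +
    3 * (2 * n - 1) * (3 * n\<^sup>2 - 3 * n + 1) * (mu18 (m + 1) h * nu18 (m + 1) h) -
    (n - 1) ^ 3 * (mu18 m h * nu18 m h)) (at h)"
proof -
  have 1: "(2 * n - 1) * (2 + h) * mu18 (m + 1) h - n * mu18 (m + 2) h = (n - 1) * h\<^sup>2 * mu18 m h"
    using mu18_rec[OF h, of m] by (simp add: n_def algebra_simps)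
  have 2: "(2 * n - 1) * (3 * h + 2) * nu18 (m + 1) h + n * (h\<^sup>2 * (4 * h + 3)) * nu18 (m + 2) h = (n - 1) * nu18 m h"
    using nu18_rec[OF h, of m] by (simp add: n_def algebra_simps)
  have n: "real (m + 1) + 1 = n" "m + 1 + 1 = m + 2" by (simp_all add: n_def)
  have "(n - 1) * ((n - 1) * h\<^sup>2 * mu18 m h * ((n - 1) * nu18 m h) / h\<^sup>2) = (n - 1) ^ 3 * (mu18 m h * nu18 m h)"
    using h by (simp add: power3_eq_cube)
  then show ?thesis using C18_deriv[OF h, of "m + 1"] unfolding n 1 2 by simp
qed

text \<open>Eliminating \<open>nu18 1\<close> leaves only \<open>nu18 0\<close>,
  \<open>ln (1 + h)\<close> and \<open>ln (1 + h) / h\<close>, whose behaviour at both ends is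
  known.\<close>

lemma C18_0_eq:
  assumes h: "h > 0"
  shows "C18 0 h = (2 - (3 * h + 2) * nu18 0 h) * (8 - 9 * (ln (1 + h) / h)) +
    nu18 0 h * (12 * h - 2 - (15 + 6 * h) * ln (1 + h))"
proof -
  have 1: "nu18 (Suc 0) h = (2 - (3 * h + 2) * nu18 0 h) / (h\<^sup>2 * (4 * h + 3))"
    using nu18_1_eq[OF h] by simp
  show ?thesis
    using h by (simp add: C18_def Let_def mu18_0 mu18_1[simplified] 1 divide_simps)
      Groebner_Basis.algebra
qed

section \<open>Integration over the half-line and boundary values\<close>

lemma FTC_halfline:
  fixes F f :: "real \<Rightarrow> real"
  assumes F: "\<And>x. x > a \<Longrightarrow> (F has_real_derivative f x) (at x)"
    and f: "\<And>x. x > a \<Longrightarrow> isCont f x"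
    and int: "set_integrable lborel {a<..} f"
    and A: "(F \<longlongrightarrow> A) (at_right a)" and B: "(F \<longlongrightarrow> B) at_top"
  shows "(LINT x:{a<..}|lborel. f x) = B - A"
proof -
  have "(LBINT x=ereal a..\<infinity>. f x) = B - A"
    by (rule interval_integral_FTC_integrable[where F = F])
       (use assms in \<open>auto simp: ereal_tendsto_simps has_real_derivative_iff_has_vector_derivative\<close>)
  then show ?thesis by (simp add: interval_lebesgue_integral_def)
qed

lemma isCont_mu18: "h > 0 \<Longrightarrow> isCont (mu18 n) h"
  using mu18_deriv[of h n] DERIV_isCont by blast

lemma isCont_nu18: "h > 0 \<Longrightarrow> isCont (nu18 n) h"
  using nu18_deriv[of h n] DERIV_isCont by blast

text \<open>Up to the factor \<open>2 * pi\<close>, a common majorant of all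
  \<open>mu18 n * nu18 n\<close>: it combines \<open>mu18 0 h = ln (1 + h)\<close> with the decay of
  \<open>nu18 0\<close>.\<close>

lemma log_over_sqrt_cube_integrable:
  "set_integrable lborel {0<..} (\<lambda>h::real. ln (1 + h) / sqrt (1 + h) ^ 3)"
proof -
  define F where "F = (\<lambda>h::real. - (2 * ln (1 + h) + 4) / sqrt (1 + h))"
  have "set_integrable lborel (einterval (ereal 0) \<infinity>) (\<lambda>h::real. ln (1 + h) / sqrt (1 + h) ^ 3)"
  proof (rule interval_integral_FTC_nonneg(1)[where F = F and A = "- 4" and B = 0])
    fix h :: real assume "ereal 0 < ereal h"
    then have h: "h > 0" by simp
    define s where "s = sqrt (1 + h)"
    have s: "s > 0" "1 + h = s\<^sup>2" using h by (simp_all add: s_def)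
    have "((\<lambda>h. sqrt (1 + h)) has_real_derivative 1 / (2 * s)) (at h)"
      using h by (auto intro!: derivative_eq_intros simp: s_def field_simps)
    moreover have "((\<lambda>h. - (2 * ln (1 + h) + 4)) has_real_derivative - (2 / s\<^sup>2)) (at h)"
      using h s(1) by (auto intro!: derivative_eq_intros simp: s(2))
    ultimately have "(F has_real_derivative
        (- (2 / s\<^sup>2) * s - - (2 * ln (1 + h) + 4) * (1 / (2 * s))) / (s * s)) (at h)"
      unfolding F_def s_def using h by (intro DERIV_divide) auto
    moreover have "(- (2 / s\<^sup>2) * s - - (2 * ln (1 + h) + 4) * (1 / (2 * s))) / (s * s) = ln (1 + h) / s ^ 3"
      using s(1) by (simp add: divide_simps power2_eq_square power3_eq_cube)
    ultimately show "DERIV F h :> ln (1 + h) / sqrt (1 + h) ^ 3" by (simp add: s_def)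
    show "isCont (\<lambda>h. ln (1 + h) / sqrt (1 + h) ^ 3) h"
      using h by (intro continuous_intros) auto
  next
    have "(F \<longlongrightarrow> F 0) (at_right 0)"
      unfolding F_def by (intro tendsto_intros) auto
    then show "((F \<circ> real_of_ereal) \<longlongrightarrow> - 4) (at_right (ereal 0))"
      unfolding ereal_tendsto_simps by (simp add: F_def)
    show "((F \<circ> real_of_ereal) \<longlongrightarrow> 0) (at_left \<infinity>)"
      unfolding ereal_tendsto_simps F_def by real_asymp
  qed auto
  then show ?thesis by simp
qed

lemma mu18_nu18_integrable: "set_integrable lborel {0<..} (\<lambda>h. mu18 n h * nu18 n h)"
proof (rule set_integrable_bound)
  show "set_integrable lborel {0<..} (\<lambda>h::real. 2 * pi * (ln (1 + h) / sqrt (1 + h) ^ 3))"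
    by (intro set_integrable_mult_right log_over_sqrt_cube_integrable)
  show "set_borel_measurable lborel {0<..} (\<lambda>h. mu18 n h * nu18 n h)"
    unfolding set_borel_measurable_def
    using borel_measurable_continuous_on_indicator[of "{0<..}" "\<lambda>h. mu18 n h * nu18 n h"] isCont_mu18 isCont_nu18
    by (auto intro!: continuous_at_imp_continuous_on continuous_mult)
  have "norm (mu18 n h * nu18 n h) \<le> norm (2 * pi * (ln (1 + h) / sqrt (1 + h) ^ 3))" if h: "h > 0" for h
  proof -
    have "mu18 n h * nu18 n h \<le> (1 / 10) ^ n * (mu18 0 h * nu18 0 h)" by (rule mu18_nu18_le[OF h])
    also have "\<dots> \<le> 1 * (mu18 0 h * nu18 0 h)"
      using mu18_nonneg[OF h] nu18_nonneg[OF h] by (intro mult_right_mono power_le_one) auto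
    also have "\<dots> \<le> ln (1 + h) * (2 * pi / sqrt (1 + h) ^ 3)"
      unfolding mu18_0[OF h] mult_1_left using nu18_0_decay[OF h refl] h by (intro mult_left_mono) auto
    finally show ?thesis using mu18_nonneg[OF h, of n] nu18_nonneg[OF h, of n] h by (simp add: mult_ac)
  qed
  then show "AE h in lborel. h \<in> {0<..} \<longrightarrow> norm (mu18 n h * nu18 n h) \<le> norm (2 * pi * (ln (1 + h) / sqrt (1 + h) ^ 3))"
    by auto
qed

text \<open>The coefficients have at worst a simple pole at 0, and \<open>mu18 a h\<close> is at
  most \<open>h ^ 3\<close> for \<open>a >= 1\<close> and \<open>h < 1\<close>. Only
  \<open>mu18 0\<close>, absent from \<open>C18 (m + 1)\<close>, could leave a boundary
  term.\<close>

lemma C18_tendsto_at_0: "(C18 (m + 1) \<longlongrightarrow> 0) (at_right 0)"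
proof -
  define n where "n = real (m + 1) + 1"
  have q: "((\<lambda>h. mu18 a h * nu18 b h / h) \<longlongrightarrow> 0) (at_right 0)" if a: "a \<ge> 1" for a b
  proof (rule Lim_null_comparison)
    show "((\<lambda>h::real. h\<^sup>2) \<longlongrightarrow> 0) (at_right 0)" by real_asymp
    have "\<forall>\<^sub>F h in at_right 0. h < (1::real)"
      using eventually_at_right_real[of 0 1] by (auto elim: eventually_mono)
    then show "\<forall>\<^sub>F h in at_right 0. norm (mu18 a h * nu18 b h / h) \<le> h\<^sup>2"
      using eventually_at_right_less[of "0::real"]
    proof eventually_elim
      case (elim h)
      have "mu18 a h \<le> (h\<^sup>2) ^ a * ln (1 + h)" by (rule mu18_le[OF elim(2) y18_bounds(3)[OF elim(2)]])
      also have "\<dots> \<le> (h\<^sup>2) ^ 1 * h"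
        using a elim ln_add_one_self_le_self[of h] by (intro mult_mono power_decreasing) (auto simp: power_le_one)
      finally have mu: "mu18 a h \<le> h\<^sup>2 * h" by simp
      have "nu18 b h \<le> nu18 0 h / 1 ^ b"
      proof (rule nu18_le[OF elim(2)])
        fix t :: real assume t: "t \<in> {0..1}"
        then have "t * (1 - t) \<le> 1 * 1" by (intro mult_mono) auto
        then show "1 * (t * (1 - t)) \<le> K18 h t" using K18_ge_1[OF elim(2) t] by simp
      qed simp
      then have "nu18 b h \<le> 1" using nu18_0_bounds(1)[OF elim(2)] by simp
      then have "mu18 a h * nu18 b h \<le> h\<^sup>2 * h * 1"
        using mu elim nu18_nonneg[OF elim(2)] by (intro mult_mono) auto
      then show ?case using elim mu18_nonneg[OF elim(2), of a] nu18_nonneg[OF elim(2), of b]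
        by (simp add: divide_simps)
    qed
  qed
  have id: "((\<lambda>h. h) \<longlongrightarrow> (0::real)) (at_right 0)" by real_asymp
  define q11 where "q11 = (\<lambda>h. mu18 (m + 2) h * nu18 (m + 2) h / h)"
  define q10 where "q10 = (\<lambda>h. mu18 (m + 2) h * nu18 (m + 1) h / h)"
  define q01 where "q01 = (\<lambda>h. mu18 (m + 1) h * nu18 (m + 2) h / h)"
  define q00 where "q00 = (\<lambda>h. mu18 (m + 1) h * nu18 (m + 1) h / h)"
  note qs = q[of "m + 2" "m + 2", folded q11_def] q[of "m + 2" "m + 1", folded q10_def]
    q[of "m + 1" "m + 2", folded q01_def] q[of "m + 1" "m + 1", folded q00_def]
  have "((\<lambda>h. - 4 * n\<^sup>2 * h * (3 + 4 * h) * (q11 h * h) + (n * (2 * n - 1) - 6 * n\<^sup>2 * h) * q10 h +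
      (- 3 * n * (2 * n - 1) * h + 2 * n * (5 * n - 1) * h\<^sup>2 + 8 * n * (3 * n - 1) * h ^ 3) * (q01 h * h) +
      (- 2 * (2 * n - 1)\<^sup>2 - 4 * (2 * n - 1) * (3 * n - 2) * h - 6 * (n - 1) * (2 * n - 1) * h\<^sup>2) * q00 h) \<longlongrightarrow>
      - 4 * n\<^sup>2 * 0 * (3 + 4 * 0) * (0 * 0) + (n * (2 * n - 1) - 6 * n\<^sup>2 * 0) * 0 +
      (- 3 * n * (2 * n - 1) * 0 + 2 * n * (5 * n - 1) * 0\<^sup>2 + 8 * n * (3 * n - 1) * 0 ^ 3) * (0 * 0) +
      (- 2 * (2 * n - 1)\<^sup>2 - 4 * (2 * n - 1) * (3 * n - 2) * 0 - 6 * (n - 1) * (2 * n - 1) * 0\<^sup>2) * 0) (at_right 0)"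
    by (intro tendsto_intros id qs) auto
  then have lim: "((\<lambda>h. - 4 * n\<^sup>2 * h * (3 + 4 * h) * (q11 h * h) + (n * (2 * n - 1) - 6 * n\<^sup>2 * h) * q10 h +
      (- 3 * n * (2 * n - 1) * h + 2 * n * (5 * n - 1) * h\<^sup>2 + 8 * n * (3 * n - 1) * h ^ 3) * (q01 h * h) +
      (- 2 * (2 * n - 1)\<^sup>2 - 4 * (2 * n - 1) * (3 * n - 2) * h - 6 * (n - 1) * (2 * n - 1) * h\<^sup>2) * q00 h) \<longlongrightarrow> 0) (at_right 0)"
    by simp
  have "\<forall>\<^sub>F h in at_right 0. - 4 * n\<^sup>2 * h * (3 + 4 * h) * (q11 h * h) + (n * (2 * n - 1) - 6 * n\<^sup>2 * h) * q10 h +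
      (- 3 * n * (2 * n - 1) * h + 2 * n * (5 * n - 1) * h\<^sup>2 + 8 * n * (3 * n - 1) * h ^ 3) * (q01 h * h) +
      (- 2 * (2 * n - 1)\<^sup>2 - 4 * (2 * n - 1) * (3 * n - 2) * h - 6 * (n - 1) * (2 * n - 1) * h\<^sup>2) * q00 h = C18 (m + 1) h"
    using eventually_at_right_less[of "0::real"]
  proof eventually_elim
    case (elim h)
    define p where "p = mu18 (m + 2) h"
    define p' where "p' = mu18 (m + 1) h"
    define v where "v = nu18 (m + 2) h"
    define v' where "v' = nu18 (m + 1) h"
    have "m + 1 + 1 = m + 2" by simp
    moreover define i where "i = 1 / h"
    ultimately have C: "C18 (m + 1) h = - 4 * n\<^sup>2 * h * (3 + 4 * h) * (p * v) + (n * (2 * n - 1) * i - 6 * n\<^sup>2) * (p * v') +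
      (- 3 * n * (2 * n - 1) * h + 2 * n * (5 * n - 1) * h\<^sup>2 + 8 * n * (3 * n - 1) * h ^ 3) * (p' * v) +
      (- 2 * (2 * n - 1)\<^sup>2 * i - 4 * (2 * n - 1) * (3 * n - 2) - 6 * (n - 1) * (2 * n - 1) * h) * (p' * v')"
      unfolding C18_def Let_def n_def p_def p'_def v_def v'_def i_def by (simp only: times_divide_eq_right mult_1_right)
    have i: "h * i = 1" using elim by (simp add: i_def)
    have div: "q / h = q * i" for q by (simp add: i_def)
    show ?case
      unfolding C q11_def q10_def q01_def q00_def p_def[symmetric] p'_def[symmetric] v_def[symmetric] v'_def[symmetric]
        i_def[symmetric] div
      using i by Groebner_Basis.algebra
  qed
  from tendsto_cong[OF this] show ?thesis using lim by simp
qed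

text \<open>In powers of \<open>s = sqrt (1 + h)\<close>, a term
  \<open>h ^ k * mu18 a h * nu18 b h\<close> is at most of order
  \<open>s ^ (2 * a + 2 * k - 3 * b - 3) * ln (1 + h)\<close>. The exponent condition holds for all
  four terms from \<open>m + 1 = 1\<close> on, with equality at worst; for \<open>C18 0\<close> it
  fails and a boundary term survives.\<close>

lemma C18_tendsto_at_top: "(C18 (m + 1) \<longlongrightarrow> 0) at_top"
proof -
  define n where "n = real (m + 1) + 1"
  have q: "((\<lambda>h. h ^ k * (mu18 a h * nu18 b h)) \<longlongrightarrow> 0) at_top" if le: "2 * a + 2 * k + 1 \<le> 3 * b + 3" for a b k
  proof (rule Lim_null_comparison)
    show "((\<lambda>h::real. 2 * pi * ln (1 + h) / sqrt (1 + h)) \<longlongrightarrow> 0) at_top" by real_asymp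
    show "\<forall>\<^sub>F h in at_top. norm (h ^ k * (mu18 a h * nu18 b h)) \<le> 2 * pi * ln (1 + h) / sqrt (1 + h)"
      using eventually_gt_at_top[of 0]
    proof eventually_elim
      case (elim h)
      define s where "s = sqrt (1 + h)"
      have s: "s > 1" "1 + h = s\<^sup>2" using elim by (simp_all add: s_def)
      have "mu18 a h \<le> ((s - 1)\<^sup>2) ^ a * ln (1 + h)"
        unfolding s_def by (rule mu18_le[OF elim y18_bounds(2)[OF elim]])
      also have "\<dots> \<le> (s\<^sup>2) ^ a * ln (1 + h)"
        using s elim by (intro mult_right_mono power_mono) auto
      finally have mu: "mu18 a h \<le> s ^ (2 * a) * ln (1 + h)" by (simp add: power_mult)
      have "nu18 b h \<le> nu18 0 h / (s ^ 3) ^ b"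
      proof (rule nu18_le[OF elim])
        fix t :: real assume t: "t \<in> {0..1}"
        have "s ^ 3 \<le> 2 * s ^ 3 + 3 * s\<^sup>2 - 1"
          using s one_le_power[of s 2] zero_le_power[of s 3] by linarith
        then have "s ^ 3 * (t * (1 - t)) \<le> (2 * s ^ 3 + 3 * s\<^sup>2 - 1) * (t * (1 - t))"
          using t by (intro mult_right_mono) auto
        then show "s ^ 3 * (t * (1 - t)) \<le> K18 h t" using K18_ge[OF elim s_def, of t] by linarith
      qed (use s in auto)
      also have "\<dots> \<le> 2 * pi / s ^ 3 / (s ^ 3) ^ b"
        using nu18_0_decay[OF elim s_def] s by (intro divide_right_mono) auto
      also have "\<dots> = 2 * pi / s ^ (3 * b + 3)" by (simp add: power_add power_mult)
      finally have nu: "nu18 b h \<le> 2 * pi / s ^ (3 * b + 3)" .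
      have "h ^ k \<le> (s\<^sup>2) ^ k" using elim s by (intro power_mono) auto
      then have "h ^ k * (mu18 a h * nu18 b h) \<le> s ^ (2 * k) * ((s ^ (2 * a) * ln (1 + h)) * (2 * pi / s ^ (3 * b + 3)))"
        using mu nu elim s mu18_nonneg[OF elim] nu18_nonneg[OF elim]
        by (intro mult_mono) (auto simp: power_mult)
      also have "\<dots> = (s ^ (2 * a + 2 * k) / s ^ (3 * b + 3)) * (2 * pi * ln (1 + h))"
        by (simp add: power_add)
      also have "\<dots> \<le> (1 / s) * (2 * pi * ln (1 + h))"
      proof (rule mult_right_mono)
        have "s ^ (2 * a + 2 * k) * s \<le> s ^ (3 * b + 3)"
          using power_increasing[OF le, of s] s by (simp add: mult.commute)
        then show "s ^ (2 * a + 2 * k) / s ^ (3 * b + 3) \<le> 1 / s" using s by (simp add: divide_simps)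
      qed (use elim in auto)
      finally show ?case using elim mu18_nonneg[OF elim, of a] nu18_nonneg[OF elim, of b]
        by (simp add: s_def)
    qed
  qed
  have id: "((\<lambda>h. 1 / h) \<longlongrightarrow> (0::real)) at_top" by real_asymp
  define q11 where "q11 = (\<lambda>h. h ^ 2 * (mu18 (m + 2) h * nu18 (m + 2) h))"
  define q10 where "q10 = (\<lambda>h. h ^ 0 * (mu18 (m + 2) h * nu18 (m + 1) h))"
  define q01 where "q01 = (\<lambda>h. h ^ 3 * (mu18 (m + 1) h * nu18 (m + 2) h))"
  define q00 where "q00 = (\<lambda>h. h ^ 1 * (mu18 (m + 1) h * nu18 (m + 1) h))"
  note qs = q[of "m + 2" 2 "m + 2", folded q11_def] q[of "m + 2" 0 "m + 1", folded q10_def]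
    q[of "m + 1" 3 "m + 2", folded q01_def] q[of "m + 1" 1 "m + 1", folded q00_def]
  have "((\<lambda>h. - 4 * n\<^sup>2 * (3 * (1 / h) + 4) * q11 h + (n * (2 * n - 1) * (1 / h) - 6 * n\<^sup>2) * q10 h +
      (- 3 * n * (2 * n - 1) * (1 / h)\<^sup>2 + 2 * n * (5 * n - 1) * (1 / h) + 8 * n * (3 * n - 1)) * q01 h +
      (- 2 * (2 * n - 1)\<^sup>2 * (1 / h)\<^sup>2 - 4 * (2 * n - 1) * (3 * n - 2) * (1 / h) - 6 * (n - 1) * (2 * n - 1)) * q00 h) \<longlongrightarrow>
      - 4 * n\<^sup>2 * (3 * 0 + 4) * 0 + (n * (2 * n - 1) * 0 - 6 * n\<^sup>2) * 0 +
      (- 3 * n * (2 * n - 1) * 0\<^sup>2 + 2 * n * (5 * n - 1) * 0 + 8 * n * (3 * n - 1)) * 0 +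
      (- 2 * (2 * n - 1)\<^sup>2 * 0\<^sup>2 - 4 * (2 * n - 1) * (3 * n - 2) * 0 - 6 * (n - 1) * (2 * n - 1)) * 0) at_top"
    by (intro tendsto_intros id qs) auto
  then have lim: "((\<lambda>h. - 4 * n\<^sup>2 * (3 * (1 / h) + 4) * q11 h + (n * (2 * n - 1) * (1 / h) - 6 * n\<^sup>2) * q10 h +
      (- 3 * n * (2 * n - 1) * (1 / h)\<^sup>2 + 2 * n * (5 * n - 1) * (1 / h) + 8 * n * (3 * n - 1)) * q01 h +
      (- 2 * (2 * n - 1)\<^sup>2 * (1 / h)\<^sup>2 - 4 * (2 * n - 1) * (3 * n - 2) * (1 / h) - 6 * (n - 1) * (2 * n - 1)) * q00 h) \<longlongrightarrow> 0) at_top"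
    by simp
  have "\<forall>\<^sub>F h in at_top. - 4 * n\<^sup>2 * (3 * (1 / h) + 4) * q11 h + (n * (2 * n - 1) * (1 / h) - 6 * n\<^sup>2) * q10 h +
      (- 3 * n * (2 * n - 1) * (1 / h)\<^sup>2 + 2 * n * (5 * n - 1) * (1 / h) + 8 * n * (3 * n - 1)) * q01 h +
      (- 2 * (2 * n - 1)\<^sup>2 * (1 / h)\<^sup>2 - 4 * (2 * n - 1) * (3 * n - 2) * (1 / h) - 6 * (n - 1) * (2 * n - 1)) * q00 h = C18 (m + 1) h"
    using eventually_gt_at_top[of 0]
  proof eventually_elim
    case (elim h)
    define p where "p = mu18 (m + 2) h"
    define p' where "p' = mu18 (m + 1) h"
    define v where "v = nu18 (m + 2) h"
    define v' where "v' = nu18 (m + 1) h"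
    have "m + 1 + 1 = m + 2" by simp
    moreover define i where "i = 1 / h"
    ultimately have C: "C18 (m + 1) h = - 4 * n\<^sup>2 * h * (3 + 4 * h) * (p * v) + (n * (2 * n - 1) * i - 6 * n\<^sup>2) * (p * v') +
      (- 3 * n * (2 * n - 1) * h + 2 * n * (5 * n - 1) * h\<^sup>2 + 8 * n * (3 * n - 1) * h ^ 3) * (p' * v) +
      (- 2 * (2 * n - 1)\<^sup>2 * i - 4 * (2 * n - 1) * (3 * n - 2) - 6 * (n - 1) * (2 * n - 1) * h) * (p' * v')"
      unfolding C18_def Let_def n_def p_def p'_def v_def v'_def i_def by (simp only: times_divide_eq_right mult_1_right)
    have i: "h * i = 1" using elim by (simp add: i_def)
    have div: "q / h = q * i" for q by (simp add: i_def)
    show ?case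
      unfolding C q11_def q10_def q01_def q00_def p_def[symmetric] p'_def[symmetric] v_def[symmetric] v'_def[symmetric]
        i_def[symmetric] div
      using i by Groebner_Basis.algebra
  qed
  from tendsto_cong[OF this] show ?thesis using lim by simp
qed

text \<open>The limit comes from the summand \<open>- 2 / h * (mu18 0 h * nu18 0 h)\<close>, as
  \<open>ln (1 + h) / h\<close> and \<open>nu18 0 h\<close> both tend to 1.\<close>

lemma C18_0_tendsto_at_0: "(C18 0 \<longlongrightarrow> - 2) (at_right 0)"
proof -
  have "(nu18 0 \<longlongrightarrow> 1) (at_right 0)"
  proof (rule tendsto_sandwich)
    show "\<forall>\<^sub>F h in at_right 0. 1 / ((1 + h)\<^sup>2 + h\<^sup>2) \<le> nu18 0 h"
      "\<forall>\<^sub>F h in at_right 0. nu18 0 h \<le> 1"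
      using eventually_at_right_less[of "0::real"] nu18_0_bounds by (auto elim!: eventually_mono)
    show "((\<lambda>h::real. 1 / ((1 + h)\<^sup>2 + h\<^sup>2)) \<longlongrightarrow> 1) (at_right 0)" by real_asymp
  qed auto
  moreover have "((\<lambda>h::real. ln (1 + h) / h) \<longlongrightarrow> 1) (at_right 0)"
    "((\<lambda>h::real. ln (1 + h)) \<longlongrightarrow> 0) (at_right 0)" "((\<lambda>h::real. h) \<longlongrightarrow> 0) (at_right 0)"
    by real_asymp+
  ultimately have "((\<lambda>h. (2 - (3 * h + 2) * nu18 0 h) * (8 - 9 * (ln (1 + h) / h)) +
    nu18 0 h * (12 * h - 2 - (15 + 6 * h) * ln (1 + h))) \<longlongrightarrow> (2 - (3 * 0 + 2) * 1) * (8 - 9 * 1) +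
    1 * (12 * 0 - 2 - (15 + 6 * 0) * 0)) (at_right 0)"
    by (intro tendsto_intros)
  moreover have "\<forall>\<^sub>F h in at_right 0. (2 - (3 * h + 2) * nu18 0 h) * (8 - 9 * (ln (1 + h) / h)) +
    nu18 0 h * (12 * h - 2 - (15 + 6 * h) * ln (1 + h)) = C18 0 h"
    using eventually_at_right_less[of "0::real"] by eventually_elim (simp add: C18_0_eq)
  ultimately show ?thesis using tendsto_cong by fastforce
qed

text \<open>Since \<open>nu18 0\<close> decays like \<open>s ^ (- 3)\<close>, every term containing
  it disappears and only \<open>2 * 8\<close> is left.\<close>

lemma C18_0_tendsto_at_top: "(C18 0 \<longlongrightarrow> 16) at_top"
proof -
  have q: "((\<lambda>h. nu18 0 h * f h) \<longlongrightarrow> 0) at_top"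
    if "((\<lambda>h. 2 * pi / sqrt (1 + h) ^ 3 * \<bar>f h\<bar>) \<longlongrightarrow> 0) at_top" for f
  proof (rule Lim_null_comparison[OF _ that])
    show "\<forall>\<^sub>F h in at_top. norm (nu18 0 h * f h) \<le> 2 * pi / sqrt (1 + h) ^ 3 * \<bar>f h\<bar>"
      using eventually_gt_at_top[of 0]
    proof eventually_elim
      case (elim h)
      then show ?case using nu18_0_decay[OF elim refl] nu18_nonneg[OF elim, of 0]
        by (simp only: real_norm_def abs_mult abs_of_nonneg mult_right_mono abs_ge_zero)
    qed
  qed
  have "((\<lambda>h. nu18 0 h * (3 * h + 2)) \<longlongrightarrow> 0) at_top"
    "((\<lambda>h. nu18 0 h * (12 * h - 2 - (15 + 6 * h) * ln (1 + h))) \<longlongrightarrow> 0) at_top"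
    by (rule q, real_asymp)+
  moreover have "((\<lambda>h::real. ln (1 + h) / h) \<longlongrightarrow> 0) at_top" by real_asymp
  ultimately have "((\<lambda>h. (2 - nu18 0 h * (3 * h + 2)) * (8 - 9 * (ln (1 + h) / h)) +
    nu18 0 h * (12 * h - 2 - (15 + 6 * h) * ln (1 + h))) \<longlongrightarrow> (2 - 0) * (8 - 9 * 0) + 0) at_top"
    by (intro tendsto_intros)
  moreover have "\<forall>\<^sub>F h in at_top. (2 - nu18 0 h * (3 * h + 2)) * (8 - 9 * (ln (1 + h) / h)) +
    nu18 0 h * (12 * h - 2 - (15 + 6 * h) * ln (1 + h)) = C18 0 h"
    using eventually_gt_at_top[of 0] by eventually_elim (simp add: C18_0_eq mult.commute)
  ultimately show ?thesis using tendsto_cong by fastforce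
qed

definition I18 :: "nat \<Rightarrow> real" where
  "I18 n = (LINT h:{0<..}|lborel. mu18 n h * nu18 n h)"

lemma I18_bound: "\<bar>I18 n\<bar> \<le> (1 / 10) ^ n * I18 0"
proof -
  have "I18 n \<le> (LINT h:{0<..}|lborel. (1 / 10) ^ n * (mu18 0 h * nu18 0 h))"
    unfolding I18_def using mu18_nu18_le
    by (intro set_integral_mono mu18_nu18_integrable set_integrable_mult_right) auto
  also have "\<dots> = (1 / 10) ^ n * I18 0" unfolding I18_def by simp
  finally have "I18 n \<le> (1 / 10) ^ n * I18 0" .
  moreover have "I18 n \<ge> 0"
    unfolding I18_def set_lebesgue_integral_def using mu18_nonneg nu18_nonneg
    by (intro integral_nonneg_AE) (auto simp: indicator_def)
  ultimately show ?thesis by simp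
qed

lemma I18_rec:
  fixes m :: nat
  defines "n \<equiv> real m + 2"
  shows "27 * n ^ 3 * I18 (m + 2) + 3 * (2 * n - 1) * (3 * n\<^sup>2 - 3 * n + 1) * I18 (m + 1) - (n - 1) ^ 3 * I18 m = 0"
proof -
  have i: "set_integrable lborel {0<..} (\<lambda>h. c * (mu18 k h * nu18 k h))" for c k
    by (intro set_integrable_mult_right mu18_nu18_integrable)
  have "(LINT h:{0<..}|lborel. 27 * n ^ 3 * (mu18 (m + 2) h * nu18 (m + 2) h) +
    3 * (2 * n - 1) * (3 * n\<^sup>2 - 3 * n + 1) * (mu18 (m + 1) h * nu18 (m + 1) h) -
    (n - 1) ^ 3 * (mu18 m h * nu18 m h)) = 0 - 0"
  proof (rule FTC_halfline[OF _ _ _ C18_tendsto_at_0[of m] C18_tendsto_at_top[of m]])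
    show "set_integrable lborel {0<..} (\<lambda>h. 27 * n ^ 3 * (mu18 (m + 2) h * nu18 (m + 2) h) +
      3 * (2 * n - 1) * (3 * n\<^sup>2 - 3 * n + 1) * (mu18 (m + 1) h * nu18 (m + 1) h) -
      (n - 1) ^ 3 * (mu18 m h * nu18 m h))"
      by (intro set_integral_add set_integral_diff set_integrable_mult_right mu18_nu18_integrable)
  qed (use C18_deriv_Suc[of _ m] isCont_mu18 isCont_nu18 in \<open>auto simp: n_def intro!: continuous_intros\<close>)
  also have "(LINT h:{0<..}|lborel. 27 * n ^ 3 * (mu18 (m + 2) h * nu18 (m + 2) h) +
    3 * (2 * n - 1) * (3 * n\<^sup>2 - 3 * n + 1) * (mu18 (m + 1) h * nu18 (m + 1) h) -
    (n - 1) ^ 3 * (mu18 m h * nu18 m h)) =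
    27 * n ^ 3 * I18 (m + 2) + 3 * (2 * n - 1) * (3 * n\<^sup>2 - 3 * n + 1) * I18 (m + 1) - (n - 1) ^ 3 * I18 m"
    unfolding I18_def
    by (simp only: set_integral_diff(2)[OF set_integral_add(1)[OF i i] i] set_integral_add(2)[OF i i] set_integral_mult_right)
  finally show ?thesis by simp
qed

text \<open>The case \<open>n = 1\<close> of the recurrence, where the third term drops out. The
  boundary values contribute \<open>16 - (- 2) = 18\<close>, the defect that determines the factor
  \<open>1 / 3\<close> in the limit.\<close>

lemma I18_1: "27 * I18 1 + 3 * I18 0 = 18"
proof -
  have i: "set_integrable lborel {0<..} (\<lambda>h. c * (mu18 k h * nu18 k h))" for c k
    by (intro set_integrable_mult_right mu18_nu18_integrable)
  have "(LINT h:{0<..}|lborel. 27 * (mu18 1 h * nu18 1 h) + 3 * (mu18 0 h * nu18 0 h)) = 16 - (- 2)"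
  proof (rule FTC_halfline[OF _ _ _ C18_0_tendsto_at_0 C18_0_tendsto_at_top])
    show "set_integrable lborel {0<..} (\<lambda>h. 27 * (mu18 1 h * nu18 1 h) + 3 * (mu18 0 h * nu18 0 h))"
      by (intro set_integral_add set_integrable_mult_right mu18_nu18_integrable)
  qed (use C18_deriv[of _ 0] isCont_mu18 isCont_nu18 in \<open>auto intro!: continuous_intros\<close>)
  also have "(LINT h:{0<..}|lborel. 27 * (mu18 1 h * nu18 1 h) + 3 * (mu18 0 h * nu18 0 h)) = 27 * I18 1 + 3 * I18 0"
    unfolding I18_def
    by (simp only: set_integral_add(2)[OF i i] set_integral_mult_right)
  finally show ?thesis by simp
qed

section \<open>The value of the first integral for V18\<close>

lemma Legendre_mod_3:
  "Legendre (int (3 * k + 1)) 3 = 1" "Legendre (int (3 * k + 2)) 3 = - 1" "Legendre (int (3 * k + 3)) 3 = 0"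
proof -
  have "QuadRes 3 (int (3 * k + 1))"
    unfolding QuadRes_def by (rule exI[of _ 1]) (simp add: cong_def)
  then show "Legendre (int (3 * k + 1)) 3 = 1" by (simp add: Legendre_def cong_def)
  have "\<not> QuadRes 3 (int (3 * k + 2))"
  proof
    assume "QuadRes 3 (int (3 * k + 2))"
    then obtain y where "y\<^sup>2 mod 3 = (2::int)" by (auto simp: QuadRes_def cong_def)
    moreover have "y mod 3 = 0 \<or> y mod 3 = 1 \<or> y mod 3 = 2" by presburger
    moreover have "y\<^sup>2 mod 3 = (y mod 3)\<^sup>2 mod 3" by (simp add: power_mod)
    ultimately show False by auto
  qed
  then show "Legendre (int (3 * k + 2)) 3 = - 1" by (simp add: Legendre_def cong_def)
  show "Legendre (int (3 * k + 3)) 3 = 0" by (simp add: Legendre_def cong_def)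
qed

lemma L_chi3_sums: "(\<lambda>k. 1 / (3 * real k + 1) ^ 3 - 1 / (3 * real k + 2) ^ 3) sums L_chi3 3"
proof -
  define f where "f = (\<lambda>n. real_of_int (Legendre (int (Suc n)) 3) / (real (Suc n)) ^ 3)"
  have "summable f"
  proof (rule summable_comparison_test'[OF sums_summable[OF zeta_int_sums[of 3]]])
    fix n :: nat
    have "\<bar>real_of_int (Legendre (int (Suc n)) 3)\<bar> \<le> 1" by (simp add: Legendre_def)
    then show "norm (f n) \<le> 1 / (real n + 1) ^ 3"
      by (simp add: f_def abs_divide divide_right_mono add.commute)
  qed simp
  then have "f sums L_chi3 3" unfolding L_chi3_def f_def by (rule summable_sums)
  then have "(\<lambda>k. \<Sum>i\<in>{k*3..<k*3+3}. f i) sums L_chi3 3" by (rule sums_group) simp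
  moreover have "(\<Sum>i\<in>{k*3..<k*3+3}. f i) = 1 / (3 * real k + 1) ^ 3 - 1 / (3 * real k + 2) ^ 3" for k
  proof -
    have "{k*3..<k*3+3} = {3*k, 3*k+1, 3*k+2}" by auto
    then have "(\<Sum>i\<in>{k*3..<k*3+3}. f i) = f (3 * k) + f (3 * k + 1) + f (3 * k + 2)" by simp
    moreover have "Suc (3 * k) = 3 * k + 1" "Suc (3 * k + 1) = 3 * k + 2" "Suc (3 * k + 2) = 3 * k + 3" by simp_all
    then have "f (3 * k) = 1 / (real (3 * k + 1)) ^ 3" "f (3 * k + 1) = - 1 / (real (3 * k + 2)) ^ 3" "f (3 * k + 2) = 0"
      unfolding f_def by (simp_all only: Legendre_mod_3)
    ultimately show ?thesis by (simp add: add.commute)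
  qed
  ultimately show ?thesis by simp
qed

text \<open>For \<open>x > 1\<close> the kernel \<open>1 / (1 + x + x ^ 2)\<close> is the sum of
  \<open>x ^ (- (3 * k + 2)) - x ^ (- (3 * k + 3))\<close>, and integrating
  \<open>(ln x) ^ 2 / x ^ (m + 1)\<close> from 1 gives \<open>2 / m ^ 3\<close>. Sum and integral
  are not interchanged: an arbitrary primitive is squeezed between partial sums of primitives by
  comparing derivatives.\<close>

lemma log_square_over_quadratic_limit:
  fixes \<Psi> :: "real \<Rightarrow> real"
  assumes \<Psi>: "\<And>x. x \<ge> 1 \<Longrightarrow> (\<Psi> has_real_derivative (ln x)\<^sup>2 / (1 + x + x\<^sup>2)) (at x)"
  shows "(\<Psi> \<longlongrightarrow> \<Psi> 1 + 2 * L_chi3 3) at_top"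
proof -
  \<comment> \<open>The primitive of \<open>(ln x) ^ 2 / x powr (m + 1)\<close> that vanishes at
    infinity.\<close>
  define p :: "real \<Rightarrow> real \<Rightarrow> real" where "p = (\<lambda>m x. - ((ln x)\<^sup>2 / m + 2 * ln x / m\<^sup>2 + 2 / m ^ 3) / x powr m)"
  have dp: "(p m has_real_derivative (ln x)\<^sup>2 / x powr (m + 1)) (at x)" if "m > 0" "x > 0" for m x
  proof -
    have "((\<lambda>x. x powr m) has_real_derivative m * x powr (m - 1)) (at x)"
      using that by (auto intro!: derivative_eq_intros)
    moreover have "((\<lambda>x. - ((ln x)\<^sup>2 / m + 2 * ln x / m\<^sup>2 + 2 / m ^ 3)) has_real_derivative - (2 * ln x / x / m + 2 / x / m\<^sup>2)) (at x)"
      using that by (auto intro!: derivative_eq_intros simp: field_simps)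
    ultimately have "(p m has_real_derivative (- (2 * ln x / x / m + 2 / x / m\<^sup>2) * x powr m -
        - ((ln x)\<^sup>2 / m + 2 * ln x / m\<^sup>2 + 2 / m ^ 3) * (m * x powr (m - 1))) / (x powr m * x powr m)) (at x)"
      unfolding p_def using that by (intro DERIV_divide) auto
    moreover have "x powr (m - 1) = x powr m / x" "x powr (m + 1) = x powr m * x"
      using that by (simp_all add: powr_diff powr_add)
    moreover have "(- (2 * ln x / x / m + 2 / x / m\<^sup>2) * y - - ((ln x)\<^sup>2 / m + 2 * ln x / m\<^sup>2 + 2 / m ^ 3) * (m * (y / x))) / (y * y)
        = (ln x)\<^sup>2 / (y * x)" if "y > 0" for y
      using that \<open>m > 0\<close> \<open>x > 0\<close> by (simp add: divide_simps power2_eq_square power3_eq_cube) (simp add: algebra_simps)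
    from this[of "x powr m"]
    have "(- (2 * ln x / x / m + 2 / x / m\<^sup>2) * x powr m - - ((ln x)\<^sup>2 / m + 2 * ln x / m\<^sup>2 + 2 / m ^ 3) * (m * (x powr m / x))) / (x powr m * x powr m)
        = (ln x)\<^sup>2 / (x powr m * x)" using that by simp
    ultimately show ?thesis by simp
  qed
  have p1: "p m 1 = - 2 / m ^ 3" for m by (simp add: p_def)
  have p_lim: "(p m \<longlongrightarrow> 0) at_top" if "m > 0" for m
    unfolding p_def using that by real_asymp
  define c where "c = (\<lambda>k::nat. 1 / (3 * real k + 1) ^ 3 - 1 / (3 * real k + 2) ^ 3)"
  define g where "g = (\<lambda>N x. \<Sum>k<N. p (3 * real k + 1) x - p (3 * real k + 2) x)"
  have g1: "g N 1 = - 2 * (\<Sum>k<N. c k)" for N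
    by (simp add: g_def p1 c_def sum_distrib_left algebra_simps)
  have g_lim: "(g N \<longlongrightarrow> 0) at_top" for N
    unfolding g_def by (rule tendsto_null_sum) (rule tendsto_eq_intros p_lim | simp)+
  have dg: "(g N has_real_derivative (ln x)\<^sup>2 * (1 - 1 / x ^ (3 * N)) / (1 + x + x\<^sup>2)) (at x)" if x: "x \<ge> 1" for N x
  proof -
    have "(g N has_real_derivative (\<Sum>k<N. (ln x)\<^sup>2 / x powr (3 * real k + 1 + 1) - (ln x)\<^sup>2 / x powr (3 * real k + 2 + 1))) (at x)"
      unfolding g_def using x by (intro DERIV_sum DERIV_diff dp) auto
    moreover have "(\<Sum>k<N. (ln x)\<^sup>2 / x powr (3 * real k + 1 + 1) - (ln x)\<^sup>2 / x powr (3 * real k + 2 + 1)) =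
        (ln x)\<^sup>2 * (1 - 1 / x ^ (3 * N)) / (1 + x + x\<^sup>2)"
    proof (induction N)
      case (Suc N)
      define X where "X = x ^ (3 * N)"
      have X: "X > 0" using x by (simp add: X_def)
      have "x powr (3 * real N + 1 + 1) = x powr real (3 * N + 2)" "x powr (3 * real N + 2 + 1) = x powr real (3 * N + 3)"
        by (simp_all add: algebra_simps)
      then have pw: "x powr (3 * real N + 1 + 1) = X * x\<^sup>2" "x powr (3 * real N + 2 + 1) = X * x ^ 3"
        using x by (simp_all only: powr_realpow) (simp_all add: X_def power_add power2_eq_square)
      have X3: "x ^ (3 * Suc N) = X * x ^ 3" by (simp add: X_def power_add[symmetric] add.commute)
      have pos: "1 + x + x\<^sup>2 > 0" using x by (simp add: add_pos_nonneg)
      have "(ln x)\<^sup>2 * (1 - 1 / X) / (1 + x + x\<^sup>2) + ((ln x)\<^sup>2 / (X * x\<^sup>2) - (ln x)\<^sup>2 / (X * x ^ 3)) =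
          (ln x)\<^sup>2 * (1 - 1 / (X * x ^ 3)) / (1 + x + x\<^sup>2)"
      proof -
        have "L * (1 - 1 / X) / q + (L / (X * x\<^sup>2) - L / (X * x ^ 3)) = L * (1 - 1 / (X * x ^ 3)) / q"
          if "q = 1 + x + x\<^sup>2" "q > 0" for L q
          using that(2) X x by (simp add: divide_simps) (use that(1) in \<open>Groebner_Basis.algebra\<close>)
        from this[OF refl pos] show ?thesis .
      qed
      then show ?case unfolding sum.lessThan_Suc Suc pw X3 X_def[symmetric] .
    qed simp
    ultimately show ?thesis by simp
  qed
  have lower: "\<Psi> x - \<Psi> 1 \<ge> g N x - g N 1" if x: "x \<ge> 1" for N x
  proof -
    have "(\<lambda>x. \<Psi> x - g N x) 1 \<le> (\<lambda>x. \<Psi> x - g N x) x"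
    proof (rule DERIV_nonneg_imp_nondecreasing[OF x])
      fix t :: real assume t: "1 \<le> t" "t \<le> x"
      have "((\<lambda>x. \<Psi> x - g N x) has_real_derivative (ln t)\<^sup>2 / (1 + t + t\<^sup>2) - (ln t)\<^sup>2 * (1 - 1 / t ^ (3 * N)) / (1 + t + t\<^sup>2)) (at t)"
        by (intro DERIV_diff \<Psi> dg t)
      moreover have "(ln t)\<^sup>2 * (1 - 1 / t ^ (3 * N)) / (1 + t + t\<^sup>2) \<le> (ln t)\<^sup>2 / (1 + t + t\<^sup>2)"
        using t by (intro divide_right_mono mult_left_le) auto
      ultimately show "\<exists>y. ((\<lambda>x. \<Psi> x - g N x) has_real_derivative y) (at t) \<and> 0 \<le> y"
        by (metis diff_ge_0_iff_ge)
    qed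
    then show ?thesis by simp
  qed
  have upper: "\<Psi> x - \<Psi> 1 \<le> g N x - g N 1 + (p (3 * real N + 1) x - p (3 * real N + 1) 1)" if x: "x \<ge> 1" for N x
  proof -
    have "(\<lambda>x. g N x + p (3 * real N + 1) x - \<Psi> x) 1 \<le> (\<lambda>x. g N x + p (3 * real N + 1) x - \<Psi> x) x"
    proof (rule DERIV_nonneg_imp_nondecreasing[OF x])
      fix t :: real assume t: "1 \<le> t" "t \<le> x"
      define X where "X = t ^ (3 * N)"
      have X: "X \<ge> 1" using t by (simp add: X_def)
      have "t powr (3 * real N + 1 + 1) = t powr real (3 * N + 2)" by (simp add: algebra_simps)
      then have pw: "t powr (3 * real N + 1 + 1) = X * t\<^sup>2"
        using t by (simp only: powr_realpow) (simp add: X_def power_add power2_eq_square)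
      have "((\<lambda>x. g N x + p (3 * real N + 1) x - \<Psi> x) has_real_derivative
          (ln t)\<^sup>2 * (1 - 1 / t ^ (3 * N)) / (1 + t + t\<^sup>2) + (ln t)\<^sup>2 / t powr (3 * real N + 1 + 1) - (ln t)\<^sup>2 / (1 + t + t\<^sup>2)) (at t)"
        by (intro DERIV_diff DERIV_add \<Psi> dg dp) (use t in auto)
      moreover have "(ln t)\<^sup>2 * (1 - 1 / X) / (1 + t + t\<^sup>2) + (ln t)\<^sup>2 / (X * t\<^sup>2) - (ln t)\<^sup>2 / (1 + t + t\<^sup>2) =
          (ln t)\<^sup>2 * (1 / (X * t\<^sup>2) - 1 / (X * (1 + t + t\<^sup>2)))"
        using X t by (simp add: algebra_simps diff_divide_distrib)
      moreover have "1 / (X * (1 + t + t\<^sup>2)) \<le> 1 / (X * t\<^sup>2)"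
        using X t by (intro divide_left_mono mult_left_mono mult_pos_pos) (auto simp: add_pos_nonneg)
      then have "(ln t)\<^sup>2 * (1 / (X * t\<^sup>2) - 1 / (X * (1 + t + t\<^sup>2))) \<ge> 0" by simp
      ultimately show "\<exists>y. ((\<lambda>x. g N x + p (3 * real N + 1) x - \<Psi> x) has_real_derivative y) (at t) \<and> 0 \<le> y"
        unfolding pw X_def[symmetric] by metis
    qed
    then show ?thesis by simp
  qed
  have c_lim: "(\<lambda>N. \<Psi> 1 + 2 * (\<Sum>k<N. c k)) \<longlonglongrightarrow> \<Psi> 1 + 2 * L_chi3 3"
    using L_chi3_sums unfolding sums_def c_def by (intro tendsto_intros)
  have c_lim': "(\<lambda>N. \<Psi> 1 + 2 * (\<Sum>k<N. c k) + 2 / (3 * real N + 1) ^ 3) \<longlonglongrightarrow> \<Psi> 1 + 2 * L_chi3 3 + 0"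
    by (intro tendsto_add c_lim) real_asymp
  show ?thesis
  proof (rule order_tendstoI)
    fix a assume "a < \<Psi> 1 + 2 * L_chi3 3"
    then have "\<forall>\<^sub>F N in sequentially. a < \<Psi> 1 + 2 * (\<Sum>k<N. c k)" using c_lim by (rule order_tendstoD(1)[rotated])
    then obtain N where N: "a < \<Psi> 1 + 2 * (\<Sum>k<N. c k)" by (auto simp: eventually_sequentially)
    have "((\<lambda>x. \<Psi> 1 + (g N x - g N 1)) \<longlongrightarrow> \<Psi> 1 + (0 - g N 1)) at_top"
      by (intro tendsto_intros g_lim)
    then have "\<forall>\<^sub>F x in at_top. a < \<Psi> 1 + (g N x - g N 1)"
      by (rule order_tendstoD(1)) (use N g1[of N] in simp)
    then show "\<forall>\<^sub>F x in at_top. a < \<Psi> x"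
      using eventually_ge_at_top[of 1] by eventually_elim (use lower[of _ N] in fastforce)
  next
    fix a assume "\<Psi> 1 + 2 * L_chi3 3 < a"
    then have "\<forall>\<^sub>F N in sequentially. \<Psi> 1 + 2 * (\<Sum>k<N. c k) + 2 / (3 * real N + 1) ^ 3 < a"
      using c_lim' by (intro order_tendstoD(2)[OF c_lim']) simp
    then obtain N where N: "\<Psi> 1 + 2 * (\<Sum>k<N. c k) + 2 / (3 * real N + 1) ^ 3 < a" by (auto simp: eventually_sequentially)
    have "((\<lambda>x. \<Psi> 1 + (g N x - g N 1 + (p (3 * real N + 1) x - p (3 * real N + 1) 1))) \<longlongrightarrow>
        \<Psi> 1 + (0 - g N 1 + (0 - p (3 * real N + 1) 1))) at_top"
      by (intro tendsto_intros g_lim p_lim) simp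
    then have "\<forall>\<^sub>F x in at_top. \<Psi> 1 + (g N x - g N 1 + (p (3 * real N + 1) x - p (3 * real N + 1) 1)) < a"
      by (rule order_tendstoD(2)) (use N g1[of N] p1[of "3 * real N + 1"] in simp)
    then show "\<forall>\<^sub>F x in at_top. \<Psi> x < a"
      using eventually_ge_at_top[of 1] by eventually_elim (use upper[of _ N] in fastforce)
  qed
qed

definition rho :: complex where "rho = Complex (1 / 2) (sqrt 3 / 2)"

definition f18 :: "complex \<Rightarrow> complex" where
  "f18 z = (Ln z - Complex 0 (pi / 3))\<^sup>2 / (1 - z + z\<^sup>2)"

lemma Ln_of_real_mult_rho: "x > 0 \<Longrightarrow> Ln (of_real x * rho) = Complex (ln x) (pi / 3)"
proof (rule Ln_unique)
  assume "x > 0"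
  then show "exp (Complex (ln x) (pi / 3)) = of_real x * rho"
    by (simp add: exp_eq_polar cis_conv_exp[symmetric] rho_def complex_eq_iff cos_60 sin_60)
qed (use pi_gt_zero in simp_all)

lemma sixth_cyclotomic_factor: "1 - z + z\<^sup>2 = (z - rho) * (z - cnj rho)"
proof -
  have "rho + cnj rho = 1" "rho * cnj rho = 1"
    by (simp_all add: rho_def complex_eq_iff power2_eq_square[symmetric] power_divide)
  then show ?thesis by Groebner_Basis.algebra
qed

text \<open>The singularity of \<open>f18\<close> at \<open>rho\<close> is removable, and the junk value \<open>f18 rho = 0\<close> is the right one.\<close>

lemma f18_primitive:
  obtains F where "\<And>z. Re z > 0 \<Longrightarrow> Im z > 0 \<Longrightarrow> (F has_field_derivative f18 z) (at z)"
proof -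
  define S where "S = {z. Re z > 0} \<inter> {z. Im z > 0}"
  have op: "open S" unfolding S_def by (intro open_Int open_halfspace_Re_gt open_halfspace_Im_gt)
  have cv: "convex S" unfolding S_def by (intro convex_Int convex_halfspace_Re_gt convex_halfspace_Im_gt)
  have S: "z \<notin> \<real>\<^sub>\<le>\<^sub>0" "z \<noteq> cnj rho" if "z \<in> S" for z
    using that by (auto simp: S_def rho_def complex_nonpos_Reals_iff)
  have rho_S: "rho \<in> S" by (simp add: S_def rho_def)
  have diff: "f18 field_differentiable at z" if z: "z \<in> S" "z \<noteq> rho" for z
  proof -
    have "1 - z + z\<^sup>2 \<noteq> 0" using S[OF z(1)] z(2) by (simp add: sixth_cyclotomic_factor)
    moreover have "Ln field_differentiable at z"
      using has_field_derivative_Ln[OF S(1)[OF z(1)]] field_differentiable_def by blast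
    ultimately show ?thesis unfolding f18_def
      by (intro field_differentiable_divide field_differentiable_power field_differentiable_diff
          field_differentiable_add field_differentiable_const field_differentiable_ident)
  qed
  have Ln_rho: "Ln rho = Complex 0 (pi / 3)" using Ln_of_real_mult_rho[of 1] by simp
  have "isCont f18 rho"
  proof -
    have "((\<lambda>z. (Ln z - Ln rho) / (z - rho)) \<longlongrightarrow> inverse rho) (at rho)"
      using has_field_derivative_Ln[OF S(1)[OF rho_S]] by (simp add: has_field_derivative_iff)
    moreover have "((\<lambda>z. (Ln z - Ln rho) / (z - cnj rho)) \<longlongrightarrow> (Ln rho - Ln rho) / (rho - cnj rho)) (at rho)"
      using S[OF rho_S] by (intro tendsto_intros) auto
    ultimately have "((\<lambda>z. (Ln z - Ln rho) / (z - rho) * ((Ln z - Ln rho) / (z - cnj rho))) \<longlongrightarrow>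
        inverse rho * ((Ln rho - Ln rho) / (rho - cnj rho))) (at rho)"
      by (rule tendsto_mult)
    moreover have "f18 = (\<lambda>z. (Ln z - Ln rho) / (z - rho) * ((Ln z - Ln rho) / (z - cnj rho)))"
      unfolding f18_def Ln_rho[symmetric] sixth_cyclotomic_factor by (simp add: power2_eq_square fun_eq_iff)
    moreover have "f18 rho = 0" by (simp add: f18_def Ln_rho)
    ultimately show ?thesis
      unfolding isCont_def by (simp only: diff_self div_0 mult_zero_left mult_zero_right)
  qed
  with diff have "continuous_on S f18"
    by (intro continuous_at_imp_continuous_on ballI) (metis field_differentiable_imp_continuous_at)
  then obtain F where "\<And>z. z \<in> S \<Longrightarrow> (F has_field_derivative f18 z) (at z within S)"
    using diff op by (rule_tac holomorphic_convex_primitive[OF cv, of "{rho}" f18]) (auto simp: interior_open)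
  then show ?thesis
    using that[of F] at_within_open[OF _ op] by (auto simp: S_def)
qed

text \<open>On the line \<open>Re z = 1 / 2\<close>, parametrised by \<open>h\<close>, one has
  \<open>1 - z + z ^ 2 = - h\<close>, \<open>norm z = sqrt (1 + h)\<close> and
  \<open>Arg z = arctan r\<close>. The cross term of the squared logarithm is then the product of
  \<open>ln (1 + h)\<close> and the arctangent factor of \<open>nu18 0\<close>.\<close>

lemma f18_vertical:
  assumes F: "\<And>z. Re z > 0 \<Longrightarrow> Im z > 0 \<Longrightarrow> (F has_field_derivative f18 z) (at z)" and h: "h > 0"
  shows "((\<lambda>h. 6 * Re (F (Complex (1 / 2) (sqrt (4 * h + 3) / 2)))) has_real_derivative mu18 0 h * nu18 0 h) (at h)"
proof -
  define r where "r = sqrt (4 * h + 3)"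
  define z where "z = Complex (1 / 2) (r / 2)"
  have r2: "r\<^sup>2 = 4 * h + 3" and r: "r > 0" using h by (simp_all add: r_def)
  have "sqrt (1 + r\<^sup>2) = sqrt (2\<^sup>2 * (1 + h))" unfolding r2 by simp
  then have s: "sqrt (1 + r\<^sup>2) = 2 * sqrt (1 + h)" unfolding real_sqrt_mult by simp
  have Ln_z: "Ln z = Complex (ln (1 + h) / 2) (arctan r)"
  proof (rule Ln_unique)
    have "exp (ln (1 + h) / 2) = sqrt (1 + h)" using h by (simp add: ln_sqrt[symmetric])
    then show "exp (Complex (ln (1 + h) / 2) (arctan r)) = z"
      using h by (simp add: exp_eq_polar z_def complex_eq_iff cos_arctan sin_arctan s)
  qed (use arctan_bounded[of r] pi_gt_zero in auto)
  have den: "1 - z + z\<^sup>2 = - of_real h"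
    using r2 by (simp add: z_def complex_eq_iff power2_eq_square field_simps)
  have "((\<lambda>h. Complex (1 / 2) (sqrt (4 * h + 3) / 2)) has_vector_derivative Complex 0 (1 / r)) (at h)"
    unfolding has_vector_derivative_complex_iff using h
    by (auto intro!: derivative_eq_intros simp: r_def divide_simps)
  moreover have "(F has_field_derivative f18 z) (at z)" using r by (intro F) (auto simp: z_def)
  ultimately have "((F \<circ> (\<lambda>h. Complex (1 / 2) (sqrt (4 * h + 3) / 2))) has_vector_derivative Complex 0 (1 / r) * f18 z) (at h)"
    by (intro field_vector_diff_chain_at) (auto simp: z_def r_def)
  then have "((\<lambda>h. Re (F (Complex (1 / 2) (sqrt (4 * h + 3) / 2)))) has_real_derivative Re (Complex 0 (1 / r) * f18 z)) (at h)"
    unfolding has_vector_derivative_complex_iff o_def by blast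
  then have "((\<lambda>h. 6 * Re (F (Complex (1 / 2) (sqrt (4 * h + 3) / 2)))) has_real_derivative 6 * Re (Complex 0 (1 / r) * f18 z)) (at h)"
    by (rule DERIV_cmult)
  moreover have "f18 z = - (Complex (ln (1 + h) / 2) (arctan r) - Complex 0 (pi / 3))\<^sup>2 / of_real h"
    unfolding f18_def den Ln_z by simp
  then have "Im (f18 z) = - (ln (1 + h) * (arctan r - pi / 3)) / h" by (simp add: power2_eq_square)
  then have "6 * Re (Complex 0 (1 / r) * f18 z) = mu18 0 h * nu18 0 h"
    using h r by (simp add: mu18_0 nu18_0 r_def[symmetric] power2_eq_square divide_simps) (simp add: algebra_simps)
  ultimately show ?thesis by simp
qed

text \<open>Along the ray the logarithm minus its value at \<open>rho\<close> is the real number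
  \<open>ln x\<close>, so only the real part of \<open>1 / w\<close> with
  \<open>1 - z + z ^ 2 = rho * w\<close> is needed. At \<open>x = 1\<close> both \<open>w\<close>
  and \<open>ln x\<close> vanish, which is treated apart.\<close>

lemma f18_ray:
  assumes F: "\<And>z. Re z > 0 \<Longrightarrow> Im z > 0 \<Longrightarrow> (F has_field_derivative f18 z) (at z)" and x: "x \<ge> 1"
  shows "((\<lambda>x. 2 * Re (F (of_real x * rho))) has_real_derivative (ln x)\<^sup>2 / (1 + x + x\<^sup>2)) (at x)"
proof -
  define z where "z = of_real x * rho"
  have "((\<lambda>x. of_real x * rho) has_vector_derivative rho) (at x)"
    unfolding has_vector_derivative_complex_iff by (auto intro!: derivative_eq_intros)
  moreover have "(F has_field_derivative f18 z) (at z)" using x by (intro F) (auto simp: z_def rho_def)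
  ultimately have "((F \<circ> (\<lambda>x. of_real x * rho)) has_vector_derivative rho * f18 z) (at x)"
    by (intro field_vector_diff_chain_at) (auto simp: z_def)
  then have "((\<lambda>x. Re (F (of_real x * rho))) has_real_derivative Re (rho * f18 z)) (at x)"
    unfolding has_vector_derivative_complex_iff o_def by blast
  then have "((\<lambda>x. 2 * Re (F (of_real x * rho))) has_real_derivative 2 * Re (rho * f18 z)) (at x)"
    by (rule DERIV_cmult)
  moreover have "2 * Re (rho * f18 z) = (ln x)\<^sup>2 / (1 + x + x\<^sup>2)"
  proof (cases "x = 1")
    case True
    then show ?thesis using Ln_of_real_mult_rho[of 1] by (simp add: f18_def z_def)
  next
    case False
    define w where "w = Complex ((x - 1)\<^sup>2 / 2) (sqrt 3 / 2 * (x\<^sup>2 - 1))"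
    have "1 - z + z\<^sup>2 = rho * w"
      by (simp add: z_def w_def rho_def complex_eq_iff power2_eq_square) (simp add: field_simps)
    moreover have "Ln z - Complex 0 (pi / 3) = of_real (ln x)"
      using Ln_of_real_mult_rho[of x] x by (simp add: z_def complex_eq_iff)
    moreover have "rho \<noteq> 0" by (simp add: rho_def complex_eq_iff)
    ultimately have "rho * f18 z = of_real ((ln x)\<^sup>2) / w" by (simp add: f18_def)
    then have "Re (rho * f18 z) = (ln x)\<^sup>2 * ((x - 1)\<^sup>2 / 2) / (((x - 1)\<^sup>2 / 2)\<^sup>2 + (sqrt 3 / 2 * (x\<^sup>2 - 1))\<^sup>2)"
      by (simp add: Re_divide w_def flip: of_real_power)
    then have "2 * Re (rho * f18 z) = 2 * ((ln x)\<^sup>2 * ((x - 1)\<^sup>2 / 2)) / (((x - 1)\<^sup>2 / 2)\<^sup>2 + (sqrt 3 / 2 * (x\<^sup>2 - 1))\<^sup>2)"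
      by (simp only: times_divide_eq_right)
    also have "((x - 1)\<^sup>2 / 2)\<^sup>2 + (sqrt 3 / 2 * (x\<^sup>2 - 1))\<^sup>2 = (x - 1)\<^sup>2 * (1 + x + x\<^sup>2)"
    proof -
      have "((x - 1)\<^sup>2 / 2)\<^sup>2 + 3 / 4 * (x\<^sup>2 - 1)\<^sup>2 = (x - 1)\<^sup>2 * (1 + x + x\<^sup>2)"
        by (simp add: power2_eq_square field_simps)
      then show ?thesis by (simp add: power_mult_distrib power_divide)
    qed
    also have "2 * ((ln x)\<^sup>2 * ((x - 1)\<^sup>2 / 2)) / ((x - 1)\<^sup>2 * (1 + x + x\<^sup>2)) = (ln x)\<^sup>2 / (1 + x + x\<^sup>2)"
      using False by simp
    finally show ?thesis .
  qed
  ultimately show ?thesis by simp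
qed

text \<open>Taking \<open>h = R ^ 2 - 1\<close> puts both endpoints on the circle of radius
  \<open>R\<close>. They lie in the convex cap \<open>T\<close>, where \<open>norm z\<close> is
  between \<open>sqrt 3 / 2 * R\<close> and \<open>R\<close>, so a mean value bound along the chord
  replaces an arc integral.\<close>

lemma f18_arc:
  assumes F: "\<And>z. Re z > 0 \<Longrightarrow> Im z > 0 \<Longrightarrow> (F has_field_derivative f18 z) (at z)" and R: "R \<ge> 3"
  shows "norm (F (Complex (1 / 2) (sqrt (4 * (R\<^sup>2 - 1) + 3) / 2)) - F (of_real R * rho)) \<le>
    (ln R + 2 * pi)\<^sup>2 / (3 / 4 * R\<^sup>2 - R - 1) * (2 * R)"
proof -
  define T where "T = {z. Re z > 0} \<inter> ({z. Im z \<ge> sqrt 3 / 2 * R} \<inter> cball 0 R)"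
  define B where "B = (ln R + 2 * pi)\<^sup>2 / (3 / 4 * R\<^sup>2 - R - 1)"
  define u where "u = Complex (1 / 2) (sqrt (4 * (R\<^sup>2 - 1) + 3) / 2)"
  define v where "v = of_real R * rho"
  have R2: "R\<^sup>2 \<ge> 3 * R" using R by (simp add: power2_eq_square)
  then have D: "3 / 4 * R\<^sup>2 - R - 1 > 0" using R by linarith
  have cv: "convex T" unfolding T_def
    by (intro convex_Int convex_halfspace_Re_gt convex_halfspace_Im_ge convex_cball)
  have dF: "(F has_field_derivative f18 z) (at z within T)" if "z \<in> T" for z
  proof (rule has_field_derivative_at_within[OF F])
    have "sqrt 3 / 2 * R > 0" using R by simp
    then show "Im z > 0" "Re z > 0" using that by (auto simp: T_def)
  qed
  have bd: "norm (f18 z) \<le> B" if z: "z \<in> T" for z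
  proof -
    have zR: "norm z \<le> R" and Im: "sqrt 3 / 2 * R \<le> Im z" and Re: "Re z > 0" using z by (auto simp: T_def)
    have "sqrt 3 / 2 * R \<le> norm z" using Im abs_Im_le_cmod[of z] by linarith
    then have "(sqrt 3 / 2 * R)\<^sup>2 \<le> (norm z)\<^sup>2" using R by (intro power_mono) auto
    then have z2: "3 / 4 * R\<^sup>2 \<le> (norm z)\<^sup>2" by (simp add: power_mult_distrib power_divide)
    have z1: "norm z \<ge> 1"
    proof (rule power2_le_imp_le)
      show "1\<^sup>2 \<le> (norm z)\<^sup>2" using z2 R2 R by simp
    qed simp
    have "norm (z\<^sup>2) \<le> norm (1 - z + z\<^sup>2) + norm (z - 1)"
      using norm_triangle_ineq[of "1 - z + z\<^sup>2" "z - 1"] by simp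
    moreover have "norm (z - 1) \<le> norm z + 1" using norm_triangle_ineq4[of z 1] by simp
    ultimately have den: "3 / 4 * R\<^sup>2 - R - 1 \<le> norm (1 - z + z\<^sup>2)"
      using z2 zR by (simp add: norm_power)
    have "z \<noteq> 0" using z1 by auto
    then have "\<bar>Re (Ln z - Complex 0 (pi / 3))\<bar> \<le> ln R" using z1 zR by simp
    moreover have "\<bar>Im (Ln z - Complex 0 (pi / 3))\<bar> \<le> 2 * pi"
      using Re_Ln_pos_lt_imp[OF Re] by simp
    ultimately have "norm (Ln z - Complex 0 (pi / 3)) \<le> ln R + 2 * pi"
      using cmod_le[of "Ln z - Complex 0 (pi / 3)"] by linarith
    then have "norm ((Ln z - Complex 0 (pi / 3))\<^sup>2) \<le> (ln R + 2 * pi)\<^sup>2"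
      unfolding norm_power by (intro power_mono) auto
    then show ?thesis
      unfolding f18_def B_def norm_divide using den D by (intro frac_le) auto
  qed
  have u: "u \<in> T"
  proof -
    have "norm u = sqrt (R\<^sup>2)" unfolding u_def using R2 R by (simp add: cmod_def power_divide field_simps)
    moreover have "sqrt (3 * R\<^sup>2) \<le> sqrt (4 * (R\<^sup>2 - 1) + 3)" using R2 R by (intro real_sqrt_le_mono) simp
    ultimately show ?thesis using R by (simp add: T_def real_sqrt_mult) (simp add: u_def)
  qed
  have v: "v \<in> T"
  proof -
    have "norm rho = 1" by (simp add: rho_def cmod_def power_divide)
    then show ?thesis using R by (simp add: T_def v_def norm_mult) (simp add: rho_def)
  qed
  have "norm (F u - F v) \<le> B * norm (u - v)"
    by (rule field_differentiable_bound[OF cv dF bd u v])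
  also have "norm (u - v) \<le> 2 * R" using norm_triangle_ineq4[of u v] u v by (simp add: T_def)
  then have "B * norm (u - v) \<le> B * (2 * R)" using D by (intro mult_left_mono) (auto simp: B_def)
  finally show ?thesis unfolding u_def v_def B_def .
qed

lemma I18_0: "I18 0 = 6 * L_chi3 3"
proof -
  obtain F where F: "\<And>z. Re z > 0 \<Longrightarrow> Im z > 0 \<Longrightarrow> (F has_field_derivative f18 z) (at z)"
    by (rule f18_primitive) blast
  define \<Phi> where "\<Phi> = (\<lambda>h. 6 * Re (F (Complex (1 / 2) (sqrt (4 * h + 3) / 2))))"
  have ray: "((\<lambda>x. 2 * Re (F (of_real x * rho))) \<longlongrightarrow> 2 * Re (F rho) + 2 * L_chi3 3) at_top"
    using log_square_over_quadratic_limit[OF f18_ray[OF F]] by simp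
  have "((\<lambda>R. F (Complex (1 / 2) (sqrt (4 * (R\<^sup>2 - 1) + 3) / 2)) - F (of_real R * rho)) \<longlongrightarrow> 0) at_top"
  proof (rule Lim_null_comparison)
    show "\<forall>\<^sub>F R in at_top. norm (F (Complex (1 / 2) (sqrt (4 * (R\<^sup>2 - 1) + 3) / 2)) - F (of_real R * rho)) \<le>
      (ln R + 2 * pi)\<^sup>2 / (3 / 4 * R\<^sup>2 - R - 1) * (2 * R)"
      using eventually_ge_at_top[of 3] by eventually_elim (rule f18_arc[OF F])
    show "((\<lambda>R::real. (ln R + 2 * pi)\<^sup>2 / (3 / 4 * R\<^sup>2 - R - 1) * (2 * R)) \<longlongrightarrow> 0) at_top" by real_asymp
  qed
  then have "((\<lambda>R. 6 * Re (F (Complex (1 / 2) (sqrt (4 * (R\<^sup>2 - 1) + 3) / 2)) - F (of_real R * rho)) +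
      3 * (2 * Re (F (of_real R * rho)))) \<longlongrightarrow> 6 * Re 0 + 3 * (2 * Re (F rho) + 2 * L_chi3 3)) at_top"
    by (intro tendsto_intros ray)
  then have arc: "((\<lambda>R. \<Phi> (R\<^sup>2 - 1)) \<longlongrightarrow> 6 * Re (F rho) + 6 * L_chi3 3) at_top"
    by (simp add: \<Phi>_def algebra_simps)
  \<comment> \<open>Returns from the radius \<open>R\<close> to the variable \<open>h\<close> by
    inverting \<open>h = R ^ 2 - 1\<close>.\<close>
  have "((\<lambda>h. \<Phi> ((sqrt (1 + h))\<^sup>2 - 1)) \<longlongrightarrow> 6 * Re (F rho) + 6 * L_chi3 3) at_top"
    by (rule filterlim_compose[OF arc]) real_asymp
  moreover have "\<forall>\<^sub>F h in at_top. \<Phi> ((sqrt (1 + h))\<^sup>2 - 1) = \<Phi> h"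
    using eventually_ge_at_top[of 0] by eventually_elim simp
  ultimately have top: "(\<Phi> \<longlongrightarrow> 6 * Re (F rho) + 6 * L_chi3 3) at_top"
    by (simp add: tendsto_cong)
  have "isCont F rho" using F[of rho] DERIV_isCont by (auto simp: rho_def)
  moreover have "((\<lambda>h. Complex (1 / 2) (sqrt (4 * h + 3) / 2)) \<longlongrightarrow> Complex (1 / 2) (sqrt (4 * 0 + 3) / 2)) (at_right 0)"
    by (intro tendsto_intros) auto
  then have "((\<lambda>h. Complex (1 / 2) (sqrt (4 * h + 3) / 2)) \<longlongrightarrow> rho) (at_right 0)" by (simp add: rho_def)
  ultimately have zero: "(\<Phi> \<longlongrightarrow> 6 * Re (F rho)) (at_right 0)"
    unfolding \<Phi>_def by (intro tendsto_intros isCont_tendsto_compose[of _ F])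
  have "I18 0 = 6 * Re (F rho) + 6 * L_chi3 3 - 6 * Re (F rho)"
    unfolding I18_def
    by (rule FTC_halfline[OF _ _ mu18_nu18_integrable zero top])
       (use f18_vertical[OF F] isCont_mu18 isCont_nu18 in \<open>auto simp: \<Phi>_def intro!: continuous_intros\<close>)
  then show ?thesis by simp
qed

lemma limit_V18: "(\<lambda>n. seq_b P18 Q18 n / seq_a P18 Q18 n) \<longlonglongrightarrow> L_chi3 3 / 3"
proof -
  define f where "f = (\<lambda>n. (- 27) ^ n * I18 n)"
  have "(\<lambda>n. seq_b P18 Q18 n / seq_a P18 Q18 n) \<longlonglongrightarrow> - f 0 / (- 18)"
  \<comment> \<open>The bound on \<open>f n\<close> is a multiple of \<open>(27 / 10) ^ n\<close>,
    just below \<open>3 ^ n\<close>.\<close>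
  proof (rule apery_limit[where c = 3])
    show "3\<^sup>2 * real n ^ 3 \<le> 3 * P18 n + min 0 (Q18 n)" if "n \<ge> 3" for n
    proof -
      define x where "x = real n - 3"
      have "x \<ge> 0" "real n = x + 3" using that by (auto simp: x_def)
      then show ?thesis by (simp add: P18_def Q18_def algebra_simps power2_eq_square power3_eq_cube)
    qed
    show "real n ^ 3 * f n = P18 n * f (n - 1) + Q18 n * f (n - 2)" if n: "n \<ge> 2" for n
    proof -
      obtain m where m: "n = m + 2" using le_add_diff_inverse2[OF n] by metis
      define k where "k = real m + 2"
      define e where "e = (- 27 :: real) ^ m"
      have "27 * k ^ 3 * I18 (m + 2) + 3 * (2 * k - 1) * (3 * k\<^sup>2 - 3 * k + 1) * I18 (m + 1) - (k - 1) ^ 3 * I18 m = 0"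
        using I18_rec[of m] by (simp add: k_def)
      then have "k ^ 3 * (729 * e * I18 (m + 2)) =
          3 * (2 * k - 1) * (3 * k\<^sup>2 - 3 * k + 1) * (- 27 * e * I18 (m + 1)) + 27 * (k - 1) ^ 3 * (e * I18 m)"
        by Groebner_Basis.algebra
      moreover have "real n = k" by (simp add: m k_def)
      moreover have "f n = 729 * e * I18 (m + 2)" "f (n - 1) = - 27 * e * I18 (m + 1)" "f (n - 2) = e * I18 m"
        by (simp_all add: f_def e_def m power_add)
      ultimately show ?thesis by (simp only: P18_def Q18_def)
    qed
    show "(\<lambda>n. f n / 3 ^ n) \<longlonglongrightarrow> 0"
    proof (rule Lim_null_comparison)
      have "norm (f n / 3 ^ n) \<le> I18 0 * (9 / 10) ^ n" for n
      proof -
        have "norm (f n / 3 ^ n) = (27 / 3) ^ n * \<bar>I18 n\<bar>"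
          by (simp add: f_def abs_mult power_abs power_divide[symmetric] flip: times_divide_eq_left)
        also have "\<dots> \<le> (27 / 3) ^ n * ((1 / 10) ^ n * I18 0)" by (intro mult_left_mono I18_bound) simp
        also have "\<dots> = I18 0 * (9 / 10) ^ n" by (simp add: power_divide)
        finally show ?thesis .
      qed
      then show "\<forall>\<^sub>F n in sequentially. norm (f n / 3 ^ n) \<le> I18 0 * (9 / 10) ^ n"
        by (intro always_eventually allI)
      show "(\<lambda>n. I18 0 * (9 / 10) ^ n) \<longlonglongrightarrow> 0"
        by (intro tendsto_mult_right_zero LIMSEQ_power_zero) simp
    qed
    show "f 1 = P18 1 * f 0 + - 18" using I18_1 by (simp add: f_def P18_def)
  qed (auto simp: P18_def Q18_def)
  then show ?thesis by (simp add: f_def I18_0)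
qed

theorem theorem2p4:
  shows "((\<lambda>n. seq_b P10 Q10 n / seq_a P10 Q10 n) \<longlonglongrightarrow> zeta_int 2 / 10) \<and>
    ((\<lambda>n. seq_b P12 Q12 n / seq_a P12 Q12 n) \<longlonglongrightarrow> zeta_int 3 / 6) \<and>
    ((\<lambda>n. seq_b P14 Q14 n / seq_a P14 Q14 n) \<longlonglongrightarrow> zeta_int 2 / 7) \<and>
    ((\<lambda>n. seq_b P16 Q16 n / seq_a P16 Q16 n) \<longlonglongrightarrow> 7 / 32 * zeta_int 3) \<and>
    ((\<lambda>n. seq_b P18 Q18 n / seq_a P18 Q18 n) \<longlonglongrightarrow> L_chi3 3 / 3)"
  using limit_V10 limit_V12 limit_V14 limit_V16 limit_V18 by blast

end
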